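(* Let $n\ge 3$, $d=2$, $S=\mathrm{diag}(s_1,1)$ with $s_1>1$, and suppose that $m_1=m_2=\dots=m_n>0$. Assume that all $S$-balanced configurations (SBC) are non-degenerate. Let $\widehat q$ be a collinear central configuration and let $\eta_k<\dots<\eta_1<-U(\widehat q)<0$ be the distinct eigenvalues of $M^{-1}B(\widehat q)$. Then the following lower bounds on the number of planar SBC hold: 1. If $1<s_1<-\frac{\eta_1}{U(\widehat q)}$, there are at least $3n!-2(n-1)!$ planar SBC, of which at least $n!-2(n-1)!$ are not collinear. 2. If $-\frac{\eta_1}{U(\widehat q)}<s_1<-\frac{\eta_k}{U(\widehat q)}$, there are at least $4n!-2(n-1)!$ planar SBC, of which at least $2n!-2(n-1)!$ are not collinear. Moreover, for $n\in\mathbb N$ sufficiently large, there are at least $\big(3n-2(1+n^{\epsilon})\big)\cdot (n-1)!$ non-collinear SBC, for some constant $\epsilon=\epsilon(n)$ with $\epsilon(n)\to 0$ as $n\to+\infty$. 3. If $-\frac{\eta_k}{U(\widehat q)}<s_1$, there are at least $5n!-2(n-1)!-2$ planar SBC, of which at least $3n!-2(n-1)!-2$ are not collinear.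
   Context: Let $m_1,\dots,m_n>0$ be masses and $q=(q_1,\dots,q_n)\in(\mathbb R^d)^n$. Set $\mathbb X=\{q\in\mathbb R^{dn}:\sum_i m_iq_i=0\}$, $\Delta=\{q: q_i=q_j \text{ for some } i\neq j\}$, $U(q)=\sum_{i<j}\frac{m_im_j}{|q_i-q_j|}$ on $\mathbb X\setminus\Delta$. For $S=\mathrm{diag}(s_1,\dots,s_d)$ with positive entries let $I_S(q)=\sum_i m_i\langle Sq_i,q_i\rangle$, $\mathbb S=\{q\in\mathbb X: I_S(q)=1\}$, $\widehat{\mathbb S}=\mathbb S\setminus\Delta$, $\widehat U=U|_{\widehat{\mathbb S}}$. An $S$-balanced configuration (SBC) is a $q\in\mathbb X\setminus\Delta$ such that $\nabla_{q_i}U(q)+\lambda m_iSq_i=0$ for all $i$ and some $\lambda>0$; SBC are always normalized by $I_S(q)=1$, and are then exactly the critical points of $\widehat U$. An SBC is non-degenerate if it is a non-degenerate critical point of $\widehat U$. It is collinear (planar) if all $q_i$ lie in a common line (plane) through the origin. A collinear central configuration $\widehat q$ is a collinear configuration in $\mathbb X\setminus\Delta$ with $\nabla_{q_i}U(\widehat q)+\lambda m_i\widehat q_i=0$ for all $i$, normalized by $\sum_im_i|\widehat q_i|^2=1$. In the eigenvalue problem, $M=\mathrm{diag}(m_1,\dots,m_n)$ and $B(q)$ is the $n\times n$ matrix with $b_{ij}(q)=\frac{m_im_j}{|q_i-q_j|^3}$ for $i\ne j$ and $b_{ii}(q)=-\sum_{j\neq i}b_{ij}(q)$. The eigenvalues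 of $M^{-1}B(\widehat q)$ are $0$ and $-U(\widehat q)$ (both simple) and the remaining ones, all less than $-U(\widehat q)$, whose distinct values are denoted $\eta_k<\dots<\eta_1$. For equal masses these numbers and $U(\widehat q)$ do not depend on the choice of $\widehat q$. *)

theory Defs
  imports "HOL-Analysis.Analysis" "Jordan_Normal_Form.Char_Poly"
begin

text \<open>
  A configuration of \<open>n\<close> bodies in $R^d$ is a function \<open>q :: nat \<Rightarrow> real^'d\<close>; the bodies
  carry the indices \<open>0, ..., n - 1\<close>. All configurations below vanish at indices \<open>i \<ge> n\<close>, so that
  they correspond one-to-one to points of $R^{dn}$ and counting them is meaningful. The number
  \<open>n\<close> is a term and not a type, since it is quantified inside the theorem.
\<close>

type_synonym 'd config = "nat \<Rightarrow> real^'d"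

definition centered_configs :: "nat \<Rightarrow> (nat \<Rightarrow> real) \<Rightarrow> 'd::finite config set" where
  "centered_configs n m = {q. (\<forall>i\<ge>n. q i = 0) \<and> (\<Sum>i<n. m i *\<^sub>R q i) = 0}"

definition collisions :: "nat \<Rightarrow> 'd::finite config set" where
  "collisions n = {q. \<exists>i<n. \<exists>j<n. i \<noteq> j \<and> q i = q j}"

definition potential :: "nat \<Rightarrow> (nat \<Rightarrow> real) \<Rightarrow> 'd::finite config \<Rightarrow> real" where
  "potential n m q = (\<Sum>j<n. \<Sum>i<j. m i * m j / norm (q i - q j))"

definition diag :: "real^'d \<Rightarrow> real^'d^'d::finite" where
  "diag s = (\<chi> i j. if i = j then vec_nth s i else 0)"

definition inertia :: "nat \<Rightarrow> (nat \<Rightarrow> real) \<Rightarrow> real^'d^'d \<Rightarrow> 'd::finite config \<Rightarrow> real" where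
  "inertia n m S q = (\<Sum>i<n. m i * ((S *v q i) \<bullet> q i))"

definition collision_free_sphere ::
    "nat \<Rightarrow> (nat \<Rightarrow> real) \<Rightarrow> real^'d^'d \<Rightarrow> 'd::finite config set" where
  "collision_free_sphere n m S =
     {q \<in> centered_configs n m. inertia n m S q = 1} - collisions n"

text \<open>
  The equations $\nabla_{q_i} U(q) + \lambda m_i S q_i = 0$. The partial gradient is that of \<open>U\<close>
  as a function of the \<open>i\<close>-th position alone, the other positions being kept fixed
  (the formula for \<open>U\<close> does not need the center of mass to be at the origin).
\<close>

definition balance_equations ::
    "nat \<Rightarrow> (nat \<Rightarrow> real) \<Rightarrow> real^'d^'d \<Rightarrow> real \<Rightarrow> 'd::finite config \<Rightarrow> bool" where
  "balance_equations n m S l q \<longleftrightarrow>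
     (\<forall>i<n. \<exists>g. GDERIV (\<lambda>x. potential n m (q(i := x))) (q i) :> g \<and>
                g + (l * m i) *\<^sub>R (S *v q i) = 0)"

definition is_SBC :: "nat \<Rightarrow> (nat \<Rightarrow> real) \<Rightarrow> real^'d^'d \<Rightarrow> 'd::finite config \<Rightarrow> bool" where
  "is_SBC n m S q \<longleftrightarrow>
     q \<in> centered_configs n m - collisions n \<and> inertia n m S q = 1 \<and>
     (\<exists>l>0. balance_equations n m S l q)"

definition collinear_config :: "nat \<Rightarrow> 'd::finite config \<Rightarrow> bool" where
  "collinear_config n q \<longleftrightarrow> (\<exists>L. subspace L \<and> dim L = 1 \<and> (\<forall>i<n. q i \<in> L))"

definition planar_config :: "nat \<Rightarrow> 'd::finite config \<Rightarrow> bool" where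
  "planar_config n q \<longleftrightarrow> (\<exists>P. subspace P \<and> dim P = 2 \<and> (\<forall>i<n. q i \<in> P))"

text \<open>
  Non-degenerate critical points of a function \<open>f\<close> on a submanifold \<open>A\<close> of configuration space,
  expressed through curves. At a critical point \<open>p\<close>, the Hessian is the symmetric bilinear form
  on the tangent space whose quadratic form sends \<open>v\<close> to the second derivative at 0 of
  \<open>f \<circ> c\<close>, for any twice continuously differentiable curve \<open>c\<close> in \<open>A\<close> with \<open>c 0 = p\<close> and
  velocity \<open>v\<close>; the value does not depend on \<open>c\<close> because \<open>p\<close> is critical.
\<close>

definition C2_curve ::
    "'d::finite config set \<Rightarrow> 'd config \<Rightarrow> 'd config \<Rightarrow> (real \<Rightarrow> 'd config) \<Rightarrow> bool" where
  "C2_curve A p v c \<longleftrightarrow> c 0 = p \<and>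
     (\<exists>e>0. \<exists>c' c''. c' 0 = v \<and>
        (\<forall>t\<in>{-e<..<e}. c t \<in> A \<and>
           (\<forall>i. ((\<lambda>u. c u i) has_vector_derivative c' t i) (at t) \<and>
                ((\<lambda>u. c' u i) has_vector_derivative c'' t i) (at t))) \<and>
        (\<forall>i. continuous_on {-e<..<e} (\<lambda>u. c'' u i)))"

definition tangent_vectors :: "'d::finite config set \<Rightarrow> 'd config \<Rightarrow> 'd config set" where
  "tangent_vectors A p = {v. \<exists>c. C2_curve A p v c}"

definition critical_point ::
    "('d::finite config \<Rightarrow> real) \<Rightarrow> 'd config set \<Rightarrow> 'd config \<Rightarrow> bool" where
  "critical_point f A p \<longleftrightarrow> p \<in> A \<and>
     (\<forall>v c. C2_curve A p v c \<longrightarrow> ((f \<circ> c) has_real_derivative 0) (at 0))"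

definition hessian_quadratic ::
    "('d::finite config \<Rightarrow> real) \<Rightarrow> 'd config set \<Rightarrow> 'd config \<Rightarrow> 'd config \<Rightarrow> real" where
  "hessian_quadratic f A p v =
     (THE h. \<forall>c. C2_curve A p v c \<longrightarrow> (deriv ^^ 2) (f \<circ> c) 0 = h)"

definition hessian ::
    "('d::finite config \<Rightarrow> real) \<Rightarrow> 'd config set \<Rightarrow> 'd config \<Rightarrow> 'd config \<Rightarrow> 'd config \<Rightarrow> real" where
  "hessian f A p v w =
     (hessian_quadratic f A p (\<lambda>i. v i + w i)
        - hessian_quadratic f A p v - hessian_quadratic f A p w) / 2"

definition nondegenerate_critical_point ::
    "('d::finite config \<Rightarrow> real) \<Rightarrow> 'd config set \<Rightarrow> 'd config \<Rightarrow> bool" where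
  "nondegenerate_critical_point f A p \<longleftrightarrow> critical_point f A p \<and>
     (\<forall>v\<in>tangent_vectors A p.
        (\<forall>w\<in>tangent_vectors A p. hessian f A p v w = 0) \<longrightarrow> v = (\<lambda>i. 0))"

definition nondegenerate_SBC ::
    "nat \<Rightarrow> (nat \<Rightarrow> real) \<Rightarrow> real^'d^'d \<Rightarrow> 'd::finite config \<Rightarrow> bool" where
  "nondegenerate_SBC n m S q \<longleftrightarrow> is_SBC n m S q \<and>
     nondegenerate_critical_point (potential n m) (collision_free_sphere n m S) q"

definition collinear_CC :: "nat \<Rightarrow> (nat \<Rightarrow> real) \<Rightarrow> 'd::finite config \<Rightarrow> bool" where
  "collinear_CC n m q \<longleftrightarrow>
     q \<in> centered_configs n m - collisions n \<and> collinear_config n q \<and>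
     (\<Sum>i<n. m i * (norm (q i))\<^sup>2) = 1 \<and>
     (\<exists>l. balance_equations n m (Finite_Cartesian_Product.mat 1) l q)"

definition B_entry :: "(nat \<Rightarrow> real) \<Rightarrow> 'd::finite config \<Rightarrow> nat \<Rightarrow> nat \<Rightarrow> real" where
  "B_entry m q i j = m i * m j / norm (q i - q j) ^ 3"

definition B_matrix :: "nat \<Rightarrow> (nat \<Rightarrow> real) \<Rightarrow> 'd::finite config \<Rightarrow> real Matrix.mat" where
  "B_matrix n m q = Matrix.mat n n
     (\<lambda>(i, j). if i = j then - (\<Sum>k\<in>{..<n} - {i}. B_entry m q i k) else B_entry m q i j)"

text \<open>
  \<open>\<eta> k < ... < \<eta> 1\<close> are the distinct eigenvalues of $M^{-1} B(q)$ other than the two eigenvalues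
  \<open>0\<close> and \<open>- U(q)\<close>, which are present (and simple) for every collinear central configuration.
  The matrix $M^{-1}$ is the diagonal matrix of the inverse masses.
\<close>

definition remaining_eigenvalues ::
    "nat \<Rightarrow> (nat \<Rightarrow> real) \<Rightarrow> 'd::finite config \<Rightarrow> nat \<Rightarrow> (nat \<Rightarrow> real) \<Rightarrow> bool" where
  "remaining_eigenvalues n m q k \<eta> \<longleftrightarrow>
     (\<forall>i\<in>{1..k}. \<forall>j\<in>{1..k}. i < j \<longrightarrow> \<eta> j < \<eta> i) \<and>
     \<eta> ` {1..k} =
       {x. Char_Poly.eigenvalue (mat_diag n (\<lambda>i. inverse (m i)) * B_matrix n m q) x}
         - {0, - potential n m q}"

text \<open>Lower bounds on the cardinality of a set not assumed to be finite.\<close>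

definition at_least :: "real \<Rightarrow> 'a set \<Rightarrow> bool" where
  "at_least x A \<longleftrightarrow> (\<exists>F. finite F \<and> F \<subseteq> A \<and> x \<le> real (card F))"

end

theory Submission
  imports Defs
begin

text \<open>
  Critical points of the potential on the ellipsoid are, up to scaling, the critical points of the
  energy \<open>U + I_S / 2\<close> on the whole configuration space. Since the masses are equal, the symmetric
  group acts freely on them, so the claimed bounds only require \<open>2\<close> or \<open>3\<close> similarity classes (up to
  scaling and relabelling) of non-collinear critical points, besides the two collinear ones
  obtained by placing \<open>qhat\<close> on a coordinate axis.

  No Morse theory is needed to find them: the energy attains its minimum on the configurations
  that are mapped to themselves by the reflection \<open>(x, y) \<mapsto> (-x, y)\<close> with \<open>k\<close> pairs of bodies
  exchanged, and this minimizer is critical because the gradient respects the symmetry. It has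
  exactly \<open>n - 2 k\<close> bodies on the vertical axis, so different \<open>k\<close> give different classes, and it is
  not collinear because a horizontal configuration can be improved by turning two neighbours.
  This yields \<open>floor (n / 2)\<close> classes, enough except for \<open>n \<le> 5\<close>. For \<open>n = 3\<close> an isosceles triangle
  and its reflection \<open>(x, y) \<mapsto> (x, -y)\<close> are not similar. For \<open>n = 4, 5\<close> the third class is needed
  only if \<open>s\<^sub>1 > - \<eta>\<^sub>k / U\<close>, and \<open>- \<eta>\<^sub>k / U \<ge> 12 / 5\<close> by a Rayleigh quotient; then there is a critical
  kite (four or five bodies, one symmetric pair) that is not similar to its reflection.
  The sequence \<open>\<epsilon>\<close> can be taken to be constantly zero.
\<close>

section \<open>Forces and energy\<close>

text \<open>Scaling \<open>q\<close> by r multiplies the forces by r^-2 and \<open>S q\<close> by r,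
  so a positive multiplier can be traded for the size of \<open>q\<close>. This is why free critical
  points of an energy suffice. With 1 / 0 = 0 the energy does not see collisions, so injectivity is
  carried along as a separate hypothesis.

  Unwanted minimizers are excluded by bending: bodies on a common horizontal line move vertically in
  opposite directions with their centre of mass fixed. The inertia then changes only to second
  order, while distances along the line grow. The balance equations say how close these bodies are,
  hence how much is gained. For plain horizontal configurations \<open>s > 1\<close> is enough; the
  kites need the margin 12/5 that the spectral bound supplies.

  The obstacle for four and five bodies is that a symmetric minimizer may be its own reflection up
  to relabelling. For four bodies an order constraint is imposed, whose wall must be shown to repel
  the minimizer; for five bodies the self-reflected case is a cross, which is excluded directly. The
  displacements x / 4 and 5 x / 36 are chosen so that the triples 3, 4, 5 and 5, 12, 13 make the new
  distances rational multiples of x.\<close>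

lemma potential_double_sum:
  "potential n m q = (\<Sum>i<n. \<Sum>j<n. m i * m j / norm (q i - q j)) / 2"
proof (induction n)
  case 0
  then show ?case by (simp add: potential_def)
next
  case (Suc n)
  have sym: "(\<Sum>i<n. m i * m n / norm (q i - q n)) = (\<Sum>i<n. m n * m i / norm (q n - q i))"
    by (simp add: norm_minus_commute mult.commute)
  have "potential (Suc n) m q = potential n m q + (\<Sum>i<n. m i * m n / norm (q i - q n))"
    by (simp add: potential_def)
  also have "2 * \<dots> = (\<Sum>i<Suc n. \<Sum>j<Suc n. m i * m j / norm (q i - q j))"
    using Suc sym by (simp add: sum.distrib)
  finally show ?case
    by simp
qed

lemma GDERIV_sum:
  assumes "\<And>i. i \<in> I \<Longrightarrow> GDERIV (f i) x :> D i"
  shows "GDERIV (\<lambda>x. \<Sum>i\<in>I. f i x) x :> (\<Sum>i\<in>I. D i)"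
  using assms unfolding gderiv_def inner_sum_right by (intro has_derivative_sum) auto

lemma GDERIV_unique:
  assumes "GDERIV f x :> D" "GDERIV f x :> E"
  shows "D = E"
proof -
  have "(\<lambda>h. inner h D) = (\<lambda>h. inner h E)"
    using assms has_derivative_unique unfolding gderiv_def by blast
  then show ?thesis
    by (metis vector_eq_ldot)
qed

lemma GDERIV_inverse_distance:
  fixes a x :: "'a::real_inner"
  assumes "x \<noteq> a"
  shows "GDERIV (\<lambda>y. c / norm (y - a)) x :> - ((c / norm (x - a) ^ 3) *\<^sub>R (x - a))"
proof -
  have pos: "norm (x - a) > 0" using assms by simp
  have "GDERIV (\<lambda>y. norm (y - a)) x :> sgn (x - a)"
    unfolding gderiv_def
    by (rule has_derivative_eq_rhs[OF has_derivative_compose[of "\<lambda>y. y - a" "\<lambda>h. h", OF _ has_derivative_norm]])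
      (use assms in \<open>auto intro!: derivative_eq_intros\<close>)
  moreover have "DERIV (\<lambda>r. c / r) (norm (x - a)) :> - (c / norm (x - a) ^ 2)"
    using pos by (auto intro!: derivative_eq_intros simp: power2_eq_square)
  ultimately have "GDERIV (\<lambda>y. c / norm (y - a)) x :> (- (c / norm (x - a) ^ 2)) *\<^sub>R sgn (x - a)"
    by (rule GDERIV_DERIV_compose)
  then show ?thesis
    by (simp add: sgn_div_norm power3_eq_cube power2_eq_square field_simps)
qed

lemma GDERIV_potential:
  fixes q :: "'d::finite config"
  assumes inj: "inj_on q {..<n}" and i: "i < n"
  shows "GDERIV (\<lambda>x. potential n m (q(i := x))) (q i) :>
    - (\<Sum>j<n. (m i * m j / norm (q i - q j) ^ 3) *\<^sub>R (q i - q j))"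
proof -
  define I where "I = {..<n} - {i}"
  have I: "{..<n} = insert i I" "finite I" "i \<notin> I"
    using i by (auto simp: I_def)
  \<comment> \<open>\<open>C\<close> collects the interactions that avoid body \<open>i\<close>.
    Body \<open>i\<close> meets every other body twice in the double sum, which cancels the factor
    1/2.\<close>
  define C where "C = (\<Sum>a\<in>I. \<Sum>b\<in>I. m a * m b / norm (q a - q b)) / 2"
  have eq: "potential n m (q(i := x)) = C + (\<Sum>j\<in>I. m i * m j / norm (x - q j))" for x
  proof -
    have 1: "(\<Sum>b\<in>I. m a * m b / norm ((q(i := x)) a - (q(i := x)) b))
        = (\<Sum>b\<in>I. m a * m b / norm (q a - q b))" if "a \<in> I" for a
      using I that by (intro sum.cong) auto
    have 2: "(\<Sum>b\<in>I. m i * m b / norm ((q(i := x)) i - (q(i := x)) b)) = (\<Sum>b\<in>I. m i * m b / norm (x - q b))"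
      using I by (intro sum.cong) auto
    have 3: "(\<Sum>a\<in>I. m a * m i / norm ((q(i := x)) a - (q(i := x)) i)) = (\<Sum>b\<in>I. m i * m b / norm (x - q b))"
      using I by (intro sum.cong) (auto simp: norm_minus_commute mult.commute)
    show ?thesis
      unfolding potential_double_sum I(1)
      using I by (simp add: sum.distrib 1 2 3 C_def add_divide_distrib del: fun_upd_apply)
  qed
  have "GDERIV (\<lambda>x. C + (\<Sum>j\<in>I. m i * m j / norm (x - q j))) (q i) :>
      0 + (\<Sum>j\<in>I. - ((m i * m j / norm (q i - q j) ^ 3) *\<^sub>R (q i - q j)))"
    using inj i by (intro GDERIV_add GDERIV_const GDERIV_sum GDERIV_inverse_distance)
      (auto simp: I_def inj_on_def)
  also have "0 + (\<Sum>j\<in>I. - ((m i * m j / norm (q i - q j) ^ 3) *\<^sub>R (q i - q j)))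
      = - (\<Sum>j<n. (m i * m j / norm (q i - q j) ^ 3) *\<^sub>R (q i - q j))"
    unfolding I(1) using I by (simp add: sum_negf)
  finally show ?thesis
    by (simp only: eq)
qed

text \<open>The gradient in \<open>balance_equations\<close> is only asserted to exist; uniqueness
  of gradients turns the condition into an explicit force equation.\<close>

lemma balance_equations_iff:
  fixes q :: "'d::finite config"
  assumes "inj_on q {..<n}"
  shows "balance_equations n m S l q \<longleftrightarrow>
    (\<forall>i<n. (l * m i) *\<^sub>R (S *v q i) = (\<Sum>j<n. (m i * m j / norm (q i - q j) ^ 3) *\<^sub>R (q i - q j)))"
proof -
  have "(\<exists>g. GDERIV (\<lambda>x. potential n m (q(i := x))) (q i) :> g \<and> g + (l * m i) *\<^sub>R (S *v q i) = 0) \<longleftrightarrow>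
      (l * m i) *\<^sub>R (S *v q i) = (\<Sum>j<n. (m i * m j / norm (q i - q j) ^ 3) *\<^sub>R (q i - q j))"
    (is "?L \<longleftrightarrow> ?a = ?b") if i: "i < n" for i
  proof -
    have "?L \<longleftrightarrow> - ?b + ?a = 0"
      using GDERIV_potential[OF assms i] GDERIV_unique by blast
    then show ?thesis
      by simp
  qed
  then show ?thesis
    unfolding balance_equations_def by simp
qed

text \<open>The self-interaction terms of the double sums vanish because of \<open>1 / 0 = 0\<close>.\<close>

definition repulsion :: "nat \<Rightarrow> 'd::finite config \<Rightarrow> nat \<Rightarrow> real^'d" where
  "repulsion n q i = (\<Sum>j<n. (1 / norm (q i - q j) ^ 3) *\<^sub>R (q i - q j))"

text \<open>Equal masses and the normalization are absorbed into the free multiplier. Centring is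
  not demanded because it follows from \<open>sum_repulsion\<close>.\<close>

definition balanced :: "nat \<Rightarrow> real^'d^'d \<Rightarrow> 'd::finite config \<Rightarrow> bool" where
  "balanced n S q \<longleftrightarrow> (\<forall>i\<ge>n. q i = 0) \<and> inj_on q {..<n} \<and>
     (\<exists>\<mu>>0. \<forall>i<n. \<mu> *\<^sub>R (S *v q i) = repulsion n q i)"

text \<open>Action equals reaction: exchanging the summation indices pairs each force with its
  opposite, so only differences of \<open>f\<close> survive. Constant \<open>f\<close> gives zero
  total force; \<open>f = q\<close> gives the virial identity behind
  \<open>qhat_balance\<close>.\<close>

lemma sum_repulsion_inner:
  fixes q f :: "'d::finite config"
  shows "(\<Sum>i<n. repulsion n q i \<bullet> f i)
    = (\<Sum>i<n. \<Sum>j<n. ((q i - q j) \<bullet> (f i - f j)) / norm (q i - q j) ^ 3) / 2"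
proof -
  let ?c = "\<lambda>i j. 1 / norm (q i - q j) ^ 3"
  have "(\<Sum>i<n. \<Sum>j<n. ?c i j * ((q i - q j) \<bullet> f j)) = (\<Sum>i<n. \<Sum>j<n. ?c j i * ((q j - q i) \<bullet> f i))"
    by (rule sum.swap)
  also have "\<dots> = - (\<Sum>i<n. \<Sum>j<n. ?c i j * ((q i - q j) \<bullet> f i))"
    unfolding sum_negf[symmetric]
    by (intro sum.cong refl) (simp add: norm_minus_commute inner_diff_left minus_divide_left)
  finally have "(\<Sum>i<n. \<Sum>j<n. ?c i j * ((q i - q j) \<bullet> (f i - f j)))
      = 2 * (\<Sum>i<n. \<Sum>j<n. ?c i j * ((q i - q j) \<bullet> f i))"
    by (simp add: inner_diff_right right_diff_distrib sum_subtractf)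
  then show ?thesis
    by (simp add: repulsion_def inner_sum_left)
qed

lemma sum_repulsion: "(\<Sum>i<n. repulsion n q i) = (0 :: real^'d::finite)"
proof -
  have "(\<Sum>i<n. repulsion n q i) \<bullet> v = 0" for v :: "real^'d"
    using sum_repulsion_inner[of n q "\<lambda>i. v"] by (simp add: inner_sum_left)
  then show ?thesis
    by (metis inner_eq_zero_iff)
qed

section \<open>Planar coordinates and the energy\<close>

abbreviation hor :: "real^2 \<Rightarrow> real" where
  "hor p \<equiv> vec_nth p 1"

abbreviation ver :: "real^2 \<Rightarrow> real" where
  "ver p \<equiv> vec_nth p 2"

abbreviation point :: "real \<Rightarrow> real \<Rightarrow> real^2" where
  "point a b \<equiv> vector [a, b]"

abbreviation aniso :: "real \<Rightarrow> real^2^2" where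
  "aniso s \<equiv> diag (vector [s, 1])"

lemma plane_eq_iff: "p = q \<longleftrightarrow> hor p = hor q \<and> ver p = ver q"
  by (simp add: Finite_Cartesian_Product.vec_eq_iff forall_2)

lemma norm_plane: "norm p = sqrt ((hor p)\<^sup>2 + (ver p)\<^sup>2)"
  by (simp add: norm_vec_def L2_set_def UNIV_2)

lemma inner_plane: "p \<bullet> q = hor p * hor q + ver p * ver q"
  by (simp add: inner_vec_def UNIV_2)

lemma aniso_mult: "aniso s *v p = point (s * hor p) (ver p)"
  by (simp add: Finite_Cartesian_Product.vec_eq_iff forall_2 diag_def matrix_vector_mult_def UNIV_2)

text \<open>This is 2 U + I_S for unit masses, since every pair is counted twice.\<close>

definition energy :: "nat \<Rightarrow> real \<Rightarrow> 2 config \<Rightarrow> real" where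
  "energy n s q = (\<Sum>i<n. \<Sum>j<n. 1 / norm (q i - q j)) + (\<Sum>i<n. s * (hor (q i))\<^sup>2 + (ver (q i))\<^sup>2)"

lemma inverse_norm_line_derivative:
  fixes p w :: "'a::real_inner"
  assumes "p \<noteq> 0"
  shows "((\<lambda>t. 1 / norm (p - t *\<^sub>R w)) has_real_derivative (p \<bullet> w) / norm p ^ 3) (at 0)"
proof -
  have pos: "p \<bullet> p > 0" using assms by simp
  have "((\<lambda>t. 1 / sqrt (p \<bullet> p - 2 * t * (p \<bullet> w) + t\<^sup>2 * (w \<bullet> w))) has_real_derivative
      (p \<bullet> w) / (sqrt (p \<bullet> p) * (p \<bullet> p))) (at 0)"
    using pos by (auto intro!: derivative_eq_intros simp: field_simps simp del: inner_gt_zero_iff)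
  moreover have "norm (p - t *\<^sub>R w) = sqrt (p \<bullet> p - 2 * t * (p \<bullet> w) + t\<^sup>2 * (w \<bullet> w))" for t
    by (simp add: norm_eq_sqrt_inner inner_diff_left inner_diff_right inner_commute power2_eq_square
        algebra_simps)
  moreover have "norm p ^ 3 = sqrt (p \<bullet> p) * (p \<bullet> p)"
    using pos by (simp add: norm_eq_sqrt_inner power3_eq_cube)
  ultimately show ?thesis
    by simp
qed

text \<open>The line runs in direction \<open>- f\<close>, so that half the energy gradient as
  \<open>f\<close> gives a descent line.\<close>

lemma energy_derivative:
  assumes inj: "inj_on q {..<n}"
  shows "((\<lambda>t. energy n s (\<lambda>i. q i - t *\<^sub>R f i)) has_real_derivative
    2 * (\<Sum>i<n. (repulsion n q i - aniso s *v q i) \<bullet> f i)) (at 0)"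
proof -
  have 1: "((\<lambda>t. 1 / norm (q i - t *\<^sub>R f i - (q j - t *\<^sub>R f j))) has_real_derivative
      ((q i - q j) \<bullet> (f i - f j)) / norm (q i - q j) ^ 3) (at 0)" if "i < n" "j < n" for i j
  proof (cases "i = j")
    case False
    then have "q i - q j \<noteq> 0"
      using inj that by (auto simp: inj_on_def)
    from inverse_norm_line_derivative[OF this, of "f i - f j"] show ?thesis
      by (simp add: algebra_simps)
  qed simp
  have 2: "((\<lambda>t. s * (hor (q i - t *\<^sub>R f i))\<^sup>2 + (ver (q i - t *\<^sub>R f i))\<^sup>2) has_real_derivative
      - 2 * ((aniso s *v q i) \<bullet> f i)) (at 0)" for i
    by (auto intro!: derivative_eq_intros simp: inner_plane aniso_mult algebra_simps)
  have "((\<lambda>t. energy n s (\<lambda>i. q i - t *\<^sub>R f i)) has_real_derivative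
      (\<Sum>i<n. \<Sum>j<n. ((q i - q j) \<bullet> (f i - f j)) / norm (q i - q j) ^ 3)
      + (\<Sum>i<n. - 2 * ((aniso s *v q i) \<bullet> f i))) (at 0)"
    unfolding energy_def by (intro DERIV_add DERIV_sum 1 2) auto
  moreover have "2 * (\<Sum>i<n. repulsion n q i \<bullet> f i)
      = (\<Sum>i<n. \<Sum>j<n. ((q i - q j) \<bullet> (f i - f j)) / norm (q i - q j) ^ 3)"
    by (simp add: sum_repulsion_inner)
  ultimately show ?thesis
    by (simp add: inner_diff_left sum_subtractf sum_distrib_left right_diff_distrib sum_negf)
qed

text \<open>Minimality is only needed along the gradient of the energy, so that the lemma also applies
  to minimizers among the configurations with a given symmetry.\<close>

lemma balanced_if_gradient_line_minimum:
  assumes inj: "inj_on q {..<n}" and d: "d > 0"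
    and f: "\<And>i. i < n \<Longrightarrow> f i = aniso s *v q i - repulsion n q i"
    and min: "\<And>t. \<bar>t\<bar> < d \<Longrightarrow> energy n s q \<le> energy n s (\<lambda>i. q i - t *\<^sub>R f i)"
  shows "\<forall>i<n. aniso s *v q i = repulsion n q i"
proof -
  have "2 * (\<Sum>i<n. (repulsion n q i - aniso s *v q i) \<bullet> f i) = 0"
    using DERIV_local_min[OF energy_derivative[OF inj, of s f] d] min by simp
  moreover have "(repulsion n q i - aniso s *v q i) \<bullet> f i = - (f i \<bullet> f i)" if "i < n" for i
    by (simp add: f[OF that] inner_diff_left inner_diff_right inner_commute)
  ultimately have "(\<Sum>i<n. f i \<bullet> f i) = 0"
    by (simp add: sum_negf)
  then have "\<forall>i<n. f i = 0"
    by (simp add: sum_nonneg_eq_0_iff)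
  then show ?thesis
    using f by simp
qed

lemma energy_nonneg:
  assumes "s \<ge> 0"
  shows "energy n s q \<ge> 0"
  unfolding energy_def using assms by (intro add_nonneg_nonneg sum_nonneg) auto

lemma energy_bounds:
  assumes s: "s \<ge> 1" and i: "i < n"
  shows "j < n \<Longrightarrow> 1 / norm (q i - q j) \<le> energy n s q" "(norm (q i))\<^sup>2 \<le> energy n s q"
proof -
  have I: "0 \<le> s * (hor (q i))\<^sup>2 + (ver (q i))\<^sup>2" for i
    using s by simp
  have "1 / norm (q i - q j) \<le> (\<Sum>j<n. 1 / norm (q i - q j))" if "j < n"
    using that by (intro member_le_sum) auto
  also have "\<dots> \<le> (\<Sum>i<n. \<Sum>j<n. 1 / norm (q i - q j))"
    using i by (intro member_le_sum[of i "{..<n}" "\<lambda>i. \<Sum>j<n. 1 / norm (q i - q j)"] sum_nonneg) auto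
  also have "\<dots> \<le> energy n s q"
    unfolding energy_def using I by (simp add: sum_nonneg)
  finally show "j < n \<Longrightarrow> 1 / norm (q i - q j) \<le> energy n s q" .
  have "(norm (q i))\<^sup>2 = (hor (q i))\<^sup>2 + (ver (q i))\<^sup>2"
    by (simp add: norm_plane)
  also have "\<dots> \<le> s * (hor (q i))\<^sup>2 + (ver (q i))\<^sup>2"
    using s by (simp add: mult_right_mono[of 1 s "(hor (q i))\<^sup>2", simplified])
  also have "\<dots> \<le> (\<Sum>i<n. s * (hor (q i))\<^sup>2 + (ver (q i))\<^sup>2)"
    using i I by (intro member_le_sum[of i "{..<n}" "\<lambda>i. s * (hor (q i))\<^sup>2 + (ver (q i))\<^sup>2"]) auto
  also have "\<dots> \<le> energy n s q"
    unfolding energy_def by (simp add: sum_nonneg)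
  finally show "(norm (q i))\<^sup>2 \<le> energy n s q" .
qed

text \<open>Tychonoff: configurations are functions on all naturals with the product topology, and a
  box in infinitely many coordinates is still compact.\<close>

lemma compact_coordinate_box:
  "compact {q :: nat \<Rightarrow> 'a::euclidean_space. \<forall>i. norm (q i) \<le> R}"
proof -
  have "compactin (product_topology (\<lambda>i. euclidean) UNIV) (PiE UNIV (\<lambda>i::nat. cball (0 :: 'a) R))"
    by (subst compactin_PiE) simp
  moreover have "PiE UNIV (\<lambda>i::nat. cball (0 :: 'a) R) = {q. \<forall>i. norm (q i) \<le> R}"
    by (auto simp: PiE_def Pi_def)
  ultimately show ?thesis
    by (simp add: euclidean_product_topology)
qed

text \<open>An energy bound confines the bodies to a ball and keeps distinct bodies a fixed distance
  apart. Competitors below the energy of \<open>z0\<close> therefore lie in a compact set that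
  contains no collisions.\<close>

lemma energy_attains_minimum:
  assumes s: "s \<ge> 1" and clo: "closed Z" and Z: "\<And>q i. q \<in> Z \<Longrightarrow> i \<ge> n \<Longrightarrow> q i = 0"
    and z0: "z0 \<in> Z" "inj_on z0 {..<n}"
  obtains q where "q \<in> Z" "inj_on q {..<n}"
    "\<And>z. z \<in> Z \<Longrightarrow> inj_on z {..<n} \<Longrightarrow> energy n s q \<le> energy n s z"
proof -
  \<comment> \<open>The added 1 gives \<open>c \<ge> 1\<close>, so a bound \<open>c\<close> on a
    squared norm also bounds the norm.\<close>
  define c where "c = energy n s z0 + 1"
  have c: "c \<ge> 1"
    using s by (simp add: c_def energy_nonneg)
  \<comment> \<open>The separation is a closed condition that implies injectivity, which makes the
    energy continuous on \<open>K\<close>.\<close>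
  define K where "K = Z \<inter> {q. \<forall>i. norm (q i) \<le> c}
    \<inter> {q. \<forall>i j. i < n \<and> j < n \<and> i \<noteq> j \<longrightarrow> 1 / c \<le> norm (q i - q j)}"
  have inK: "z \<in> K" if z: "z \<in> Z" "inj_on z {..<n}" "energy n s z \<le> energy n s z0" for z
  proof -
    have "norm (z i) \<le> c" for i
    proof (cases "i < n")
      case True
      have "(norm (z i))\<^sup>2 \<le> c"
        using energy_bounds(2)[OF s True, of z] z by (simp add: c_def)
      also have "c \<le> c\<^sup>2"
        using c by (simp add: power2_eq_square)
      finally show ?thesis
        using c power2_le_imp_le by fastforce
    qed (use Z[OF z(1), of i] c in auto)
    moreover have "1 / c \<le> norm (z i - z j)" if "i < n" "j < n" "i \<noteq> j" for i j
    proof -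
      have "norm (z i - z j) > 0"
        using that z by (auto simp: inj_on_def)
      moreover have "1 / norm (z i - z j) \<le> c"
        using energy_bounds(1)[OF s that(1,2), of z] z by (simp add: c_def)
      ultimately show ?thesis
        using c by (simp add: field_simps)
    qed
    ultimately show ?thesis
      using z by (simp add: K_def)
  qed
  have Kinj: "inj_on q {..<n}" if "q \<in> K" for q
  proof (rule inj_onI, rule ccontr)
    fix i j assume ij: "i \<in> {..<n}" "j \<in> {..<n}" "q i = q j" "i \<noteq> j"
    have "1 / c \<le> norm (q i - q j)"
      using that ij(1,2,4) by (simp add: K_def)
    then show False
      using ij c by simp
  qed
  have "compact K"
    unfolding K_def imp_conjL
    by (intro compact_Int_closed closed_Int_compact clo compact_coordinate_box closed_Collect_all
        closed_Collect_imp open_Collect_const closed_Collect_le continuous_intros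
        continuous_on_product_coordinates)
  moreover have "continuous_on K (energy n s)"
  proof -
    have coord: "continuous_on K (\<lambda>q. q i)" for i
      by (rule continuous_on_subset[OF continuous_on_product_coordinates]) simp
    have "continuous_on K (\<lambda>q. 1 / norm (q i - q j))" if "i < n" "j < n" for i j
    proof (cases "i = j")
      case False
      then show ?thesis
        using that Kinj by (intro continuous_intros coord) (auto simp: inj_on_def)
    qed simp
    then have "continuous_on K (\<lambda>q. \<Sum>i<n. \<Sum>j<n. 1 / norm (q i - q j))"
      by (intro continuous_on_sum) auto
    moreover have "continuous_on K (\<lambda>q. \<Sum>i<n. s * (hor (q i))\<^sup>2 + (ver (q i))\<^sup>2)"
      by (intro continuous_intros coord)
    ultimately show ?thesis
      unfolding energy_def by (rule continuous_on_add)
  qed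
  moreover have "K \<noteq> {}"
    using inK[of z0] z0 by auto
  ultimately obtain q where q: "q \<in> K" "\<And>z. z \<in> K \<Longrightarrow> energy n s q \<le> energy n s z"
    using continuous_attains_inf by metis
  have "energy n s q \<le> energy n s z" if "z \<in> Z" "inj_on z {..<n}" for z
    using inK[OF that] q(2)[of z] q(2)[OF inK[OF z0]] by linarith
  then show thesis
    using that[of q] q(1) Kinj by (auto simp: K_def)
qed

section \<open>Minimizers with mirror symmetry\<close>

lemma collinear_configI:
  assumes "e \<noteq> 0" "\<And>i. i < n \<Longrightarrow> q i = c i *\<^sub>R e"
  shows "collinear_config n q"
proof -
  have "dim (span {e}) = 1"
    using assms(1) by (subst dim_span_eq_card_independent) auto
  moreover have "q i \<in> span {e}" if "i < n" for i
    using assms(2)[OF that] by (simp add: span_scale span_base)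
  ultimately show ?thesis
    unfolding collinear_config_def using subspace_span[of "{e}"] by blast
qed

lemma not_collinear_configI:
  assumes ij: "i < n" "j < n" and det: "hor (q i) * ver (q j) \<noteq> ver (q i) * hor (q j)"
  shows "\<not> collinear_config n q"
proof
  assume "collinear_config n q"
  then obtain L where L: "subspace L" "dim L = 1" "\<forall>i<n. q i \<in> L"
    by (auto simp: collinear_config_def)
  obtain B where B: "L \<subseteq> span B" "card B = dim L"
    using basis_exists by metis
  then obtain u where "B = {u}"
    using L(2) by (auto simp: card_1_singleton_iff)
  then have "q i \<in> span {u}" "q j \<in> span {u}"
    using B L(3) ij by auto
  then obtain a b where "q i = a *\<^sub>R u" "q j = b *\<^sub>R u"
    by (auto simp: span_singleton)
  then show False
    using det by simp
qed

definition mirror :: "real^2 \<Rightarrow> real^2" where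
  "mirror p = point (- hor p) (ver p)"

definition symmetric_configs :: "nat \<Rightarrow> (nat \<Rightarrow> nat) \<Rightarrow> 2 config set" where
  "symmetric_configs n \<sigma> = {q. (\<forall>i\<ge>n. q i = 0) \<and> (\<forall>i<n. q (\<sigma> i) = mirror (q i))}"

lemma hor_mirror [simp]: "hor (mirror p) = - hor p"
  and ver_mirror [simp]: "ver (mirror p) = ver p"
  by (simp_all add: mirror_def)

lemma closed_symmetric_configs: "closed (symmetric_configs n \<sigma>)"
proof -
  have eq: "symmetric_configs n \<sigma> = {q. (\<forall>i\<ge>n. q i = 0) \<and>
      (\<forall>i<n. hor (q (\<sigma> i)) = - hor (q i) \<and> ver (q (\<sigma> i)) = ver (q i))}"
    by (simp add: symmetric_configs_def plane_eq_iff)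
  show ?thesis
    unfolding eq
    by (intro closed_Collect_conj closed_Collect_all closed_Collect_imp open_Collect_const
        closed_Collect_eq continuous_intros continuous_on_product_coordinates)
qed

lemma norm_mirror_diff: "norm (mirror p - mirror q) = norm (p - q)"
  by (simp add: norm_plane power2_commute)

lemma repulsion_mirror:
  assumes \<sigma>: "\<sigma> permutes {..<n}" and q: "q \<in> symmetric_configs n \<sigma>" and i: "i < n"
  shows "repulsion n q (\<sigma> i) = mirror (repulsion n q i)"
proof -
  let ?c = "\<lambda>j. 1 / norm (q i - q j) ^ 3"
  have "repulsion n q (\<sigma> i) = (\<Sum>j<n. (1 / norm (q (\<sigma> i) - q (\<sigma> j)) ^ 3) *\<^sub>R (q (\<sigma> i) - q (\<sigma> j)))"
    unfolding repulsion_def by (subst sum.permute[OF \<sigma>]) (simp add: o_def)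
  also have "\<dots> = (\<Sum>j<n. ?c j *\<^sub>R (mirror (q i) - mirror (q j)))"
    using q i by (intro sum.cong refl) (simp add: symmetric_configs_def norm_mirror_diff)
  also have "\<dots> = mirror (repulsion n q i)"
    by (simp add: plane_eq_iff repulsion_def sum_negf[symmetric] right_diff_distrib)
  finally show ?thesis .
qed

lemma open_inj_configs: "open {q :: nat \<Rightarrow> real^2. inj_on q {..<n}}"
proof -
  have eq: "{q :: nat \<Rightarrow> real^2. inj_on q {..<n}} =
      (\<Inter>i\<in>{..<n}. \<Inter>j\<in>{..<n} - {i}. {q. q i \<noteq> q j})"
    by (auto simp: inj_on_def)
  show ?thesis
    unfolding eq
    by (intro open_INT finite_lessThan finite_Diff ballI open_Collect_neq
        continuous_on_product_coordinates)
qed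

text \<open>The descent line stays among symmetric configurations by
  \<open>repulsion_mirror\<close>. The open set \<open>R\<close> localizes the minimum, so that
  minimizers under additional order constraints are covered once these hold strictly.\<close>

lemma symmetric_local_minimum_balanced:
  assumes \<sigma>: "\<sigma> permutes {..<n}" and q: "q \<in> symmetric_configs n \<sigma>" "inj_on q {..<n}"
    and R: "open R" "q \<in> R"
    and min: "\<And>z. z \<in> symmetric_configs n \<sigma> \<Longrightarrow> inj_on z {..<n} \<Longrightarrow> z \<in> R
      \<Longrightarrow> energy n s q \<le> energy n s z"
  shows "\<forall>i<n. aniso s *v q i = repulsion n q i"
proof -
  define f where "f i = (if i < n then aniso s *v q i - repulsion n q i else 0)" for i
  define line where "line t = (\<lambda>i. q i - t *\<^sub>R f i)" for t
  have sym: "line t \<in> symmetric_configs n \<sigma>" for t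
  proof -
    have "\<sigma> i < n" if "i < n" for i
      using permutes_in_image[OF \<sigma>, of i] that by simp
    then show ?thesis
      using q by (auto simp: symmetric_configs_def line_def f_def repulsion_mirror[OF \<sigma> q(1)]
          plane_eq_iff aniso_mult algebra_simps)
  qed
  have "continuous_on UNIV line"
    unfolding line_def
    by (intro continuous_on_coordinatewise_then_product) (auto intro!: continuous_intros)
  then have "open (line -` (R \<inter> {q. inj_on q {..<n}}))"
    using R(1) open_inj_configs by (intro open_vimage) auto
  moreover have "0 \<in> line -` (R \<inter> {q. inj_on q {..<n}})"
    using R(2) q(2) by (simp add: line_def)
  ultimately obtain d where d: "d > 0" "ball 0 d \<subseteq> line -` (R \<inter> {q. inj_on q {..<n}})"
    using open_contains_ball by blast
  have "energy n s q \<le> energy n s (\<lambda>i. q i - t *\<^sub>R f i)" if "\<bar>t\<bar> < d" for t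
  proof -
    have "t \<in> ball 0 d" using that by simp
    then have "inj_on (line t) {..<n}" "line t \<in> R"
      using d(2) by auto
    from min[OF sym this] show ?thesis
      by (simp add: line_def)
  qed
  then show ?thesis
    using balanced_if_gradient_line_minimum[OF q(2) d(1), of f s] by (simp add: f_def)
qed

text \<open>A body on the axis that was exchanged with another one would share its position,
  contrary to injectivity.\<close>

lemma symmetric_axis_iff:
  assumes "\<sigma> permutes {..<n}" "q \<in> symmetric_configs n \<sigma>" "inj_on q {..<n}" "i < n"
  shows "hor (q i) = 0 \<longleftrightarrow> \<sigma> i = i"
proof -
  have "\<sigma> i < n"
    using permutes_in_image[OF assms(1), of i] assms(4) by simp
  moreover have "q (\<sigma> i) = mirror (q i)"
    using assms by (simp add: symmetric_configs_def)
  ultimately have "\<sigma> i = i \<longleftrightarrow> q i = mirror (q i)"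
    using assms(3,4) by (metis inj_onD lessThan_iff)
  then show ?thesis
    by (auto simp: plane_eq_iff)
qed

section \<open>Reflections exchanging k pairs\<close>

definition swap_pairs :: "nat \<Rightarrow> nat \<Rightarrow> nat" where
  "swap_pairs k i = (if i < 2 * k then if even i then i + 1 else i - 1 else i)"

lemma swap_pairs_permutes:
  assumes "2 * k \<le> n"
  shows "swap_pairs k permutes {..<n}"
proof -
  have "swap_pairs k (swap_pairs k i) = i" for i
    by (auto simp: swap_pairs_def elim!: oddE)
  then have "\<exists>!i. swap_pairs k i = j" for j
    by metis
  then show ?thesis
    using assms by (auto simp: permutes_def swap_pairs_def)
qed

lemma swap_pairs_fixed_iff: "swap_pairs k i = i \<longleftrightarrow> 2 * k \<le> i"
  by (auto simp: swap_pairs_def elim: oddE)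

definition axis_count :: "nat \<Rightarrow> 2 config \<Rightarrow> nat" where
  "axis_count n q = card {i \<in> {..<n}. hor (q i) = 0}"

lemma swap_pairs_axis_iff:
  assumes "2 * k \<le> n" "q \<in> symmetric_configs n (swap_pairs k)" "inj_on q {..<n}" "i < n"
  shows "hor (q i) = 0 \<longleftrightarrow> 2 * k \<le> i"
  using symmetric_axis_iff[OF swap_pairs_permutes[OF assms(1)] assms(2-)]
  by (simp add: swap_pairs_fixed_iff)

lemma axis_count_symmetric:
  assumes "2 * k \<le> n" "q \<in> symmetric_configs n (swap_pairs k)" "inj_on q {..<n}"
  shows "axis_count n q = n - 2 * k"
proof -
  have "{i \<in> {..<n}. hor (q i) = 0} = {2 * k..<n}"
    using swap_pairs_axis_iff[OF assms] by auto
  then show ?thesis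
    by (simp add: axis_count_def)
qed

text \<open>A body off the horizontal axis is not parallel to body 0 if it lies on the vertical
  axis, and otherwise not parallel to its own mirror image.\<close>

lemma symmetric_not_collinear:
  assumes k: "1 \<le> k" "2 * k \<le> n" and q: "q \<in> symmetric_configs n (swap_pairs k)" "inj_on q {..<n}"
    and i: "i < n" "ver (q i) \<noteq> 0"
  shows "\<not> collinear_config n q"
proof (cases "hor (q i) = 0")
  case True
  have "hor (q 0) \<noteq> 0"
    using swap_pairs_axis_iff[OF k(2) q, of 0] k by simp
  then show ?thesis
    using True i k by (intro not_collinear_configI[of 0 n i]) auto
next
  case False
  have "swap_pairs k i < n"
    using permutes_in_image[OF swap_pairs_permutes[OF k(2)], of i] i by simp
  moreover have "q (swap_pairs k i) = mirror (q i)"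
    using q i by (simp add: symmetric_configs_def)
  ultimately show ?thesis
    using False i by (intro not_collinear_configI[of i n "swap_pairs k i"]) auto
qed

text \<open>Otherwise two distinct bodies fixed by the exchange would both sit at the
  origin.\<close>

lemma symmetric_two_axis_points:
  assumes k: "2 * k + 2 \<le> n" and q: "q \<in> symmetric_configs n (swap_pairs k)" "inj_on q {..<n}"
  shows "\<exists>i<n. ver (q i) \<noteq> 0"
proof (rule ccontr)
  assume "\<not> ?thesis"
  then have "q (2 * k) = q (2 * k + 1)"
    using swap_pairs_axis_iff[OF _ q, of "2 * k"] swap_pairs_axis_iff[OF _ q, of "2 * k + 1"] k
    by (simp add: plane_eq_iff)
  then have "2 * k = 2 * k + 1"
    by (rule inj_onD[OF q(2)]) (use k in auto)
  then show False
    by simp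
qed

text \<open>An admissible starting point for the minimization. Heights descend with the index so
  that \<open>ladder 4 1\<close> and \<open>ladder 5 1\<close> also satisfy the order constraints
  used for kites.\<close>

definition ladder :: "nat \<Rightarrow> nat \<Rightarrow> 2 config" where
  "ladder n k i = (if i < 2 * k then point (if even i then 1 else - 1) (- real (i div 2))
     else if i < n then point 0 (- real i) else 0)"

lemma ladder_symmetric:
  assumes "2 * k \<le> n"
  shows "ladder n k \<in> symmetric_configs n (swap_pairs k)"
  using assms by (auto simp: symmetric_configs_def ladder_def swap_pairs_def plane_eq_iff elim!: oddE)

lemma ladder_inj: "inj_on (ladder n k) {..<n}"
proof (rule inj_onI)
  fix i j assume "i \<in> {..<n}" "j \<in> {..<n}" and eq: "ladder n k i = ladder n k j"
  then have "i < n" "j < n" by auto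
  then show "i = j"
    using eq by (auto simp: ladder_def plane_eq_iff split: if_splits elim!: evenE oddE)
qed

lemma symmetric_minimizer:
  assumes "s \<ge> 1" "2 * k \<le> n"
  obtains q where "q \<in> symmetric_configs n (swap_pairs k)" "inj_on q {..<n}"
    "\<And>z. z \<in> symmetric_configs n (swap_pairs k) \<Longrightarrow> inj_on z {..<n} \<Longrightarrow> energy n s q \<le> energy n s z"
    "\<forall>i<n. aniso s *v q i = repulsion n q i"
proof -
  obtain q where q: "q \<in> symmetric_configs n (swap_pairs k)" "inj_on q {..<n}"
    "\<And>z. z \<in> symmetric_configs n (swap_pairs k) \<Longrightarrow> inj_on z {..<n} \<Longrightarrow> energy n s q \<le> energy n s z"
    using energy_attains_minimum[OF assms(1) closed_symmetric_configs _ ladder_symmetric[OF assms(2)]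
        ladder_inj] by (auto simp: symmetric_configs_def)
  moreover have "\<forall>i<n. aniso s *v q i = repulsion n q i"
    using symmetric_local_minimum_balanced[OF swap_pairs_permutes[OF assms(2)] q(1,2) open_UNIV]
      q(3) by simp
  ultimately show thesis
    using that by blast
qed

section \<open>Horizontal configurations are not minimal\<close>

lemma inverse_square_force_antimono:
  fixes a b :: real
  assumes "a \<le> b" "0 < a \<or> b < 0"
  shows "b / \<bar>b\<bar> ^ 3 \<le> a / \<bar>a\<bar> ^ 3"
proof -
  have pos: "c / \<bar>c\<bar> ^ 3 = 1 / c\<^sup>2" if "c > 0" for c :: real
    using that by (simp add: power3_eq_cube power2_eq_square)
  have neg: "c / \<bar>c\<bar> ^ 3 = - (1 / c\<^sup>2)" if "c < 0" for c :: real
    using that by (simp add: power3_eq_cube power2_eq_square)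
  show ?thesis
    using assms(2)
  proof
    assume "0 < a"
    then have "a\<^sup>2 \<le> b\<^sup>2" "a\<^sup>2 > 0"
      using assms(1) by (auto intro: power_mono)
    then show ?thesis
      using pos[of a] pos[of b] \<open>0 < a\<close> assms(1) by (simp del: abs_of_pos abs_of_nonneg add: frac_le)
  next
    assume "b < 0"
    then have "b\<^sup>2 \<le> a\<^sup>2" "b\<^sup>2 > 0"
      using assms(1) power_mono[of "-b" "-a" 2] by auto
    then show ?thesis
      using neg[of a] neg[of b] \<open>b < 0\<close> assms(1) by (simp del: abs_of_neg abs_of_nonpos add: frac_le)
  qed
qed

text \<open>A body outside the interval from \<open>a\<close> to \<open>b\<close> sees both points
  on the same side, where the signed inverse-square force decreases. It can only lower the
  difference, so discarding it leaves an upper bound.\<close>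

lemma force_difference_le:
  fixes x :: "nat \<Rightarrow> real"
  assumes T: "T \<subseteq> {..<n}" and ab: "a < b" and out: "\<And>p. p \<in> {..<n} - T \<Longrightarrow> x p < a \<or> b < x p"
  shows "(\<Sum>p<n. (b - x p) / \<bar>b - x p\<bar> ^ 3) - (\<Sum>p<n. (a - x p) / \<bar>a - x p\<bar> ^ 3)
    \<le> (\<Sum>p\<in>T. (b - x p) / \<bar>b - x p\<bar> ^ 3 - (a - x p) / \<bar>a - x p\<bar> ^ 3)"
proof -
  have "(\<Sum>p\<in>{..<n} - T. (b - x p) / \<bar>b - x p\<bar> ^ 3 - (a - x p) / \<bar>a - x p\<bar> ^ 3) \<le> 0"
    using out ab by (intro sum_nonpos) (force intro!: inverse_square_force_antimono)
  moreover have "(\<Sum>p<n. (b - x p) / \<bar>b - x p\<bar> ^ 3 - (a - x p) / \<bar>a - x p\<bar> ^ 3)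
    = (\<Sum>p\<in>{..<n} - T. (b - x p) / \<bar>b - x p\<bar> ^ 3 - (a - x p) / \<bar>a - x p\<bar> ^ 3)
      + (\<Sum>p\<in>T. (b - x p) / \<bar>b - x p\<bar> ^ 3 - (a - x p) / \<bar>a - x p\<bar> ^ 3)"
    using T by (rule sum.subset_diff) simp
  ultimately show ?thesis
    by (simp add: sum_subtractf)
qed

lemma hor_repulsion:
  assumes "\<forall>j<n. ver (q j) = 0" "i < n"
  shows "hor (repulsion n q i) = (\<Sum>j<n. (hor (q i) - hor (q j)) / \<bar>hor (q i) - hor (q j)\<bar> ^ 3)"
  using assms by (simp add: repulsion_def norm_plane)

text \<open>To leading order the gain is 2 t^2 / g^3, which exceeds t^2 when g^3 < 2. Exactly, with
  r the new distance, (r - g) (r + g) = 4 t^2 reduces the claim to g r (g + r) < 4; at t = 0 the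
  left side is 2 g^3, so continuity suffices.\<close>

lemma close_pair_rotation_gain:
  fixes g :: real
  assumes "0 < g" "g ^ 3 < 2"
  shows "\<exists>t. t > 0 \<and> t\<^sup>2 < 1 / g - 1 / sqrt (g\<^sup>2 + (2 * t)\<^sup>2)"
proof -
  define r where "r t = sqrt (g\<^sup>2 + (2 * t)\<^sup>2)" for t
  have "((\<lambda>t. g * r t * (g + r t)) \<longlongrightarrow> g * r 0 * (g + r 0)) (at_right 0)"
    unfolding r_def by (intro tendsto_intros)
  moreover have "g * r 0 * (g + r 0) < 4"
    using assms by (simp add: r_def power3_eq_cube)
  ultimately have "eventually (\<lambda>t. g * r t * (g + r t) < 4) (at_right 0)"
    by (rule order_tendstoD)
  moreover have "eventually (\<lambda>t::real. t > 0) (at_right 0)"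
    by (rule eventually_at_right_less)
  ultimately have "eventually (\<lambda>t. g * r t * (g + r t) < 4 \<and> t > 0) (at_right 0)"
    by (rule eventually_conj)
  then obtain t where t: "g * r t * (g + r t) < 4" "t > 0"
    using eventually_happens by force
  have r: "(r t)\<^sup>2 = g\<^sup>2 + 4 * t\<^sup>2" "r t > 0"
    using assms t by (auto simp: r_def add_pos_nonneg power_mult_distrib)
  have "t\<^sup>2 * (g * r t * (g + r t)) < t\<^sup>2 * 4"
    using t by (intro mult_strict_left_mono) auto
  also have "\<dots> = (r t - g) * (g + r t)"
    using r(1) by (simp add: power2_eq_square algebra_simps)
  finally have "t\<^sup>2 * (g * r t) < r t - g"
    using assms r(2) by (simp add: mult.assoc[symmetric])
  then have "t\<^sup>2 < 1 / g - 1 / r t"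
    using assms r(2) by (simp add: field_simps)
  then show ?thesis
    using t(2) unfolding r_def by blast
qed

text \<open>A pair of neighbours on the horizontal axis is so close that turning it off the axis,
  together with its mirror image, lowers the energy.\<close>

lemma horizontal_not_minimal:
  assumes s: "s > 1" and k: "2 \<le> k" "2 * k \<le> n"
    and q: "q \<in> symmetric_configs n (swap_pairs k)" "inj_on q {..<n}"
    and bal: "\<forall>i<n. aniso s *v q i = repulsion n q i"
    and hor: "\<forall>i<n. ver (q i) = 0"
  shows "\<exists>z\<in>symmetric_configs n (swap_pairs k). inj_on z {..<n} \<and> energy n s z < energy n s q"
proof -
  let ?\<sigma> = "swap_pairs k"
  define x where "x i = hor (q i)" for i
  have x_inj: "inj_on x {..<n}"
    using q(2) hor by (auto simp: inj_on_def x_def plane_eq_iff)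
  have \<sigma>: "?\<sigma> i < n" "x (?\<sigma> i) = - x i" if "i < n" for i
    using permutes_in_image[OF swap_pairs_permutes[OF k(2)], of i] that q(1)
    by (auto simp: symmetric_configs_def x_def)
  define P where "P = {i \<in> {..<n}. x i > 0}"
  have "x 0 \<noteq> 0" "x 2 \<noteq> 0" "?\<sigma> 0 = 1" "?\<sigma> 2 = 3"
    using swap_pairs_axis_iff[OF k(2) q, of 0] swap_pairs_axis_iff[OF k(2) q, of 2] k
    by (auto simp: x_def swap_pairs_def)
  \<comment> \<open>Bodies 0, 1 and bodies 2, 3 are mirror pairs off the axis, so each pair has one
    member on the right. Hence \<open>P\<close> has two elements; this is where
    \<open>2 \<le> k\<close> enters.\<close>
  then have "0 \<in> P \<or> 1 \<in> P" "2 \<in> P \<or> 3 \<in> P"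
    using \<sigma>(2)[of 0] \<sigma>(2)[of 2] k by (auto simp: P_def)
  then obtain u v where "u = 0 \<or> u = 1" "v = 2 \<or> v = 3" "u \<in> P" "v \<in> P"
    by blast
  then have uv: "u \<in> P" "v \<in> P" "u \<noteq> v"
    by auto
  have fin: "finite P"
    by (simp add: P_def)
  \<comment> \<open>\<open>i\<close> and \<open>j\<close> are the two bodies closest to the axis on
    its right side; no body lies between them.\<close>
  obtain i where i: "i \<in> P" "\<And>p. p \<in> P \<Longrightarrow> x i \<le> x p"
    using ex_min_if_finite[of "x ` P"] fin uv(1) by (metis arg_min_if_finite(1) arg_min_least empty_iff)
  have "P - {i} \<noteq> {}"
    using uv by auto
  then obtain j where j: "j \<in> P - {i}" "\<And>p. p \<in> P - {i} \<Longrightarrow> x j \<le> x p"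
    using fin by (metis arg_min_if_finite(1) arg_min_least finite_Diff)
  have ij: "i < n" "j < n" "i \<noteq> j" "0 < x i" "0 < x j"
    using i(1) j(1) by (auto simp: P_def)
  have "x i \<noteq> x j"
    using ij inj_onD[OF x_inj, of i j] by auto
  then have less: "x i < x j"
    using i(2)[of j] j(1) by auto
  define g where "g = x j - x i"
  have g: "g > 0"
    using less by (simp add: g_def)
  have "(\<Sum>p<n. (x j - x p) / \<bar>x j - x p\<bar> ^ 3) - (\<Sum>p<n. (x i - x p) / \<bar>x i - x p\<bar> ^ 3)
      \<le> (\<Sum>p\<in>{i, j}. (x j - x p) / \<bar>x j - x p\<bar> ^ 3 - (x i - x p) / \<bar>x i - x p\<bar> ^ 3)"
  proof (rule force_difference_le)
    fix p assume p: "p \<in> {..<n} - {i, j}"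
    then have "x p \<noteq> x j" "x p \<noteq> x i"
      using inj_onD[OF x_inj, of p j] inj_onD[OF x_inj, of p i] ij by auto
    then show "x p < x i \<or> x j < x p"
      using p j(2)[of p] ij by (cases "p \<in> P") (auto simp: P_def)
  qed (use ij less in auto)
  also have "\<dots> = 2 * (g / g ^ 3)"
    using ij less by (simp add: g_def diff_divide_distrib)
  \<comment> \<open>The balance equations of \<open>j\<close> and \<open>i\<close> are subtracted;
    only their mutual repulsion is kept.\<close>
  finally have "s * g \<le> 2 * (g / g ^ 3)"
    using bal ij hor_repulsion[OF hor] unfolding x_def g_def
    by (simp add: aniso_mult plane_eq_iff right_diff_distrib)
  then have "s * g ^ 3 \<le> 2"
    using g by (simp add: field_simps power3_eq_cube)
  moreover have "g ^ 3 < s * g ^ 3"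
    using s g by simp
  ultimately obtain t where t: "t > 0" "t\<^sup>2 < 1 / g - 1 / sqrt (g\<^sup>2 + (2 * t)\<^sup>2)"
    using close_pair_rotation_gain[OF g] by auto
  \<comment> \<open>Both \<open>i, j\<close> and their mirror images are tilted, each pair gaining a
    vertical separation 2 t. Horizontal coordinates are unchanged, so no distance shrinks.\<close>
  define w where "w a = (if a = i \<or> a = ?\<sigma> i then t else if a = j \<or> a = ?\<sigma> j then - t else 0)" for a
  define z where "z a = q a + point 0 (w a)" for a
  have hz: "hor (z a) = x a" for a
    by (simp add: z_def x_def)
  have vz: "ver (z a) = w a" if "a < n" for a
    using hor that by (simp add: z_def)
  have \<sigma>\<sigma>: "?\<sigma> (?\<sigma> a) = a" for a
    by (auto simp: swap_pairs_def elim!: oddE)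
  have swap: "?\<sigma> a = b \<longleftrightarrow> a = ?\<sigma> b" for a b
    by (metis \<sigma>\<sigma>)
  have w_\<sigma>: "w (?\<sigma> a) = w a" for a
    unfolding w_def swap[of a] \<sigma>\<sigma> by (simp add: disj_commute)
  have "z \<in> symmetric_configs n ?\<sigma>"
  proof -
    have "w a = 0" if "a \<ge> n" for a
      using that ij \<sigma>[of i] \<sigma>[of j] by (auto simp: w_def)
    then show ?thesis
      using q(1) w_\<sigma> by (auto simp: symmetric_configs_def z_def plane_eq_iff)
  qed
  moreover have "inj_on z {..<n}"
    using x_inj hz by (metis (mono_tags, lifting) inj_on_def)
  moreover have "energy n s z < energy n s q"
  proof -
    define \<delta> where "\<delta> = 1 / g - 1 / sqrt (g\<^sup>2 + (2 * t)\<^sup>2)"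
    define H where "H = {(i, j), (j, i), (?\<sigma> i, ?\<sigma> j), (?\<sigma> j, ?\<sigma> i)}"
    have ne: "?\<sigma> i \<noteq> i" "?\<sigma> j \<noteq> j" "?\<sigma> i \<noteq> j" "?\<sigma> j \<noteq> i" "?\<sigma> i \<noteq> ?\<sigma> j"
      using \<sigma>(2)[OF ij(1)] \<sigma>(2)[OF ij(2)] ij \<open>x i \<noteq> x j\<close> by auto
    have H: "H \<subseteq> {..<n} \<times> {..<n}" "card H = 4"
      using ij ne \<sigma>(1)[OF ij(1)] \<sigma>(1)[OF ij(2)] by (auto simp: H_def)
    have termwise: "1 / norm (z a - z b) \<le> 1 / norm (q a - q b) - (if (a, b) \<in> H then \<delta> else 0)"
      if ab: "a < n" "b < n" for a b
    proof -
      have nq: "norm (q a - q b) = \<bar>x a - x b\<bar>"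
        using hor ab by (simp add: norm_plane x_def)
      have nz: "norm (z a - z b) = sqrt ((x a - x b)\<^sup>2 + (w a - w b)\<^sup>2)"
        using hz vz ab by (simp add: norm_plane)
      show ?thesis
      proof (cases "(a, b) \<in> H")
        case True
        then have "(x a - x b)\<^sup>2 = g\<^sup>2" "(w a - w b)\<^sup>2 = (2 * t)\<^sup>2"
          using ne \<sigma>(2)[OF ij(1)] \<sigma>(2)[OF ij(2)] ij(3)
          by (auto simp: H_def g_def w_def power2_eq_square algebra_simps)
        moreover from this(1) have "\<bar>x a - x b\<bar> = g"
          using g by (metis abs_of_pos real_sqrt_abs)
        ultimately show ?thesis
          using True by (simp add: nq nz \<delta>_def)
      next
        case False
        have "\<bar>x a - x b\<bar> \<le> norm (z a - z b)"
          unfolding nz by (rule real_le_rsqrt) simp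
        moreover have "\<bar>x a - x b\<bar> > 0 \<or> a = b"
          using ab inj_onD[OF x_inj, of a b] by auto
        ultimately show ?thesis
          using False nq by (auto simp: frac_le)
      qed
    qed
    have "(\<Sum>a<n. \<Sum>b<n. 1 / norm (z a - z b))
        \<le> (\<Sum>a<n. \<Sum>b<n. 1 / norm (q a - q b) - (if (a, b) \<in> H then \<delta> else 0))"
      by (intro sum_mono termwise) auto
    also have "\<dots> = (\<Sum>a<n. \<Sum>b<n. 1 / norm (q a - q b)) - (\<Sum>p\<in>{..<n} \<times> {..<n}. if p \<in> H then \<delta> else 0)"
      by (simp add: sum_subtractf sum.cartesian_product case_prod_beta)
    also have "(\<Sum>p\<in>{..<n} \<times> {..<n}. if p \<in> H then \<delta> else 0) = 4 * \<delta>"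
      using H by (simp add: sum.If_cases Int_absorb1)
    finally have U: "(\<Sum>a<n. \<Sum>b<n. 1 / norm (z a - z b))
        \<le> (\<Sum>a<n. \<Sum>b<n. 1 / norm (q a - q b)) - 4 * \<delta>" .
    define J where "J = {i, ?\<sigma> i, j, ?\<sigma> j}"
    have J: "J \<subseteq> {..<n}" "card J = 4"
      using ne ij \<sigma>(1)[OF ij(1)] \<sigma>(1)[OF ij(2)] by (auto simp: J_def)
    have "(\<Sum>a<n. (w a)\<^sup>2) = (\<Sum>a<n. if a \<in> J then t\<^sup>2 else 0)"
      by (intro sum.cong) (auto simp: w_def J_def)
    also have "\<dots> = (\<Sum>a\<in>J. t\<^sup>2)"
      using J(1) by (simp add: sum.inter_restrict[symmetric] Int_absorb1)
    also have "\<dots> = 4 * t\<^sup>2"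
      using J(2) by simp
    finally have I: "(\<Sum>a<n. s * (hor (z a))\<^sup>2 + (ver (z a))\<^sup>2)
        = (\<Sum>a<n. s * (hor (q a))\<^sup>2 + (ver (q a))\<^sup>2) + 4 * t\<^sup>2"
      using hz vz hor by (simp add: sum.distrib x_def)
    have "t\<^sup>2 < \<delta>"
      using t(2) by (simp add: \<delta>_def)
    then have "energy n s q - 4 * \<delta> + 4 * t\<^sup>2 < energy n s q"
      by simp
    moreover have "energy n s z \<le> energy n s q - 4 * \<delta> + 4 * t\<^sup>2"
      unfolding energy_def I using U by simp
    ultimately show ?thesis
      by simp
  qed
  ultimately show ?thesis
    by blast
qed

section \<open>One symmetric pair of bodies\<close>

lemma DERIV_inverse_sqrt:
  assumes "(g has_real_derivative g') (at x)" "g x > 0"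
  shows "((\<lambda>x. c / sqrt (g x)) has_real_derivative - c * g' / (2 * sqrt (g x) ^ 3)) (at x)"
proof -
  have "((\<lambda>x. sqrt (g x)) has_real_derivative inverse (sqrt (g x)) / 2 * g') (at x)"
    using DERIV_chain2[OF DERIV_real_sqrt[OF assms(2)] assms(1)] .
  from DERIV_divide[OF DERIV_const[of c] this] show ?thesis
    by (rule DERIV_cong) (use assms(2) in \<open>auto simp: power3_eq_cube field_simps\<close>)
qed

text \<open>\<open>f\<close> is the energy of a pair at height \<open>y\<close> with horizontal
  coordinates x and -x, and of axis bodies at \<open>a\<close> and \<open>b\<close>. A minimizer
  with \<open>b < a \<le> y\<close> cannot touch the wall \<open>a = y\<close>: stationarity along
  the wall and \<open>s \<ge> 12 / 5\<close> make the level triple narrow compared with its distance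
  \<open>h\<close> from the fourth body, and then bending the triple lowers the energy.\<close>

lemma end_pair_barrier:
  fixes s x y b :: real
  defines "f \<equiv> \<lambda>x y a b. 1 / x + 4 / sqrt (x\<^sup>2 + (y - a)\<^sup>2) + 4 / sqrt (x\<^sup>2 + (y - b)\<^sup>2)
    + 2 / (a - b) + 2 * s * x\<^sup>2 + 2 * y\<^sup>2 + a\<^sup>2 + b\<^sup>2"
  assumes s: "s \<ge> 12 / 5" and x: "x > 0" and b: "b < y"
    and min: "\<And>x' y' a' b'. x' > 0 \<Longrightarrow> b' < a' \<Longrightarrow> a' \<le> y' \<Longrightarrow> f x y y b \<le> f x' y' a' b'"
  shows False
proof -
  define h where "h = y - b"
  define r where "r = sqrt (x\<^sup>2 + h\<^sup>2)"
  have h: "h > 0" using b by (simp add: h_def)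
  have r: "r > 0" "r\<^sup>2 = x\<^sup>2 + h\<^sup>2" "r > h"
    using x h by (auto simp: r_def add_pos_pos intro: real_less_rsqrt)
  have fb: "f x' y' y' b' = 5 / x' + 4 / sqrt (x'\<^sup>2 + (y' - b')\<^sup>2) + 2 / (y' - b')
      + 2 * s * x'\<^sup>2 + 3 * y'\<^sup>2 + b'\<^sup>2" if "x' > 0" for x' y' b'
    using that by (simp add: f_def)
  have posr: "x\<^sup>2 + (y - b)\<^sup>2 > 0"
    using x by (simp add: add_pos_nonneg)
  have d1: "((\<lambda>x'. 5 / x') has_real_derivative - 5 / x\<^sup>2) (at x)"
    using x by (auto intro!: derivative_eq_intros simp: power2_eq_square)
  have "((\<lambda>x'. x'\<^sup>2 + (y - b)\<^sup>2) has_real_derivative 2 * x) (at x)"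
    by (auto intro!: derivative_eq_intros)
  from DERIV_inverse_sqrt[OF this posr, of 4]
  have d2: "((\<lambda>x'. 4 / sqrt (x'\<^sup>2 + (y - b)\<^sup>2)) has_real_derivative - 4 * x / r ^ 3) (at x)"
    by (rule DERIV_cong) (simp add: r_def h_def[symmetric])
  have "((\<lambda>x'. 5 / x' + 4 / sqrt (x'\<^sup>2 + (y - b)\<^sup>2) + 2 / (y - b) + 2 * s * x'\<^sup>2 + 3 * y\<^sup>2 + b\<^sup>2)
      has_real_derivative - 5 / x\<^sup>2 - 4 * x / r ^ 3 + 4 * s * x) (at x)"
    by ((rule d1 d2 derivative_eq_intros refl)+) simp
  then have "- 5 / x\<^sup>2 - 4 * x / r ^ 3 + 4 * s * x = 0"
    by (rule DERIV_local_min[OF _ x]) (use min b x in \<open>auto simp: fb[symmetric]\<close>)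
  then have eqx: "s = 5 / 4 / x ^ 3 + 1 / r ^ 3"
    using x r(1) by (simp add: field_simps power2_eq_square power3_eq_cube)
  have "((\<lambda>y'. x\<^sup>2 + (y' - b)\<^sup>2) has_real_derivative 2 * h) (at y)"
    by (auto intro!: derivative_eq_intros simp: h_def)
  from DERIV_inverse_sqrt[OF this posr, of 4]
  have d1: "((\<lambda>y'. 4 / sqrt (x\<^sup>2 + (y' - b)\<^sup>2)) has_real_derivative - 4 * h / r ^ 3) (at y)"
    by (rule DERIV_cong) (simp add: r_def h_def[symmetric])
  have d2: "((\<lambda>y'. 2 / (y' - b)) has_real_derivative - 2 / h\<^sup>2) (at y)"
    using b by (auto intro!: derivative_eq_intros simp: power2_eq_square h_def)
  have "((\<lambda>y'. 5 / x + 4 / sqrt (x\<^sup>2 + (y' - b)\<^sup>2) + 2 / (y' - b) + 2 * s * x\<^sup>2 + 3 * y'\<^sup>2 + b\<^sup>2)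
      has_real_derivative - 4 * h / r ^ 3 - 2 / h\<^sup>2 + 6 * y) (at y)"
    by ((rule d1 d2 derivative_eq_intros refl)+) simp
  then have eqy: "- 4 * h / r ^ 3 - 2 / h\<^sup>2 + 6 * y = 0"
    by (rule DERIV_local_min[OF _ h]) (use min b x in \<open>auto simp: fb[symmetric] h_def\<close>)
  have "((\<lambda>b'. x\<^sup>2 + (y - b')\<^sup>2) has_real_derivative - 2 * h) (at b)"
    by (auto intro!: derivative_eq_intros simp: h_def)
  from DERIV_inverse_sqrt[OF this posr, of 4]
  have d1: "((\<lambda>b'. 4 / sqrt (x\<^sup>2 + (y - b')\<^sup>2)) has_real_derivative 4 * h / r ^ 3) (at b)"
    by (rule DERIV_cong) (simp add: r_def h_def[symmetric])
  have d2: "((\<lambda>b'. 2 / (y - b')) has_real_derivative 2 / h\<^sup>2) (at b)"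
    using b by (auto intro!: derivative_eq_intros simp: power2_eq_square h_def)
  have "((\<lambda>b'. 5 / x + 4 / sqrt (x\<^sup>2 + (y - b')\<^sup>2) + 2 / (y - b') + 2 * s * x\<^sup>2 + 3 * y\<^sup>2 + b'\<^sup>2)
      has_real_derivative 4 * h / r ^ 3 + 2 / h\<^sup>2 + 2 * b) (at b)"
    by ((rule d1 d2 derivative_eq_intros refl)+) simp
  then have eqb: "4 * h / r ^ 3 + 2 / h\<^sup>2 + 2 * b = 0"
    by (rule DERIV_local_min[OF _ h]) (use min b x in \<open>auto simp: fb[symmetric] h_def\<close>)
  have "b = - 3 * y"
    using eqy eqb by simp
  then have "y = h / 4"
    by (simp add: h_def)
  with eqy have "3 / 2 * h = 4 * h / r ^ 3 + 2 / h\<^sup>2"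
    by simp
  then have eqh: "3 / 4 = 1 / h ^ 3 + 2 / r ^ 3"
    using h r(1) by (simp add: field_simps power2_eq_square power3_eq_cube)
  \<comment> \<open>With P, Q, R the inverse cubes of x, h, r, combining \<open>eqx\<close>,
    \<open>eqh\<close> and 12/5 = 16/5 * 3/4 yields 5/4 P \<ge> 16/5 Q + 27/5 R. A ratio x / h of at
    least 29/50 would make the right side exceed 5/4 P. The same 29/50 is still small enough for the
    numerical contradiction at the end.\<close>
  have x_less: "x < 29 / 50 * h"
  proof (rule ccontr)
    assume "\<not> ?thesis"
    then have ge: "29 / 50 * h \<le> x" by simp
    then have "(29 / 50 * h) ^ 3 \<le> x ^ 3" "(29 / 50 * h) ^ 2 \<le> x ^ 2"
      using h by (intro power_mono; simp)+
    then have 1: "(29 / 50) ^ 3 * h ^ 3 \<le> x ^ 3" "(29 / 50) ^ 2 * h ^ 2 \<le> x ^ 2"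
      by (simp_all only: power_mult_distrib)
    from 1(2) have "841 / 2500 * h\<^sup>2 \<le> x\<^sup>2"
      by (simp add: power2_eq_square)
    then have "h\<^sup>2 \<le> 3 * x\<^sup>2"
      using zero_le_power2[of x] by linarith
    then have "r\<^sup>2 \<le> (2 * x)\<^sup>2"
      using r(2) by (simp add: power_mult_distrib)
    then have "r \<le> 2 * x"
      by (rule power2_le_imp_le) (use x in simp)
    then have "r ^ 3 \<le> 8 * x ^ 3"
      using r(1) power_mono[of r "2 * x" 3] by (simp add: power_mult_distrib)
    define P Q R where "P = 1 / x ^ 3" and "Q = 1 / h ^ 3" and "R = 1 / r ^ 3"
    have "R \<ge> 1 / 8 * P"
      using \<open>r ^ 3 \<le> 8 * x ^ 3\<close> x r(1) by (simp add: P_def R_def field_simps)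
    moreover have "Q \<ge> (29 / 50) ^ 3 * P"
      using x h 1(1) by (simp add: P_def Q_def field_simps)
    moreover have "s = 5 / 4 * P + R" "3 / 4 = Q + 2 * R"
      using eqx eqh by (simp_all add: P_def Q_def R_def)
    moreover have "P > 0"
      using x by (simp add: P_def)
    ultimately show False
      using s by (simp add: power3_eq_cube)
  qed
  \<comment> \<open>The pair rises by u and the middle body sinks by 2 u, so the linear terms of the
    inertia cancel. Their vertical separation 3 u = 3 x / 4 gives the new distance 5 x / 4.\<close>
  define u where "u = x / 4"
  have "f x y y b \<le> f x (y + u) (y - 2 * u) b"
    using min[of x b "y - 2 * u" "y + u"] x x_less by (simp add: u_def h_def)
  also have "f x (y + u) (y - 2 * u) b
      = 1 / x + 16 / (5 * x) + 4 / sqrt (x\<^sup>2 + (h + u)\<^sup>2) + 2 / (h - 2 * u) + 2 * s * x\<^sup>2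
        + 3 * y\<^sup>2 + b\<^sup>2 + 6 * u\<^sup>2"
  proof -
    have 1: "sqrt (x\<^sup>2 + (y + u - (y - 2 * u))\<^sup>2) = 5 / 4 * x"
      by (rule real_sqrt_unique) (use x in \<open>simp_all add: u_def power2_eq_square\<close>)
    have 2: "y + u - b = h + u" "y - 2 * u - b = h - 2 * u"
      by (simp_all add: h_def)
    have 3: "2 * (y + u)\<^sup>2 + (y - 2 * u)\<^sup>2 = 3 * y\<^sup>2 + 6 * u\<^sup>2"
      by (simp add: power2_eq_square algebra_simps)
    show ?thesis
      unfolding f_def 1 2 using 3 by simp
  qed
  also have "f x y y b = 5 / x + 4 / r + 2 / h + 2 * s * x\<^sup>2 + 3 * y\<^sup>2 + b\<^sup>2"
    using x by (simp add: fb r_def h_def)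
  finally have "4 / 5 / x + 4 / r + 2 / h
      \<le> 4 / sqrt (x\<^sup>2 + (h + u)\<^sup>2) + 2 / (h - 2 * u) + 6 * u\<^sup>2"
    by simp
  moreover have "r \<le> sqrt (x\<^sup>2 + (h + u)\<^sup>2)"
    using h x unfolding r_def by (intro real_sqrt_le_mono add_left_mono power_mono) (auto simp: u_def)
  then have "4 / sqrt (x\<^sup>2 + (h + u)\<^sup>2) \<le> 4 / r"
    using r(1) by (intro frac_le) auto
  \<comment> \<open>\<open>eqh\<close> together with \<open>h < r\<close> turns the inertia cost
    into a multiple of 1 / h^3, comparable with the potential terms.\<close>
  moreover have "6 * u\<^sup>2 \<le> 3 / 2 * x\<^sup>2 / h ^ 3"
  proof -
    have "h ^ 3 \<le> r ^ 3"
      using r(3) h by (intro power_mono) auto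
    then have "1 / r ^ 3 \<le> 1 / h ^ 3"
      using h by (intro frac_le) auto
    then have "3 / 4 \<le> 3 / h ^ 3"
      using eqh by simp
    then have "3 / 4 * x\<^sup>2 \<le> 3 / h ^ 3 * x\<^sup>2"
      by (rule mult_right_mono) simp
    then show ?thesis
      by (simp add: u_def power2_eq_square)
  qed
  ultimately have *: "4 / 5 / x + 2 / h \<le> 2 / (h - x / 2) + 3 / 2 * x\<^sup>2 / h ^ 3"
    by (simp add: u_def)
  \<comment> \<open>After multiplication by h only this ratio remains. The left side decreases and
    the right side increases in t, so the endpoint 29/50 decides.\<close>
  define t where "t = x / h"
  have t: "0 < t" "t < 29 / 50" "x = t * h"
    using x h x_less by (auto simp: t_def field_simps)
  have "h * (4 / 5 / x + 2 / h) \<le> h * (2 / (h - x / 2) + 3 / 2 * x\<^sup>2 / h ^ 3)"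
    using * h by (intro mult_left_mono) auto
  also have "h * (2 / (h - x / 2) + 3 / 2 * x\<^sup>2 / h ^ 3) = 2 / (1 - t / 2) + 3 / 2 * t\<^sup>2"
  proof -
    have "h - x / 2 = h * (1 - t / 2)"
      by (simp add: t(3) algebra_simps)
    then have "h * (2 / (h - x / 2)) = 2 / (1 - t / 2)"
      using h by simp
    moreover have "h * (3 / 2 * x\<^sup>2 / h ^ 3) = 3 / 2 * t\<^sup>2"
      using h by (simp add: t(3) power2_eq_square power3_eq_cube)
    ultimately show ?thesis
      by (simp add: distrib_left)
  qed
  also have "h * (4 / 5 / x + 2 / h) = 4 / 5 / t + 2"
    using h t by (simp add: field_simps)
  also have "2 / (1 - t / 2) \<le> 2 / (1 - 29 / 50 / 2)"
    using t by (intro divide_left_mono) auto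
  finally have "4 / 5 / t + 2 \<le> 2 / (71 / 100) + 3 / 2 * t\<^sup>2"
    by simp
  moreover have "4 / 5 / t \<ge> 4 / 5 / (29 / 50)"
    using t by (intro divide_left_mono) auto
  moreover have "t\<^sup>2 \<le> (29 / 50)\<^sup>2"
    using t by (intro power_mono) auto
  ultimately show False
    by (simp add: power2_eq_square)
qed

text \<open>Each summand is bounded by a quadratic polynomial whose linear terms cancel. For 1 /
  sqrt (1 + v) the Taylor coefficient 3/8 works; for 1 / sqrt (1 - v) the Taylor polynomial is too
  small, and 5/8 is used on the short interval.\<close>

lemma inverse_sqrt_sum_le:
  fixes v :: real
  assumes "0 \<le> v" "v \<le> 3 / 10"
  shows "1 / sqrt (1 - v) + 1 / sqrt (1 + v) \<le> 2 + v\<^sup>2"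
proof -
  have inv: "1 / sqrt z \<le> P" if "z > 0" "P > 0" "1 \<le> z * P\<^sup>2" for z P :: real
  proof -
    have "1 \<le> sqrt (z * P\<^sup>2)"
      using that(3) by simp
    also have "\<dots> = sqrt z * P"
      using that by (simp add: real_sqrt_mult)
    finally show ?thesis
      using that by (simp add: field_simps)
  qed
  have v2: "v\<^sup>2 \<le> (3 / 10)\<^sup>2" and v3: "v ^ 3 \<le> (3 / 10) ^ 3"
    using assms by (intro power_mono; simp)+
  have "1 / sqrt (1 - v) \<le> 1 + v / 2 + 5 / 8 * v\<^sup>2"
  proof (rule inv)
    have "(1 - v) * (1 + v / 2 + 5 / 8 * v\<^sup>2)\<^sup>2 - 1
        = v\<^sup>2 * (1 / 2 - 7 / 8 * v - 15 / 64 * v\<^sup>2 - 25 / 64 * v ^ 3)"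
      by (simp add: power2_eq_square power3_eq_cube field_simps)
    moreover have "0 \<le> 1 / 2 - 7 / 8 * v - 15 / 64 * v\<^sup>2 - 25 / 64 * v ^ 3"
      using v2 v3 assms by (simp add: power2_eq_square power3_eq_cube)
    ultimately show "1 \<le> (1 - v) * (1 + v / 2 + 5 / 8 * v\<^sup>2)\<^sup>2"
      by (metis diff_ge_0_iff_ge mult_nonneg_nonneg zero_le_power2)
  qed (use assms in \<open>auto simp: add_pos_nonneg\<close>)
  moreover have "1 / sqrt (1 + v) \<le> 1 - v / 2 + 3 / 8 * v\<^sup>2"
  proof (rule inv)
    have "(1 + v) * (1 - v / 2 + 3 / 8 * v\<^sup>2)\<^sup>2 - 1
        = v ^ 3 * (5 / 8 - 15 / 64 * v + 9 / 64 * v\<^sup>2)"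
      by (simp add: power2_eq_square power3_eq_cube field_simps)
    moreover have "0 \<le> 5 / 8 - 15 / 64 * v + 9 / 64 * v\<^sup>2"
      using assms by (simp add: add_nonneg_nonneg)
    ultimately show "1 \<le> (1 + v) * (1 - v / 2 + 3 / 8 * v\<^sup>2)\<^sup>2"
      by (metis assms(1) diff_ge_0_iff_ge mult_nonneg_nonneg zero_le_power)
  qed (use assms in \<open>auto simp: add_pos_nonneg\<close>)
  ultimately show ?thesis
    by simp
qed

text \<open>\<open>f\<close> is the energy of a pair at height \<open>y\<close> and three axis
  bodies. In the cross, the pair is level with the central body and the outer bodies are at distance
  A. Since \<open>s \<ge> 12 / 5\<close> makes the horizontal arm the shorter one, bending it gains
  4 / (13 x), more than the second-order losses.\<close>

lemma cross_not_minimal: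
  fixes s x A :: real
  defines "f \<equiv> \<lambda>x y a b c. 1 / x + 4 / sqrt (x\<^sup>2 + (y - a)\<^sup>2) + 4 / sqrt (x\<^sup>2 + (y - b)\<^sup>2)
    + 4 / sqrt (x\<^sup>2 + (y - c)\<^sup>2) + 2 / (a - b) + 2 / (b - c) + 2 / (a - c)
    + 2 * s * x\<^sup>2 + 2 * y\<^sup>2 + a\<^sup>2 + b\<^sup>2 + c\<^sup>2"
  assumes s: "s \<ge> 12 / 5" and x: "x > 0" and A: "A > 0"
    and min: "\<And>x' y' a' b' c'. x' > 0 \<Longrightarrow> c' < b' \<Longrightarrow> b' < a' \<Longrightarrow> f x 0 A 0 (- A) \<le> f x' y' a' b' c'"
  shows False
proof -
  define r where "r = sqrt (x\<^sup>2 + A\<^sup>2)"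
  have r: "r > 0" "r\<^sup>2 = x\<^sup>2 + A\<^sup>2" "r > A"
    using x A by (auto simp: r_def add_pos_pos intro: real_less_rsqrt)
  have fc: "f x' 0 A' 0 (- A') = 5 / x' + 8 / sqrt (x'\<^sup>2 + A'\<^sup>2) + 5 / A' + 2 * s * x'\<^sup>2 + 2 * A'\<^sup>2"
    if "x' > 0" "A' > 0" for x' A'
  proof -
    have "2 / (A' - - A') = 1 / A'"
      using that by (simp add: field_simps)
    then show ?thesis
      using that unfolding f_def by simp
  qed
  have posr: "x\<^sup>2 + A\<^sup>2 > 0"
    using x by (simp add: add_pos_nonneg)
  have d1: "((\<lambda>x'. 5 / x') has_real_derivative - 5 / x\<^sup>2) (at x)"
    using x by (auto intro!: derivative_eq_intros simp: power2_eq_square)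
  have "((\<lambda>x'. x'\<^sup>2 + A\<^sup>2) has_real_derivative 2 * x) (at x)"
    by (auto intro!: derivative_eq_intros)
  from DERIV_inverse_sqrt[OF this posr, of 8]
  have d2: "((\<lambda>x'. 8 / sqrt (x'\<^sup>2 + A\<^sup>2)) has_real_derivative - 8 * x / r ^ 3) (at x)"
    by (rule DERIV_cong) (simp add: r_def)
  have "((\<lambda>x'. 5 / x' + 8 / sqrt (x'\<^sup>2 + A\<^sup>2) + 5 / A + 2 * s * x'\<^sup>2 + 2 * A\<^sup>2)
      has_real_derivative - 5 / x\<^sup>2 - 8 * x / r ^ 3 + 4 * s * x) (at x)"
    by ((rule d1 d2 derivative_eq_intros refl)+) simp
  then have "- 5 / x\<^sup>2 - 8 * x / r ^ 3 + 4 * s * x = 0"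
    by (rule DERIV_local_min[OF _ x]) (use min A x in \<open>auto simp: fc[symmetric]\<close>)
  then have eqx: "s = 5 / 4 / x ^ 3 + 2 / r ^ 3"
    using x r(1) by (simp add: field_simps power2_eq_square power3_eq_cube)
  have d1: "((\<lambda>A'. 5 / A') has_real_derivative - 5 / A\<^sup>2) (at A)"
    using A by (auto intro!: derivative_eq_intros simp: power2_eq_square)
  have "((\<lambda>A'. x\<^sup>2 + A'\<^sup>2) has_real_derivative 2 * A) (at A)"
    by (auto intro!: derivative_eq_intros)
  from DERIV_inverse_sqrt[OF this posr, of 8]
  have d2: "((\<lambda>A'. 8 / sqrt (x\<^sup>2 + A'\<^sup>2)) has_real_derivative - 8 * A / r ^ 3) (at A)"
    by (rule DERIV_cong) (simp add: r_def)
  have "((\<lambda>A'. 5 / x + 8 / sqrt (x\<^sup>2 + A'\<^sup>2) + 5 / A' + 2 * s * x\<^sup>2 + 2 * A'\<^sup>2)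
      has_real_derivative - 8 * A / r ^ 3 - 5 / A\<^sup>2 + 4 * A) (at A)"
    by ((rule d1 d2 derivative_eq_intros refl)+) simp
  then have "- 8 * A / r ^ 3 - 5 / A\<^sup>2 + 4 * A = 0"
    by (rule DERIV_local_min[OF _ A]) (use min A x in \<open>auto simp: fc[symmetric]\<close>)
  moreover have "4 * A * (5 / 4 / A ^ 3 + 2 / r ^ 3) = 5 / A\<^sup>2 + 8 * A / r ^ 3"
    using A by (simp add: power2_eq_square power3_eq_cube distrib_left)
  ultimately have "4 * A * (5 / 4 / A ^ 3 + 2 / r ^ 3) = 4 * A * 1"
    by simp
  then have eqA: "1 = 5 / 4 / A ^ 3 + 2 / r ^ 3"
    using A by (metis mult_left_cancel less_irrefl mult_pos_pos zero_less_numeral)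
  define P Q R where "P = 1 / x ^ 3" and "Q = 1 / A ^ 3" and "R = 1 / r ^ 3"
  have pos: "Q > 0" "R > 0"
    using A r by (auto simp: Q_def R_def)
  \<comment> \<open>Replacing 1 by 5/4 Q + 2 R in s \<ge> 12/5 * 1 makes the condition homogeneous
    in the inverse cubes.\<close>
  have eqs: "5 / 4 * P \<ge> 3 * Q + 14 / 5 * R"
  proof -
    have "s = 5 / 4 * P + 2 * R" "1 = 5 / 4 * Q + 2 * R"
      using eqx eqA by (simp_all add: P_def Q_def R_def)
    then show ?thesis
      using s by linarith
  qed
  then have "P > Q"
    using pos by linarith
  then have "x ^ 3 < A ^ 3"
    using x A by (simp add: P_def Q_def field_simps)
  then have xA: "x < A"
    using A power_less_imp_less_base[of x 3 A] by simp
  \<comment> \<open>The pair rises by u and the centre sinks by 2 u; 3 u = 5 x / 12 gives the new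
    distance 13 x / 12.\<close>
  define u where "u = 5 * x / 36"
  have u: "u > 0" "2 * u < A"
    using x xA by (auto simp: u_def)
  define p where "p = r\<^sup>2 + u\<^sup>2"
  \<comment> \<open>The squared distances of the lifted pair to the upper and lower end are p (1 -
    v) and p (1 + v), so the first-order changes cancel in the sum.\<close>
  define v where "v = 2 * A * u / p"
  have p: "p > 0" "sqrt p \<ge> r"
    using r(1) by (auto simp: p_def add_pos_nonneg intro: real_le_rsqrt)
  have v: "0 \<le> v" "v \<le> 3 / 10" "v \<le> 2 * u / r"
  proof -
    have "A * r \<le> r\<^sup>2"
      using mult_right_mono[of A r r] r(1,3) by (simp add: power2_eq_square)
    then have "A * r \<le> p"
      using zero_le_power2[of u] unfolding p_def by linarith
    then have "A / p \<le> 1 / r"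
      using p r(1) by (simp add: field_simps)
    then have "A / p * (2 * u) \<le> 1 / r * (2 * u)"
      using u by (intro mult_right_mono) auto
    then show "v \<le> 2 * u / r"
      by (simp add: v_def mult.commute mult.left_commute)
    moreover have "2 * u / r \<le> 3 / 10"
      using xA r(1,3) by (simp add: u_def field_simps)
    ultimately show "v \<le> 3 / 10"
      by simp
    show "0 \<le> v"
      using A u p by (simp add: v_def)
  qed
  have "f x 0 A 0 (- A) \<le> f x u A (- 2 * u) (- A)"
    using min[of x "- A" "- 2 * u" A u] x A u by simp
  also have "f x u A (- 2 * u) (- A)
      = 1 / x + 4 / sqrt (p * (1 - v)) + 48 / 13 / x + 4 / sqrt (p * (1 + v)) + 2 / (A + 2 * u)
        + 2 / (A - 2 * u) + 1 / A + 2 * s * x\<^sup>2 + 6 * u\<^sup>2 + 2 * A\<^sup>2"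
  proof -
    have 1: "sqrt (x\<^sup>2 + (u - - 2 * u)\<^sup>2) = 13 / 12 * x"
      by (rule real_sqrt_unique) (use x in \<open>simp_all add: u_def power2_eq_square\<close>)
    have "p * (1 - v) = p - 2 * A * u" "p * (1 + v) = p + 2 * A * u"
      using p by (simp_all add: v_def right_diff_distrib distrib_left)
    moreover have "x\<^sup>2 + (u - A)\<^sup>2 = p - 2 * A * u" "x\<^sup>2 + (u - - A)\<^sup>2 = p + 2 * A * u"
      using r(2) by (simp_all add: p_def power2_eq_square algebra_simps)
    ultimately have 2: "x\<^sup>2 + (u - A)\<^sup>2 = p * (1 - v)" "x\<^sup>2 + (u - - A)\<^sup>2 = p * (1 + v)"
      by simp_all
    have 3: "2 / (A - - A) = 1 / A"
      using A by (simp add: field_simps)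
    show ?thesis
      unfolding f_def 1 2 3 by (simp add: power_mult_distrib)
  qed
  also have "f x 0 A 0 (- A) = 5 / x + 8 / r + 5 / A + 2 * s * x\<^sup>2 + 2 * A\<^sup>2"
    using x A by (simp add: fc r_def)
  finally have "4 / 13 / x + 8 / r + 4 / A \<le> 4 / sqrt (p * (1 - v)) + 4 / sqrt (p * (1 + v))
      + (2 / (A + 2 * u) + 2 / (A - 2 * u)) + 6 * u\<^sup>2"
    by simp
  moreover have "4 / sqrt (p * (1 - v)) + 4 / sqrt (p * (1 + v)) \<le> 8 / r + 16 * u\<^sup>2 / r ^ 3"
  proof -
    have "4 / sqrt (p * (1 - v)) + 4 / sqrt (p * (1 + v))
        = 4 / sqrt p * (1 / sqrt (1 - v) + 1 / sqrt (1 + v))"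
      unfolding real_sqrt_mult distrib_left[of "4 / sqrt p"] by simp
    also have "\<dots> \<le> 4 / r * (2 + v\<^sup>2)"
      using p r v by (intro mult_mono inverse_sqrt_sum_le divide_left_mono) auto
    also have "\<dots> \<le> 4 / r * (2 + (2 * u / r)\<^sup>2)"
      using v r by (intro mult_left_mono add_left_mono power_mono) auto
    also have "\<dots> = 8 / r + 16 * u\<^sup>2 / r ^ 3"
      using r(1) by (simp add: power2_eq_square power3_eq_cube field_simps)
    finally show ?thesis .
  qed
  moreover have "2 / (A + 2 * u) + 2 / (A - 2 * u) \<le> 4 / A + 18 * u\<^sup>2 / A ^ 3"
  proof -
    have "u \<le> 5 / 36 * A"
      using xA by (simp add: u_def)
    then have "u\<^sup>2 \<le> (5 / 36 * A)\<^sup>2"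
      using u by (intro power_mono) auto
    then have "u\<^sup>2 \<le> 25 / 1296 * A\<^sup>2"
      by (simp add: power2_eq_square)
    then have "4 * u\<^sup>2 \<le> 1 / 9 * A\<^sup>2"
      using zero_le_power2[of A] by linarith
    then have "8 / 9 * A\<^sup>2 \<le> A\<^sup>2 - 4 * u\<^sup>2"
      by simp
    then have "A * (8 / 9 * A\<^sup>2) \<le> A * (A\<^sup>2 - 4 * u\<^sup>2)"
      using A by (intro mult_left_mono) auto
    then have le: "8 / 9 * A ^ 3 \<le> A * (A\<^sup>2 - 4 * u\<^sup>2)"
      by (simp add: power2_eq_square power3_eq_cube)
    have "2 / (A + 2 * u) + 2 / (A - 2 * u) = 4 / A + 16 * u\<^sup>2 / (A * (A\<^sup>2 - 4 * u\<^sup>2))"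
    proof -
      have "A\<^sup>2 - 4 * u\<^sup>2 = (A + 2 * u) * (A - 2 * u)"
        by (simp add: power2_eq_square algebra_simps)
      then show ?thesis
        using A u by (simp add: divide_simps) (simp add: power2_eq_square algebra_simps)
    qed
    also have "16 * u\<^sup>2 / (A * (A\<^sup>2 - 4 * u\<^sup>2)) \<le> 16 * u\<^sup>2 / (8 / 9 * A ^ 3)"
      using le A by (intro frac_le) auto
    finally show ?thesis
      by simp
  qed
  ultimately have "4 / 13 / x \<le> 18 * u\<^sup>2 / A ^ 3 + 16 * u\<^sup>2 / r ^ 3 + 6 * u\<^sup>2 * 1"
    by simp
  \<comment> \<open>\<open>eqA\<close> converts the inertia cost into inverse cubes as well;
    \<open>eqs\<close> then bounds everything by 1 / x^3, and 625/2592 < 4/13.\<close>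
  also have "\<dots> = u\<^sup>2 * (51 / 2 * Q + 28 * R)"
    unfolding Q_def R_def by (subst eqA) (simp add: algebra_simps)
  also have "\<dots> \<le> u\<^sup>2 * (25 / 2 * P)"
    using eqs pos by (intro mult_left_mono) auto
  also have "\<dots> = 625 / 2592 / x"
    using x by (simp add: u_def P_def power2_eq_square power3_eq_cube)
  finally show False
    using x by (simp add: field_simps)
qed

section \<open>One mirror pair and k bodies on the axis\<close>

definition pair_axis :: "nat \<Rightarrow> real \<Rightarrow> real \<Rightarrow> (nat \<Rightarrow> real) \<Rightarrow> 2 config" where
  "pair_axis k x y a i = (if i = 0 then point x y else if i = 1 then point (- x) y
     else if i < k + 2 then point 0 (a (i - 2)) else 0)"

lemma pair_axis_symmetric: "pair_axis k x y a \<in> symmetric_configs (k + 2) (swap_pairs 1)"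
  by (auto simp: symmetric_configs_def pair_axis_def swap_pairs_def plane_eq_iff elim!: oddE)

lemma pair_axis_inj:
  assumes "x \<noteq> 0" "inj_on a {..<k}"
  shows "inj_on (pair_axis k x y a) {..<k + 2}"
proof (rule inj_onI)
  fix i j assume "i \<in> {..<k + 2}" "j \<in> {..<k + 2}" and eq: "pair_axis k x y a i = pair_axis k x y a j"
  then have ij: "i < k + 2" "j < k + 2" by auto
  have "i \<ge> 2 \<longleftrightarrow> j \<ge> 2"
    using eq ij assms(1) by (auto simp: pair_axis_def plane_eq_iff split: if_splits)
  show "i = j"
  proof (cases "i \<ge> 2")
    case True
    then have "j \<ge> 2" and "a (i - 2) = a (j - 2)"
      using eq ij \<open>i \<ge> 2 \<longleftrightarrow> j \<ge> 2\<close> by (auto simp: pair_axis_def plane_eq_iff)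
    moreover have "i - 2 \<in> {..<k}" "j - 2 \<in> {..<k}"
      using ij True \<open>j \<ge> 2\<close> by auto
    ultimately have "i - 2 = j - 2"
      using inj_onD[OF assms(2)] by blast
    then show ?thesis
      using True \<open>j \<ge> 2\<close> by simp
  next
    case False
    then show ?thesis
      using eq ij \<open>i \<ge> 2 \<longleftrightarrow> j \<ge> 2\<close> assms(1)
      by (auto simp: pair_axis_def plane_eq_iff split: if_splits)
  qed
qed

lemma symmetric_eq_pair_axis:
  assumes q: "q \<in> symmetric_configs (k + 2) (swap_pairs 1)" "inj_on q {..<k + 2}"
  shows "q = pair_axis k (hor (q 0)) (ver (q 0)) (\<lambda>i. ver (q (i + 2)))" "hor (q 0) \<noteq> 0"
proof
  fix i :: nat
  have "q (swap_pairs 1 0) = mirror (q 0)"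
    using q(1) by (simp add: symmetric_configs_def)
  then have 1: "q 1 = mirror (q 0)"
    by (simp add: swap_pairs_def)
  have 2: "hor (q (j + 2)) = 0" if "j < k" for j
    using swap_pairs_axis_iff[OF _ q, of "j + 2"] that by simp
  have 3: "q (j + 2) = 0" if "\<not> j < k" for j
    using q(1) that by (simp add: symmetric_configs_def)
  have "i = 0 \<or> i = 1 \<or> i = (i - 2) + 2"
    by arith
  then consider "i = 0" | "i = 1" | j where "i = j + 2"
    by blast
  then show "q i = pair_axis k (hor (q 0)) (ver (q 0)) (\<lambda>i. ver (q (i + 2))) i"
  proof cases
    case (3 j)
    then show ?thesis
      using 2 \<open>\<And>j. \<not> j < k \<Longrightarrow> q (j + 2) = 0\<close> by (cases "j < k") (simp_all add: pair_axis_def plane_eq_iff)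
  qed (use 1 in \<open>simp_all add: pair_axis_def plane_eq_iff\<close>)
next
  show "hor (q 0) \<noteq> 0"
    using swap_pairs_axis_iff[OF _ q, of 0] by simp
qed

lemma energy_pair_axis:
  "energy (k + 2) s (pair_axis k x y a) = 1 / \<bar>x\<bar> + (\<Sum>i<k. 4 / sqrt (x\<^sup>2 + (y - a i)\<^sup>2))
    + (\<Sum>i<k. \<Sum>j<k. 1 / \<bar>a i - a j\<bar>) + 2 * s * x\<^sup>2 + 2 * y\<^sup>2 + (\<Sum>i<k. (a i)\<^sup>2)"
proof -
  have split: "(\<Sum>i<k + 2. f i) = f 0 + f (Suc 0) + (\<Sum>i<k. f (Suc (Suc i)))" for f :: "nat \<Rightarrow> real"
    using sum.lessThan_Suc_shift[of f "Suc k"] sum.lessThan_Suc_shift[of "\<lambda>i. f (Suc i)" k]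
    by (simp add: add.assoc)
  have val: "pair_axis k x y a 0 = point x y" "pair_axis k x y a (Suc 0) = point (- x) y"
    "i < k \<Longrightarrow> pair_axis k x y a (Suc (Suc i)) = point 0 (a i)" for i
    by (auto simp: pair_axis_def)
  have n1: "norm (point x y - point (- x) y) = 2 * \<bar>x\<bar>" "norm (point (- x) y - point x y) = 2 * \<bar>x\<bar>"
    by (simp_all add: norm_plane real_sqrt_mult)
  have n2: "norm (point x y - point 0 b) = sqrt (x\<^sup>2 + (y - b)\<^sup>2)"
    "norm (point (- x) y - point 0 b) = sqrt (x\<^sup>2 + (y - b)\<^sup>2)"
    "norm (point 0 b - point x y) = sqrt (x\<^sup>2 + (y - b)\<^sup>2)"
    "norm (point 0 b - point (- x) y) = sqrt (x\<^sup>2 + (y - b)\<^sup>2)"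
    "norm (point 0 b - point 0 c) = \<bar>b - c\<bar>" for b c
    by (simp_all add: norm_plane power2_commute)
  have scale: "(\<Sum>i<k. c / sqrt (x\<^sup>2 + (y - a i)\<^sup>2)) = c * (\<Sum>i<k. 1 / sqrt (x\<^sup>2 + (y - a i)\<^sup>2))" for c
    by (simp add: sum_distrib_left)
  have U: "(\<Sum>i<k + 2. \<Sum>j<k + 2. 1 / norm (pair_axis k x y a i - pair_axis k x y a j))
      = 1 / \<bar>x\<bar> + (\<Sum>i<k. 4 / sqrt (x\<^sup>2 + (y - a i)\<^sup>2)) + (\<Sum>i<k. \<Sum>j<k. 1 / \<bar>a i - a j\<bar>)"
    unfolding split by (simp add: val n1 n2 sum.distrib scale[of 2] scale[of 4])
  show ?thesis
    unfolding energy_def U unfolding split by (simp add: val)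
qed

text \<open>Collision-free critical points of \<open>energy\<close>; this is \<open>balanced\<close>
  with multiplier 1.\<close>

definition critical_config :: "nat \<Rightarrow> real \<Rightarrow> 2 config \<Rightarrow> bool" where
  "critical_config n s q \<longleftrightarrow> (\<forall>i\<ge>n. q i = 0) \<and> inj_on q {..<n} \<and>
     (\<forall>i<n. aniso s *v q i = repulsion n q i)"

lemma critical_config_sum_ver:
  assumes "critical_config n s q"
  shows "(\<Sum>i<n. ver (q i)) = 0"
proof -
  have "(\<Sum>i<n. ver (q i)) = (\<Sum>i<n. ver (aniso s *v q i))"
    by (simp add: aniso_mult)
  also have "\<dots> = ver (\<Sum>i<n. repulsion n q i)"
    using assms by (simp add: critical_config_def)
  finally show ?thesis
    by (simp add: sum_repulsion)
qed

text \<open>On the line the balance equation reads s |x|^3 = 5/4. Bending as in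
  \<open>end_pair_barrier\<close> gains 4 / (5 |x|) and costs 6 u^2 = 3/8 x^2, so |x|^3 < 32/15
  would already suffice.\<close>

lemma three_body_horizontal_not_minimal:
  assumes s: "s > 1" and q: "q \<in> symmetric_configs 3 (swap_pairs 1)" "inj_on q {..<3}"
    and bal: "\<forall>i<3. aniso s *v q i = repulsion 3 q i" and hor: "\<forall>i<3. ver (q i) = 0"
  shows "\<exists>z\<in>symmetric_configs 3 (swap_pairs 1). inj_on z {..<3} \<and> energy 3 s z < energy 3 s q"
proof -
  define x where "x = hor (q 0)"
  have q': "q = pair_axis 1 x 0 (\<lambda>_. 0)" and x: "x \<noteq> 0"
  proof -
    have "q = pair_axis 1 x (ver (q 0)) (\<lambda>i. ver (q (i + 2)))" "x \<noteq> 0"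
      using symmetric_eq_pair_axis[of q 1] q by (simp_all add: x_def numeral_3_eq_3)
    moreover have "pair_axis 1 x (ver (q 0)) (\<lambda>i. ver (q (i + 2))) = pair_axis 1 x 0 (\<lambda>_. 0)"
      using hor by (auto simp: pair_axis_def fun_eq_iff less_Suc_eq)
    ultimately show "q = pair_axis 1 x 0 (\<lambda>_. 0)" "x \<noteq> 0"
      by simp_all
  qed
  have hq: "hor (q 0) = x" "hor (q 1) = - x" "hor (q 2) = 0"
    by (simp_all add: q' pair_axis_def)
  have "s * x = (\<Sum>j<3. (hor (q 0) - hor (q j)) / \<bar>hor (q 0) - hor (q j)\<bar> ^ 3)"
    using bal[rule_format, of 0] hor_repulsion[OF hor, of 0] hq by (simp add: aniso_mult plane_eq_iff)
  also have "\<dots> = 2 * x / \<bar>2 * x\<bar> ^ 3 + x / \<bar>x\<bar> ^ 3"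
    using hq by (simp add: numeral_3_eq_3 numeral_2_eq_2)
  also have "\<dots> = x * (5 / 4 / \<bar>x\<bar> ^ 3)"
    by (simp add: abs_mult power_mult_distrib)
  finally have "s = 5 / 4 / \<bar>x\<bar> ^ 3"
    using x by (metis mult.commute mult_left_cancel)
  then have "s * \<bar>x\<bar> ^ 3 = 5 / 4"
    using x by simp
  moreover have "\<bar>x\<bar> ^ 3 < s * \<bar>x\<bar> ^ 3"
    using s x by simp
  ultimately have small: "\<bar>x\<bar> ^ 3 < 5 / 4"
    by simp
  define u where "u = \<bar>x\<bar> / 4"
  define z where "z = pair_axis 1 x u (\<lambda>_. - 2 * u)"
  have 1: "sqrt (x\<^sup>2 + (u - - 2 * u)\<^sup>2) = 5 / 4 * \<bar>x\<bar>"
    by (rule real_sqrt_unique) (simp_all add: u_def power2_eq_square)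
  have "energy 3 s z = 1 / \<bar>x\<bar> + 4 / sqrt (x\<^sup>2 + (u - - 2 * u)\<^sup>2) + 2 * s * x\<^sup>2 + 6 * u\<^sup>2"
    using energy_pair_axis[of 1 s x u "\<lambda>_. - 2 * u"]
    by (simp add: z_def numeral_3_eq_3 power_mult_distrib)
  then have "energy 3 s z = 1 / \<bar>x\<bar> + 16 / 5 / \<bar>x\<bar> + 2 * s * x\<^sup>2 + 6 * u\<^sup>2"
    unfolding 1 by simp
  moreover have "energy 3 s q = 5 / \<bar>x\<bar> + 2 * s * x\<^sup>2"
    using energy_pair_axis[of 1 s x 0 "\<lambda>_. 0"] by (simp add: q' numeral_3_eq_3)
  moreover have "6 * u\<^sup>2 < 4 / 5 / \<bar>x\<bar>"
    using small x by (simp add: u_def field_simps power2_eq_square power3_eq_cube)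
  ultimately have "energy 3 s z < energy 3 s q"
    by (simp add: field_simps)
  moreover have "z \<in> symmetric_configs 3 (swap_pairs 1)" "inj_on z {..<3}"
    using pair_axis_symmetric[of 1 x u] pair_axis_inj[OF x, of "\<lambda>_. - 2 * u" 1 u]
    by (simp_all add: z_def numeral_3_eq_3 lessThan_Suc)
  ultimately show ?thesis
    by blast
qed

lemma symmetric_critical_exists:
  assumes s: "s > 1" and k: "1 \<le> k" "2 * k \<le> n" and n: "3 \<le> n"
  obtains q where "critical_config n s q" "q \<in> symmetric_configs n (swap_pairs k)" "\<exists>i<n. ver (q i) \<noteq> 0"
proof -
  obtain q where q: "q \<in> symmetric_configs n (swap_pairs k)" "inj_on q {..<n}"
    and min: "\<And>z. z \<in> symmetric_configs n (swap_pairs k) \<Longrightarrow> inj_on z {..<n}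
      \<Longrightarrow> energy n s q \<le> energy n s z"
    and bal: "\<forall>i<n. aniso s *v q i = repulsion n q i"
    using symmetric_minimizer[of s k n] s k by auto
  have "\<exists>i<n. ver (q i) \<noteq> 0"
  proof (rule ccontr)
    assume neg: "\<not> ?thesis"
    then have hor: "\<forall>i<n. ver (q i) = 0" by simp
    \<comment> \<open>With fewer than two bodies on the axis and n \<ge> 3, either there are two
      pairs to bend or n = 3.\<close>
    have "\<not> 2 * k + 2 \<le> n"
      using symmetric_two_axis_points[OF _ q] neg by blast
    then consider "2 \<le> k" | "k = 1" "n = 3"
      using k n by linarith
    then show False
    proof cases
      case 1
      then show False
        using horizontal_not_minimal[OF s _ k(2) q bal hor] min by (meson not_less)
    next
      case 2
      then show False
        using three_body_horizontal_not_minimal[OF s, of q] q bal hor min by (metis not_less)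
    qed
  qed
  then show thesis
    using that[of q] q bal by (simp add: critical_config_def symmetric_configs_def)
qed

section \<open>Reflection of heights and similarity\<close>

definition flip :: "2 config \<Rightarrow> 2 config" where
  "flip q i = point (hor (q i)) (- ver (q i))"

lemma hor_flip [simp]: "hor (flip q i) = hor (q i)"
  and ver_flip [simp]: "ver (flip q i) = - ver (q i)"
  by (simp_all add: flip_def)

lemma critical_config_flip:
  assumes "critical_config n s q"
  shows "critical_config n s (flip q)"
proof -
  have "norm (flip q i - flip q j) = norm (q i - q j)" for i j
    by (simp add: norm_plane power2_commute)
  then have "repulsion n (flip q) i = point (hor (repulsion n q i)) (- ver (repulsion n q i))" for i
    by (simp add: plane_eq_iff repulsion_def sum_negf[symmetric] right_diff_distrib)
  then show ?thesis
    using assms by (simp add: critical_config_def inj_on_def plane_eq_iff aniso_mult)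
qed

lemma symmetric_configs_flip: "q \<in> symmetric_configs n \<sigma> \<Longrightarrow> flip q \<in> symmetric_configs n \<sigma>"
  by (simp add: symmetric_configs_def plane_eq_iff)

text \<open>Rotations are left out, as they do not preserve the anisotropic problem; reflections are
  left out so that a configuration and its reflection can count separately.\<close>

definition similar :: "nat \<Rightarrow> 2 config \<Rightarrow> 2 config \<Rightarrow> bool" where
  "similar n q q' \<longleftrightarrow> (\<exists>c>0. \<exists>\<pi>. \<pi> permutes {..<n} \<and> (\<forall>i<n. q' i = c *\<^sub>R q (\<pi> i)))"

lemma similar_axis_count:
  assumes "similar n q q'"
  shows "axis_count n q' = axis_count n q"
proof -
  obtain c \<pi> where c: "c > 0" and \<pi>: "\<pi> permutes {..<n}" and q': "\<And>i. i < n \<Longrightarrow> q' i = c *\<^sub>R q (\<pi> i)"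
    using assms by (auto simp: similar_def)
  have "bij_betw \<pi> {i \<in> {..<n}. hor (q' i) = 0} {i \<in> {..<n}. hor (q i) = 0}"
  proof (rule bij_betw_imageI)
    show "inj_on \<pi> {i \<in> {..<n}. hor (q' i) = 0}"
      using permutes_inj_on[OF \<pi>] by blast
    show "\<pi> ` {i \<in> {..<n}. hor (q' i) = 0} = {i \<in> {..<n}. hor (q i) = 0}"
    proof safe
      fix i assume i: "i < n" "hor (q i) = 0"
      then obtain j where "j < n" "\<pi> j = i"
        using permutes_image[OF \<pi>] by (metis imageE lessThan_iff)
      then show "i \<in> \<pi> ` {i \<in> {..<n}. hor (q' i) = 0}"
        using i q' by force
    qed (use c q' permutes_in_image[OF \<pi>] in auto)
  qed
  then show ?thesis
    unfolding axis_count_def by (rule bij_betw_same_card)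
qed

text \<open>Body 2 is alone on the axis, so the relabelling fixes it, and a positive scale matches
  opposite heights only if they vanish. Zero total height then makes all heights zero.\<close>

lemma three_body_not_similar_flip:
  assumes q: "critical_config 3 s q" "q \<in> symmetric_configs 3 (swap_pairs 1)" "\<exists>i<3. ver (q i) \<noteq> 0"
  shows "\<not> similar 3 q (flip q)"
proof
  assume "similar 3 q (flip q)"
  then obtain c \<pi> where c: "c > 0" and \<pi>: "\<pi> permutes {..<3}"
    and sim: "\<And>i. i < 3 \<Longrightarrow> flip q i = c *\<^sub>R q (\<pi> i)"
    by (auto simp: similar_def)
  have inj: "inj_on q {..<3}"
    using q(1) by (simp add: critical_config_def)
  have axis: "hor (q i) = 0 \<longleftrightarrow> 2 \<le> i" if "i < 3" for i
    using swap_pairs_axis_iff[OF _ q(2) inj that] by simp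
  have "\<pi> 2 < 3"
    using permutes_in_image[OF \<pi>, of 2] by simp
  moreover have "hor (q (\<pi> 2)) = 0"
    using axis[of 2] arg_cong[OF sim[of 2], of hor] c by simp
  ultimately have "\<pi> 2 = 2"
    using axis[of "\<pi> 2"] by simp
  then have "- ver (q 2) = c * ver (q 2)"
    using arg_cong[OF sim[of 2], of ver] by simp
  then have "(c + 1) * ver (q 2) = 0"
    by (simp add: algebra_simps)
  then have "ver (q 2) = 0"
    using c by simp
  moreover have "q (swap_pairs 1 0) = mirror (q 0)"
    using q(2) by (simp add: symmetric_configs_def)
  then have "ver (q 1) = ver (q 0)"
    by (simp add: swap_pairs_def)
  moreover have "ver (q 0) + ver (q 1) + ver (q 2) = 0"
    using critical_config_sum_ver[OF q(1)] by (simp add: numeral_3_eq_3 numeral_2_eq_2)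
  ultimately have "ver (q 0) = 0 \<and> ver (q 1) = 0 \<and> ver (q 2) = 0"
    by simp
  then show False
    using q(3) by (auto simp: less_Suc_eq numeral_3_eq_3 numeral_2_eq_2)
qed

section \<open>Kites of four and five bodies\<close>

lemma four_body_end_kite:
  assumes s: "s \<ge> 12 / 5"
  obtains q where "critical_config 4 s q" "q \<in> symmetric_configs 4 (swap_pairs 1)"
    "ver (q 3) < ver (q 2)" "ver (q 2) < ver (q 0)"
proof -
  \<comment> \<open>The pair is kept on top, since an unrestricted minimizer might be similar to its
    reflection. Weak inequalities make the region closed; strictness is recovered
    afterwards.\<close>
  define Z where "Z = symmetric_configs 4 (swap_pairs 1) \<inter>
    {q. ver (q 3) \<le> ver (q 2)} \<inter> {q. ver (q 2) \<le> ver (q 0)}"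
  have clo: "closed Z"
    unfolding Z_def by (intro closed_Int closed_symmetric_configs closed_Collect_le continuous_intros
        continuous_on_product_coordinates)
  have Z0: "q i = 0" if "q \<in> Z" "i \<ge> 4" for q i
    using that by (simp add: Z_def symmetric_configs_def)
  have lad: "ladder 4 1 \<in> Z"
    using ladder_symmetric[of 1 4] by (simp add: Z_def) (simp add: ladder_def)
  have "s \<ge> 1"
    using s by simp
  from energy_attains_minimum[OF this clo _ lad ladder_inj[of 4 1]] Z0 obtain q where q: "q \<in> Z" "inj_on q {..<4}"
    and min: "\<And>z. z \<in> Z \<Longrightarrow> inj_on z {..<4} \<Longrightarrow> energy 4 s q \<le> energy 4 s z"
    by blast
  have sym: "q \<in> symmetric_configs 4 (swap_pairs 1)" and le: "ver (q 3) \<le> ver (q 2)" "ver (q 2) \<le> ver (q 0)"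
    using q(1) by (auto simp: Z_def)
  define x y a where "x = hor (q 0)" and "y = ver (q 0)" and "a i = ver (q (i + 2))" for i
  have qx: "q = pair_axis 2 x y a" "x \<noteq> 0"
    using symmetric_eq_pair_axis[of q 2] sym q(2) by (simp_all add: x_def y_def a_def[abs_def])
  have a: "a 0 = ver (q 2)" "a 1 = ver (q 3)"
    by (simp_all add: a_def numeral_2_eq_2 numeral_3_eq_3)
  have "q 2 \<noteq> q 3"
    using inj_onD[OF q(2), of 2 3] by auto
  then have "ver (q 2) \<noteq> ver (q 3)"
    using swap_pairs_axis_iff[OF _ sym q(2), of 2] swap_pairs_axis_iff[OF _ sym q(2), of 3]
    by (auto simp: plane_eq_iff)
  then have "a 0 \<noteq> a 1"
    using a by simp
  then have a_less: "a 1 < a 0"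
    using le a by simp
  have sum2: "(\<Sum>i<2. g i) = g 0 + g 1" for g :: "nat \<Rightarrow> real"
    by (simp add: eval_nat_numeral)
  have energy: "energy 4 s (pair_axis 2 x' y' b) = 1 / \<bar>x'\<bar> + 4 / sqrt (x'\<^sup>2 + (y' - b 0)\<^sup>2)
      + 4 / sqrt (x'\<^sup>2 + (y' - b 1)\<^sup>2) + 2 / (b 0 - b 1) + 2 * s * \<bar>x'\<bar>\<^sup>2 + 2 * y'\<^sup>2 + (b 0)\<^sup>2 + (b 1)\<^sup>2"
    if "b 1 < b 0" for x' y' b
    using energy_pair_axis[of 2 s x' y' b] that by (simp add: sum2)
  \<comment> \<open>The only wall that is not a collision, ruled out by
    \<open>end_pair_barrier\<close>.\<close>
  have "a 0 \<noteq> y"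
  proof
    assume eq: "a 0 = y"
    show False
    proof (rule end_pair_barrier[OF s, of "\<bar>x\<bar>" "a 1" y])
      show "0 < \<bar>x\<bar>" "a 1 < y"
        using qx a_less eq by auto
      fix x' y' a' b' :: real assume x': "x' > 0" and b': "b' < a'" "a' \<le> y'"
      define b where "b i = (if i = 0 then a' else b')" for i :: nat
      define z where "z = pair_axis 2 x' y' b"
      have "inj_on b {..<2}"
        using b' by (auto simp: inj_on_def b_def)
      then have "inj_on z {..<4}"
        using pair_axis_inj[of x' b 2 y'] x' by (simp add: z_def)
      moreover have "z \<in> Z"
        using pair_axis_symmetric[of 2 x' y' b] b' by (simp add: z_def Z_def) (simp add: pair_axis_def b_def)
      ultimately have "energy 4 s q \<le> energy 4 s z"
        using min by blast
      then show "1 / \<bar>x\<bar> + 4 / sqrt (\<bar>x\<bar>\<^sup>2 + (y - y)\<^sup>2) + 4 / sqrt (\<bar>x\<bar>\<^sup>2 + (y - a 1)\<^sup>2)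
          + 2 / (y - a 1) + 2 * s * \<bar>x\<bar>\<^sup>2 + 2 * y\<^sup>2 + y\<^sup>2 + (a 1)\<^sup>2
        \<le> 1 / x' + 4 / sqrt (x'\<^sup>2 + (y' - a')\<^sup>2) + 4 / sqrt (x'\<^sup>2 + (y' - b')\<^sup>2)
          + 2 / (a' - b') + 2 * s * x'\<^sup>2 + 2 * y'\<^sup>2 + a'\<^sup>2 + b'\<^sup>2"
        using energy[of a x y] energy[of b x' y'] a_less x' b' eq by (simp add: qx(1)[symmetric] z_def b_def)
    qed
  qed
  then have less: "ver (q 3) < ver (q 2)" "ver (q 2) < ver (q 0)"
    using le a a_less by (auto simp: y_def)
  define R where "R = {q :: 2 config. ver (q 3) < ver (q 2)} \<inter> {q. ver (q 2) < ver (q 0)}"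
  have "open R"
    unfolding R_def by (intro open_Int open_Collect_less continuous_intros continuous_on_product_coordinates)
  then have "\<forall>i<4. aniso s *v q i = repulsion 4 q i"
    using less min
    by (intro symmetric_local_minimum_balanced[OF swap_pairs_permutes[of 1 4] sym q(2), of R])
      (auto simp: R_def Z_def)
  then show thesis
    using that[of q] sym q(2) less by (simp add: critical_config_def symmetric_configs_def)
qed

text \<open>The highest bodies of \<open>q\<close> form the pair, whereas a highest body of
  \<open>flip q\<close> is body 3 on the axis. Similarity respects both heights and the
  axis.\<close>

lemma four_body_end_kite_not_similar_flip:
  assumes q: "q \<in> symmetric_configs 4 (swap_pairs 1)" "inj_on q {..<4}"
    and less: "ver (q 3) < ver (q 2)" "ver (q 2) < ver (q 0)"
  shows "\<not> similar 4 q (flip q)"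
proof
  assume "similar 4 q (flip q)"
  then obtain c \<pi> where c: "c > 0" and \<pi>: "\<pi> permutes {..<4}"
    and sim: "\<And>i. i < 4 \<Longrightarrow> flip q i = c *\<^sub>R q (\<pi> i)"
    by (auto simp: similar_def)
  have axis: "hor (q i) = 0 \<longleftrightarrow> 2 \<le> i" if "i < 4" for i
    using swap_pairs_axis_iff[OF _ q that] by simp
  have "\<pi> 3 < 4"
    using permutes_in_image[OF \<pi>, of 3] by simp
  moreover have "hor (q (\<pi> 3)) = 0"
    using axis[of 3] arg_cong[OF sim[of 3], of hor] c by simp
  ultimately have "\<pi> 3 = 2 \<or> \<pi> 3 = 3"
    using axis[of "\<pi> 3"] by auto
  then have 3: "ver (q (\<pi> 3)) < ver (q 0)"
    using less by auto
  obtain j where j: "j < 4" "\<pi> j = 0"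
    using permutes_image[OF \<pi>] by (metis imageE lessThan_iff zero_less_numeral)
  have "q (swap_pairs 1 0) = mirror (q 0)"
    using q(1) by (simp add: symmetric_configs_def)
  then have "ver (q 1) = ver (q 0)"
    by (simp add: swap_pairs_def)
  moreover have "j = 0 \<or> j = 1 \<or> j = 2 \<or> j = 3"
    using j(1) by auto
  ultimately have "ver (q 3) \<le> ver (q j)"
    using less by auto
  then have "c * ver (q 0) \<le> c * ver (q (\<pi> 3))"
    using arg_cong[OF sim[of 3], of ver] arg_cong[OF sim[of j], of ver] j by simp
  then show False
    using c 3 by simp
qed

lemma five_body_asymmetric_kite:
  assumes s: "s \<ge> 12 / 5"
  obtains q where "critical_config 5 s q" "q \<in> symmetric_configs 5 (swap_pairs 1)"
    "\<not> similar 5 q (flip q)"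
proof -
  \<comment> \<open>The order merely labels the axis bodies. Its boundary consists of collisions, so
    the minimizer is interior without a barrier argument.\<close>
  define Z where "Z = symmetric_configs 5 (swap_pairs 1) \<inter>
    {q. ver (q 3) \<le> ver (q 2)} \<inter> {q. ver (q 4) \<le> ver (q 3)}"
  have clo: "closed Z"
    unfolding Z_def by (intro closed_Int closed_symmetric_configs closed_Collect_le continuous_intros
        continuous_on_product_coordinates)
  have Z0: "q i = 0" if "q \<in> Z" "i \<ge> 5" for q i
    using that by (simp add: Z_def symmetric_configs_def)
  have lad: "ladder 5 1 \<in> Z"
    using ladder_symmetric[of 1 5] by (simp add: Z_def) (simp add: ladder_def)
  have "s \<ge> 1"
    using s by simp
  from energy_attains_minimum[OF this clo _ lad ladder_inj[of 5 1]] Z0 obtain q where q: "q \<in> Z" "inj_on q {..<5}"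
    and min: "\<And>z. z \<in> Z \<Longrightarrow> inj_on z {..<5} \<Longrightarrow> energy 5 s q \<le> energy 5 s z"
    by blast
  have sym: "q \<in> symmetric_configs 5 (swap_pairs 1)" and le: "ver (q 3) \<le> ver (q 2)" "ver (q 4) \<le> ver (q 3)"
    using q(1) by (auto simp: Z_def)
  have axis: "hor (q i) = 0 \<longleftrightarrow> 2 \<le> i" if "i < 5" for i
    using swap_pairs_axis_iff[OF _ sym q(2) that] by simp
  have "q 2 \<noteq> q 3" "q 3 \<noteq> q 4"
    using inj_onD[OF q(2), of 2 3] inj_onD[OF q(2), of 3 4] by auto
  then have less: "ver (q 3) < ver (q 2)" "ver (q 4) < ver (q 3)"
    using le axis[of 2] axis[of 3] axis[of 4] by (auto simp: plane_eq_iff)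
  define R where "R = {q :: 2 config. ver (q 3) < ver (q 2)} \<inter> {q. ver (q 4) < ver (q 3)}"
  have "open R"
    unfolding R_def by (intro open_Int open_Collect_less continuous_intros continuous_on_product_coordinates)
  then have "\<forall>i<5. aniso s *v q i = repulsion 5 q i"
    using less min
    by (intro symmetric_local_minimum_balanced[OF swap_pairs_permutes[of 1 5] sym q(2), of R])
      (auto simp: R_def Z_def)
  then have crit: "critical_config 5 s q"
    using sym q(2) by (simp add: critical_config_def symmetric_configs_def)
  define x y a where "x = hor (q 0)" and "y = ver (q 0)" and "a i = ver (q (i + 2))" for i
  have qx: "q = pair_axis 3 x y a" "x \<noteq> 0"
    using symmetric_eq_pair_axis[of q 3] sym q(2) by (simp_all add: x_def y_def a_def[abs_def])
  have a: "a 0 = ver (q 2)" "a 1 = ver (q 3)" "a 2 = ver (q 4)"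
    by (simp_all add: a_def numeral_2_eq_2 numeral_3_eq_3 eval_nat_numeral)
  have q1: "hor (q 1) = - x" "ver (q 1) = y"
    by (simp_all add: qx(1) pair_axis_def)
  \<comment> \<open>If \<open>q\<close> were similar to its reflection, the horizontal extent of the
    pair would force c = 1. The pair would then have height 0 and the axis bodies symmetric heights,
    which is the excluded cross.\<close>
  have "\<not> similar 5 q (flip q)"
  proof
    assume "similar 5 q (flip q)"
    then obtain c \<pi> where c: "c > 0" and \<pi>: "\<pi> permutes {..<5}"
      and sim: "\<And>i. i < 5 \<Longrightarrow> flip q i = c *\<^sub>R q (\<pi> i)"
      by (auto simp: similar_def)
    have \<pi>5: "\<pi> i < 5" if "i < 5" for i
      using permutes_in_image[OF \<pi>, of i] that by simp
    have sim_hor: "hor (q i) = c * hor (q (\<pi> i))" and sim_ver: "- ver (q i) = c * ver (q (\<pi> i))" if "i < 5" for i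
      using arg_cong[OF sim[OF that], of hor] arg_cong[OF sim[OF that], of ver] by simp_all
    have \<pi>_axis: "2 \<le> \<pi> i \<longleftrightarrow> 2 \<le> i" if "i < 5" for i
      using axis[OF that] axis[OF \<pi>5[OF that]] sim_hor[OF that] c by simp
    have "\<pi> 0 = 0 \<or> \<pi> 0 = 1"
      using \<pi>_axis[of 0] by auto
    then have pi0: "\<bar>hor (q (\<pi> 0))\<bar> = \<bar>x\<bar>" "ver (q (\<pi> 0)) = y"
      using q1 by (auto simp: x_def y_def)
    have "\<bar>x\<bar> = c * \<bar>x\<bar>"
      using arg_cong[OF sim_hor[of 0], of abs] c pi0(1) by (simp add: abs_mult x_def)
    then have c1: "c = 1"
      using qx(2) by simp
    have y0: "y = 0"
      using sim_ver[of 0] pi0(2) c1 by (simp add: y_def)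
    have range: "a 2 \<le> ver (q (\<pi> i)) \<and> ver (q (\<pi> i)) \<le> a 0" if "i < 5" "2 \<le> i" for i
    proof -
      have "\<pi> i = 2 \<or> \<pi> i = 3 \<or> \<pi> i = 4"
        using \<pi>_axis[OF that(1)] \<pi>5[OF that(1)] that(2) by auto
      then show ?thesis
        using less a by auto
    qed
    have a02: "a 2 = - a 0"
      using range[of 2] range[of 4] sim_ver[of 2] sim_ver[of 4] c1 a by auto
    have "2 * y + a 0 + a 1 + a 2 = 0"
      using critical_config_sum_ver[OF crit] q1(2) a
      by (simp add: eval_nat_numeral y_def)
    then have a1: "a 1 = 0"
      using y0 a02 by simp
    have a0: "a 0 > 0"
      using less a a1 by simp
    have sum3: "(\<Sum>i<3. g i) = g 0 + g 1 + g 2" for g :: "nat \<Rightarrow> real"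
      by (simp add: eval_nat_numeral)
    have energy: "energy 5 s (pair_axis 3 x' y' b) = 1 / \<bar>x'\<bar> + 4 / sqrt (x'\<^sup>2 + (y' - b 0)\<^sup>2)
        + 4 / sqrt (x'\<^sup>2 + (y' - b 1)\<^sup>2) + 4 / sqrt (x'\<^sup>2 + (y' - b 2)\<^sup>2)
        + 2 / (b 0 - b 1) + 2 / (b 1 - b 2) + 2 / (b 0 - b 2)
        + 2 * s * \<bar>x'\<bar>\<^sup>2 + 2 * y'\<^sup>2 + (b 0)\<^sup>2 + (b 1)\<^sup>2 + (b 2)\<^sup>2"
      if "b 1 < b 0" "b 2 < b 1" for x' y' b
      using energy_pair_axis[of 3 s x' y' b] that by (simp add: sum3)
    show False
    proof (rule cross_not_minimal[OF s, of "\<bar>x\<bar>" "a 0"])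
      show "0 < \<bar>x\<bar>" "0 < a 0"
        using qx a0 by auto
      fix x' y' a' b' c' :: real assume x': "x' > 0" and b': "c' < b'" "b' < a'"
      define b where "b i = (if i = 0 then a' else if i = 1 then b' else c')" for i :: nat
      define z where "z = pair_axis 3 x' y' b"
      have "inj_on b {..<3}"
        using b' by (auto simp: inj_on_def b_def less_Suc_eq numeral_3_eq_3)
      then have "inj_on z {..<5}"
        using pair_axis_inj[of x' b 3 y'] x' by (simp add: z_def)
      moreover have "z \<in> Z"
        using pair_axis_symmetric[of 3 x' y' b] b' by (simp add: z_def Z_def) (simp add: pair_axis_def b_def)
      ultimately have "energy 5 s q \<le> energy 5 s z"
        using min by blast
      then show "1 / \<bar>x\<bar> + 4 / sqrt (\<bar>x\<bar>\<^sup>2 + (0 - a 0)\<^sup>2) + 4 / sqrt (\<bar>x\<bar>\<^sup>2 + (0 - 0)\<^sup>2)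
          + 4 / sqrt (\<bar>x\<bar>\<^sup>2 + (0 - - a 0)\<^sup>2) + 2 / (a 0 - 0) + 2 / (0 - - a 0) + 2 / (a 0 - - a 0)
          + 2 * s * \<bar>x\<bar>\<^sup>2 + 2 * 0\<^sup>2 + (a 0)\<^sup>2 + 0\<^sup>2 + (- a 0)\<^sup>2
        \<le> 1 / x' + 4 / sqrt (x'\<^sup>2 + (y' - a')\<^sup>2) + 4 / sqrt (x'\<^sup>2 + (y' - b')\<^sup>2)
          + 4 / sqrt (x'\<^sup>2 + (y' - c')\<^sup>2) + 2 / (a' - b') + 2 / (b' - c') + 2 / (a' - c')
          + 2 * s * x'\<^sup>2 + 2 * y'\<^sup>2 + a'\<^sup>2 + b'\<^sup>2 + c'\<^sup>2"
        using energy[of a x y] energy[of b x' y'] x' b' a0 y0 a1 a02 qx(1)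
        by (simp add: z_def b_def)
    qed
  qed
  then show thesis
    using that crit sym by blast
qed

section \<open>Similarity classes\<close>

lemma similar_refl: "similar n q q"
  unfolding similar_def by (intro exI[of _ 1] exI[of _ id] conjI permutes_id) auto

lemma similar_sym:
  assumes "similar n q q'"
  shows "similar n q' q"
proof -
  obtain c \<pi> where c: "c > 0" and \<pi>: "\<pi> permutes {..<n}" and q': "\<And>i. i < n \<Longrightarrow> q' i = c *\<^sub>R q (\<pi> i)"
    using assms by (auto simp: similar_def)
  have "q i = inverse c *\<^sub>R q' (inv_into UNIV \<pi> i)" if "i < n" for i
    using q'[of "inv_into UNIV \<pi> i"] permutes_in_image[OF permutes_inv[OF \<pi>], of i] that c
    by (simp add: permutes_inverses[OF \<pi>])
  then show ?thesis
    unfolding similar_def using c permutes_inv[OF \<pi>]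
    by (intro exI[of _ "inverse c"] exI[of _ "inv_into UNIV \<pi>"]) auto
qed

lemma similar_collinear:
  assumes "similar n q q'" "collinear_config n q"
  shows "collinear_config n q'"
proof -
  obtain c \<pi> where \<pi>: "\<pi> permutes {..<n}" and q': "\<And>i. i < n \<Longrightarrow> q' i = c *\<^sub>R q (\<pi> i)"
    using assms(1) by (auto simp: similar_def)
  obtain L where L: "subspace L" "dim L = 1" "\<forall>i<n. q i \<in> L"
    using assms(2) by (auto simp: collinear_config_def)
  have "q' i \<in> L" if "i < n" for i
    using L q'[OF that] permutes_in_image[OF \<pi>, of i] that by (simp add: subspace_scale)
  then show ?thesis
    using L unfolding collinear_config_def by blast
qed

lemma balanced_permute:
  assumes \<pi>: "\<pi> permutes {..<n}" and q: "balanced n S q"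
  shows "balanced n S (\<lambda>i. q (\<pi> i))"
proof -
  have in_iff: "\<pi> i < n \<longleftrightarrow> i < n" for i
    using permutes_in_image[OF \<pi>, of i] by simp
  have "repulsion n (\<lambda>i. q (\<pi> i)) i = repulsion n q (\<pi> i)" for i
    unfolding repulsion_def
    using sum.permute[OF \<pi>, of "\<lambda>j. (1 / norm (q (\<pi> i) - q j) ^ 3) *\<^sub>R (q (\<pi> i) - q j)"]
    by (simp add: o_def)
  moreover have "inj_on (\<lambda>i. q (\<pi> i)) {..<n}"
    using comp_inj_on[of \<pi> "{..<n}" q] permutes_inj_on[OF \<pi>] permutes_image[OF \<pi>] q
    by (simp add: balanced_def o_def)
  ultimately show ?thesis
    using q in_iff by (auto simp: balanced_def permutes_not_in[OF \<pi>] not_less[symmetric])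
qed

definition normalize_config :: "nat \<Rightarrow> (nat \<Rightarrow> real) \<Rightarrow> real^2^2 \<Rightarrow> 2 config \<Rightarrow> 2 config" where
  "normalize_config n m S q = (\<lambda>i. (1 / sqrt (inertia n m S q)) *\<^sub>R q i)"

lemma inertia_aniso_pos:
  assumes n: "n \<ge> 2" and m: "\<And>i. i < n \<Longrightarrow> m i > 0" and s: "s > 0" and inj: "inj_on q {..<n}"
  shows "inertia n m (aniso s) q > 0"
proof -
  have form: "(aniso s *v p) \<bullet> p = s * (hor p)\<^sup>2 + (ver p)\<^sup>2" for p
    by (simp add: inner_plane aniso_mult power2_eq_square)
  have ne: "q 0 \<noteq> q 1"
    using inj_onD[OF inj, of 0 1] n by auto
  obtain i where i: "i < n" "q i \<noteq> 0"
  proof (cases "q 0 = 0")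
    case True
    then show thesis using that[of 1] ne n by auto
  next
    case False
    then show thesis using that[of 0] n by auto
  qed
  then have "s * (hor (q i))\<^sup>2 + (ver (q i))\<^sup>2 > 0"
    using s by (cases "hor (q i) = 0") (simp_all add: plane_eq_iff add_pos_nonneg)
  then have "m i * (s * (hor (q i))\<^sup>2 + (ver (q i))\<^sup>2) > 0"
    using m[OF i(1)] by simp
  moreover have "m j * (s * (hor (q j))\<^sup>2 + (ver (q j))\<^sup>2) \<ge> 0" if "j < n" for j
    using m[OF that] s by simp
  ultimately show ?thesis
    unfolding inertia_def form using i by (intro sum_pos2[of "{..<n}" i]) auto
qed

lemma normalize_balanced_is_SBC:
  assumes n: "n \<ge> 2" and m: "m0 > 0" "\<And>i. i < n \<Longrightarrow> m i = m0" and s: "s > 0"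
    and q: "balanced n (aniso s) q"
  shows "is_SBC n m (aniso s) (normalize_config n m (aniso s) q)"
proof -
  let ?S = "aniso s"
  obtain \<mu> where \<mu>: "\<mu> > 0" "\<And>i. i < n \<Longrightarrow> \<mu> *\<^sub>R (?S *v q i) = repulsion n q i"
    and zero: "\<forall>i\<ge>n. q i = 0" and inj: "inj_on q {..<n}"
    using q by (auto simp: balanced_def)
  define r where "r = 1 / sqrt (inertia n m ?S q)"
  have I: "inertia n m ?S q > 0"
    using inertia_aniso_pos[OF n _ s inj] m by simp
  then have r: "r > 0" "r\<^sup>2 * inertia n m ?S q = 1"
    by (simp_all add: r_def power_divide)
  define p where "p = normalize_config n m ?S q"
  have p: "p i = r *\<^sub>R q i" for i
    by (simp add: p_def normalize_config_def r_def)
  have p_inj: "inj_on p {..<n}"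
    using inj r(1) by (simp add: p inj_on_def)
  have Sp: "?S *v p i = r *\<^sub>R (?S *v q i)" for i
    by (simp add: p aniso_mult plane_eq_iff)
  \<comment> \<open>Centring is automatic: the total repulsion vanishes and \<open>S\<close> is
    invertible.\<close>
  have "\<mu> *\<^sub>R (\<Sum>i<n. ?S *v q i) = 0"
    using \<mu>(2) sum_repulsion[of n q] by (simp add: scaleR_right.sum)
  then have "(\<Sum>i<n. ?S *v q i) = 0"
    using \<mu>(1) by simp
  then have "s * (\<Sum>i<n. hor (q i)) = 0" "(\<Sum>i<n. ver (q i)) = 0"
    by (simp_all add: aniso_mult plane_eq_iff sum_distrib_left)
  then have "(\<Sum>i<n. q i) = 0"
    using s by (simp add: plane_eq_iff)
  moreover have "(\<Sum>i<n. m i *\<^sub>R p i) = (m0 * r) *\<^sub>R (\<Sum>i<n. q i)"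
    using m(2) by (simp add: p scaleR_right.sum)
  ultimately have "p \<in> centered_configs n m"
    using zero by (simp add: centered_configs_def p)
  moreover have "p \<notin> collisions n"
    using p_inj by (auto simp: collisions_def inj_on_def)
  moreover have "inertia n m ?S p = 1"
  proof -
    have "inertia n m ?S p = r\<^sup>2 * inertia n m ?S q"
      by (simp add: inertia_def Sp p sum_distrib_left power2_eq_square algebra_simps)
    then show ?thesis
      using r(2) by simp
  qed
  \<comment> \<open>The force carries m0^2 / r^2 and the linear term m0 r, which leaves m0 \<mu> /
    r^3 as multiplier.\<close>
  moreover have "balance_equations n m ?S (m0 * \<mu> / r ^ 3) p"
    unfolding balance_equations_iff[OF p_inj]
  proof (intro allI impI)
    fix i assume i: "i < n"
    have "(\<Sum>j<n. (m i * m j / norm (p i - p j) ^ 3) *\<^sub>R (p i - p j))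
        = (\<Sum>j<n. (m0\<^sup>2 / r\<^sup>2) *\<^sub>R ((1 / norm (q i - q j) ^ 3) *\<^sub>R (q i - q j)))"
    proof (rule sum.cong)
      fix j assume "j \<in> {..<n}"
      then have "m i = m0" "m j = m0"
        using m(2) i by auto
      moreover have "p i - p j = r *\<^sub>R (q i - q j)"
        by (simp add: p scaleR_diff_right)
      ultimately show "(m i * m j / norm (p i - p j) ^ 3) *\<^sub>R (p i - p j)
          = (m0\<^sup>2 / r\<^sup>2) *\<^sub>R ((1 / norm (q i - q j) ^ 3) *\<^sub>R (q i - q j))"
        using r(1) by (simp add: power_mult_distrib power2_eq_square power3_eq_cube)
    qed simp
    also have "\<dots> = (m0\<^sup>2 / r\<^sup>2 * \<mu>) *\<^sub>R (?S *v q i)"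
      unfolding scaleR_right.sum[symmetric] repulsion_def[symmetric] \<mu>(2)[OF i, symmetric] by simp
    also have "\<dots> = (m0 * \<mu> / r ^ 3 * m i) *\<^sub>R (?S *v p i)"
      using r(1) m(2)[OF i] by (simp add: Sp power2_eq_square power3_eq_cube)
    finally show "(m0 * \<mu> / r ^ 3 * m i) *\<^sub>R (?S *v p i)
        = (\<Sum>j<n. (m i * m j / norm (p i - p j) ^ 3) *\<^sub>R (p i - p j))" ..
  qed
  moreover have "m0 * \<mu> / r ^ 3 > 0"
    using m(1) \<mu>(1) r(1) by simp
  ultimately show ?thesis
    unfolding is_SBC_def p_def[symmetric] by blast
qed

lemma inertia_permute:
  assumes \<pi>: "\<pi> permutes {..<n}" and m: "\<And>i. i < n \<Longrightarrow> m i = m0"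
  shows "inertia n m S (\<lambda>i. q (\<pi> i)) = inertia n m S q"
proof -
  have "inertia n m S q' = (\<Sum>i<n. m0 * ((S *v q' i) \<bullet> q' i))" for q'
    using m by (simp add: inertia_def)
  then show ?thesis
    using sum.permute[OF \<pi>, of "\<lambda>i. m0 * ((S *v q i) \<bullet> q i)"] by (simp add: o_def)
qed

text \<open>Since the masses are equal, the symmetric group acts freely on the set of balanced
  configurations, so each similarity class contributes \<open>n!\<close> of them.\<close>

lemma at_least_SBC_orbits:
  assumes n: "n \<ge> 2" and m: "m0 > 0" "\<And>i. i < n \<Longrightarrow> m i = m0" and s: "s > 0"
    and Q: "finite Q" "\<And>q. q \<in> Q \<Longrightarrow> balanced n (aniso s) q"
      "\<And>q q'. q \<in> Q \<Longrightarrow> q' \<in> Q \<Longrightarrow> similar n q q' \<Longrightarrow> q = q'"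
    and P: "\<And>q q'. q \<in> Q \<Longrightarrow> similar n q q' \<Longrightarrow> P q'"
    and b: "b \<le> real (card Q) * fact n"
  shows "at_least b {q. is_SBC n m (aniso s) q \<and> P q}"
proof -
  define Sym where "Sym = {\<pi>. \<pi> permutes {..<n}}"
  define f :: "2 config \<times> (nat \<Rightarrow> nat) \<Rightarrow> 2 config" where "f = (\<lambda>(q, \<pi>). normalize_config n m (aniso s) (\<lambda>i. q (\<pi> i)))"
  have I: "inertia n m (aniso s) q > 0" if "q \<in> Q" for q
    using inertia_aniso_pos[OF n _ s] Q(2)[OF that] m by (simp add: balanced_def)
  have f: "f (q, \<pi>) i = (1 / sqrt (inertia n m (aniso s) q)) *\<^sub>R q (\<pi> i)" if "\<pi> \<in> Sym" for q \<pi> i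
    using that inertia_permute[of \<pi> n m m0 "aniso s" q] m(2) by (simp add: f_def normalize_config_def Sym_def)
  have sim: "similar n q (f (q, \<pi>))" if "q \<in> Q" "\<pi> \<in> Sym" for q \<pi>
    unfolding similar_def using f[OF that(2), of q] I[OF that(1)] that(2)
    by (intro exI[of _ "1 / sqrt (inertia n m (aniso s) q)"] exI[of _ \<pi>] conjI allI impI)
      (simp_all add: Sym_def)
  have "inj_on f (Q \<times> Sym)"
  proof (rule inj_onI, safe)
    fix q \<pi> q' \<pi>' assume q: "q \<in> Q" "q' \<in> Q" and \<pi>: "\<pi> \<in> Sym" "\<pi>' \<in> Sym"
      and eq: "f (q, \<pi>) = f (q', \<pi>')"
    \<comment> \<open>Equal images make the representatives similar through the relabelling
      \<open>\<pi> \<circ> inv_into UNIV \<pi>'\<close>, hence equal; injectivity of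
      \<open>q\<close> then recovers the permutation.\<close>
    have trans: "similar n q q'"
    proof -
      define c where "c = 1 / sqrt (inertia n m (aniso s) q)"
      define c' where "c' = 1 / sqrt (inertia n m (aniso s) q')"
      have c: "c > 0" "c' > 0"
        using I q by (auto simp: c_def c'_def)
      have "c *\<^sub>R q (\<pi> i) = c' *\<^sub>R q' (\<pi>' i)" for i
        using fun_cong[OF eq, of i] f[OF \<pi>(1), of q i] f[OF \<pi>(2), of q' i] by (simp add: c_def c'_def)
      from this[of "inv_into UNIV \<pi>' i" for i]
      have "c *\<^sub>R q (\<pi> (inv_into UNIV \<pi>' i)) = c' *\<^sub>R q' i" for i
        using permutes_inverses(1)[of \<pi>' "{..<n}" i] \<pi>(2) by (simp add: Sym_def)
      from arg_cong[OF this, of "\<lambda>v. (1 / c') *\<^sub>R v"]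
      have "q' i = (c / c') *\<^sub>R q (\<pi> (inv_into UNIV \<pi>' i))" for i
        using c by simp
      moreover have "(\<pi> \<circ> inv_into UNIV \<pi>') permutes {..<n}"
        using \<pi> by (auto simp: Sym_def intro: permutes_compose permutes_inv)
      ultimately show ?thesis
        unfolding similar_def using c by (intro exI[of _ "c / c'"] exI[of _ "\<pi> \<circ> inv_into UNIV \<pi>'"]) auto
    qed
    show "q = q'"
      using Q(3)[OF q trans] .
    have "\<pi> i = \<pi>' i" for i
    proof (cases "i < n")
      case True
      have "q (\<pi> i) = q (\<pi>' i)"
        using fun_cong[OF eq, of i] f[OF \<pi>(1), of q i] f[OF \<pi>(2), of q' i] I[OF q(1)] \<open>q = q'\<close> by simp
      moreover have "\<pi> i < n" "\<pi>' i < n"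
        using permutes_in_image[of \<pi> "{..<n}" i] permutes_in_image[of \<pi>' "{..<n}" i] \<pi> True
        by (auto simp: Sym_def)
      ultimately show ?thesis
        using Q(2)[OF q(1)] by (auto simp: balanced_def dest: inj_onD)
    next
      case False
      then show ?thesis
        using \<pi> permutes_not_in[of \<pi> "{..<n}" i] permutes_not_in[of \<pi>' "{..<n}" i]
        by (simp add: Sym_def)
    qed
    then show "\<pi> = \<pi>'"
      by blast
  qed
  moreover have "card Sym = fact n" "finite Sym"
    using card_permutations[of "{..<n}" n] finite_permutations[of "{..<n}"] by (simp_all add: Sym_def)
  ultimately have "card (f ` (Q \<times> Sym)) = card Q * fact n" "finite (f ` (Q \<times> Sym))"
    using Q(1) by (simp_all add: card_image card_cartesian_product)
  moreover have "f ` (Q \<times> Sym) \<subseteq> {q. is_SBC n m (aniso s) q \<and> P q}"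
  proof safe
    fix q \<pi> assume q: "q \<in> Q" "\<pi> \<in> Sym"
    then have "\<pi> permutes {..<n}"
      by (simp add: Sym_def)
    then show "is_SBC n m (aniso s) (f (q, \<pi>))"
      using normalize_balanced_is_SBC[OF n m s balanced_permute[OF _ Q(2)[OF q(1)]]] by (simp add: f_def)
    show "P (f (q, \<pi>))"
      using P sim q by blast
  qed
  ultimately show ?thesis
    using b unfolding at_least_def by (intro exI[of _ "f ` (Q \<times> Sym)"]) simp
qed

section \<open>Pairwise dissimilar non-collinear critical points\<close>

definition noncollinear_family :: "nat \<Rightarrow> real \<Rightarrow> 2 config set \<Rightarrow> bool" where
  "noncollinear_family n s Q \<longleftrightarrow> finite Q \<and>
     (\<forall>q\<in>Q. critical_config n s q \<and> \<not> collinear_config n q) \<and>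
     (\<forall>q\<in>Q. \<forall>q'\<in>Q. similar n q q' \<longrightarrow> q = q')"

lemma noncollinear_family_insert:
  assumes "noncollinear_family n s Q" "critical_config n s q" "\<not> collinear_config n q"
    and new: "\<And>q'. q' \<in> Q \<Longrightarrow> \<not> similar n q' q"
  shows "noncollinear_family n s (insert q Q)" "card (insert q Q) = card Q + 1"
proof -
  have "q \<notin> Q"
    using new similar_refl by blast
  then show "card (insert q Q) = card Q + 1"
    using assms(1) by (simp add: noncollinear_family_def)
  show "noncollinear_family n s (insert q Q)"
    using assms similar_sym[of n q] unfolding noncollinear_family_def by blast
qed

lemma noncollinear_family_empty: "noncollinear_family n s {}"
  by (simp add: noncollinear_family_def)

lemma symmetric_noncollinear_critical:
  assumes "s > 1" "1 \<le> k" "2 * k \<le> n" "3 \<le> n"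
  obtains q where "critical_config n s q" "\<not> collinear_config n q" "axis_count n q = n - 2 * k"
proof -
  obtain q where q: "critical_config n s q" "q \<in> symmetric_configs n (swap_pairs k)" "\<exists>i<n. ver (q i) \<noteq> 0"
    using symmetric_critical_exists[OF assms] .
  then have "inj_on q {..<n}"
    by (simp add: critical_config_def)
  then show thesis
    using that q axis_count_symmetric[OF assms(3) q(2)] symmetric_not_collinear[OF assms(2,3) q(2)] by blast
qed

text \<open>The last conclusion records the axis counts already taken, so that the induction step
  can see that its new member has a different one.\<close>

lemma noncollinear_family_symmetric:
  assumes s: "s > 1" and n: "3 \<le> n" and K: "1 \<le> K" "2 * K \<le> n"
  obtains Q where "noncollinear_family n s Q" "card Q = K"
    "\<And>q. q \<in> Q \<Longrightarrow> \<exists>k. 1 \<le> k \<and> k \<le> K \<and> axis_count n q = n - 2 * k"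
  using K
proof (induction K arbitrary: thesis rule: nat_induct_at_least)
  case base
  obtain q where q: "critical_config n s q" "\<not> collinear_config n q" "axis_count n q = n - 2 * 1"
    using symmetric_noncollinear_critical[OF s, of 1 n] n by auto
  have "\<exists>k. 1 \<le> k \<and> k \<le> 1 \<and> axis_count n p = n - 2 * k" if "p \<in> {q}" for p
    using that q(3) by (intro exI[of _ 1]) simp
  then show ?case
    using base(1)[of "{q}"] noncollinear_family_insert[OF noncollinear_family_empty q(1,2)] by simp
next
  case (Suc K)
  obtain Q where Q: "noncollinear_family n s Q" "card Q = K"
    "\<And>q. q \<in> Q \<Longrightarrow> \<exists>k. 1 \<le> k \<and> k \<le> K \<and> axis_count n q = n - 2 * k"
    using Suc.IH Suc.prems(2) by auto
  obtain q where q: "critical_config n s q" "\<not> collinear_config n q" "axis_count n q = n - 2 * Suc K"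
    using symmetric_noncollinear_critical[OF s, of "Suc K" n] Suc.prems(2) n by auto
  have new: "\<not> similar n q' q" if q': "q' \<in> Q" for q'
  proof
    assume "similar n q' q"
    then have "axis_count n q = axis_count n q'"
      by (rule similar_axis_count)
    then show False
      using Q(3)[OF q'] q(3) Suc.prems(2) by auto
  qed
  note ins = noncollinear_family_insert[OF Q(1) q(1,2) new]
  have "\<exists>k. 1 \<le> k \<and> k \<le> Suc K \<and> axis_count n p = n - 2 * k" if "p \<in> insert q Q" for p
  proof (cases "p = q")
    case True
    then show ?thesis
      using q(3) by (intro exI[of _ "Suc K"]) simp
  next
    case False
    then show ?thesis
      using Q(3)[of p] that by (meson insertE le_SucI)
  qed
  then show ?case
    using Suc.prems(1)[of "insert q Q"] ins Q(2) by simp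
qed

lemma noncollinear_family_two:
  assumes s: "s > 1" and n: "3 \<le> n"
  obtains Q where "noncollinear_family n s Q" "card Q = 2"
proof (cases "n = 3")
  case True
  obtain q where q: "critical_config 3 s q" "q \<in> symmetric_configs 3 (swap_pairs 1)" "\<exists>i<3. ver (q i) \<noteq> 0"
    using symmetric_critical_exists[OF s, of 1 3] by auto
  have inj: "inj_on q {..<3}" "inj_on (flip q) {..<3}"
    using q(1) critical_config_flip[OF q(1)] by (simp_all add: critical_config_def)
  obtain i where i: "i < 3" "ver (q i) \<noteq> 0"
    using q(3) by blast
  have "\<not> collinear_config 3 q" "\<not> collinear_config 3 (flip q)"
    using symmetric_not_collinear[OF _ _ q(2) inj(1) i]
      symmetric_not_collinear[OF _ _ symmetric_configs_flip[OF q(2)] inj(2) i(1)] i(2) by simp_all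
  note fam = noncollinear_family_insert[OF noncollinear_family_empty q(1) this(1)]
    and this
  have "noncollinear_family 3 s {flip q, q}" "card {flip q, q} = 2"
    using noncollinear_family_insert[OF fam(1) critical_config_flip[OF q(1)] \<open>\<not> collinear_config 3 (flip q)\<close>]
      three_body_not_similar_flip[OF q] fam(2) by simp_all
  then show thesis
    using that True by blast
next
  case False
  then show thesis
    using noncollinear_family_symmetric[OF s n, of 2] n that by force
qed

text \<open>The kite and its reflection have n - 2 bodies on the axis; the third member, with two
  swapped pairs, has n - 4.\<close>

lemma noncollinear_family_kite:
  assumes s: "s > 1" and n: "4 \<le> n" and q: "critical_config n s q" "q \<in> symmetric_configs n (swap_pairs 1)"
    and flip: "\<not> similar n q (flip q)"
  obtains Q where "noncollinear_family n s Q" "card Q = 3"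
proof -
  have crit: "critical_config n s (flip q)" and sym: "flip q \<in> symmetric_configs n (swap_pairs 1)"
    using critical_config_flip symmetric_configs_flip q by blast+
  have inj: "inj_on q {..<n}" "inj_on (flip q) {..<n}"
    using q(1) crit by (simp_all add: critical_config_def)
  have nc: "\<not> collinear_config n p" "axis_count n p = n - 2"
    if p: "p \<in> symmetric_configs n (swap_pairs 1)" "inj_on p {..<n}" for p
  proof -
    show "\<not> collinear_config n p"
      using symmetric_two_axis_points[OF _ p] symmetric_not_collinear[OF _ _ p] n by auto
    show "axis_count n p = n - 2"
      using axis_count_symmetric[OF _ p] n by simp
  qed
  obtain p where p: "critical_config n s p" "\<not> collinear_config n p" "axis_count n p = n - 2 * 2"
    using symmetric_noncollinear_critical[OF s, of 2 n] n by auto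
  note 1 = noncollinear_family_insert[OF noncollinear_family_empty p(1,2), simplified]
  have "\<not> similar n p q" "\<not> similar n p (flip q)"
    using similar_axis_count[of n p] nc(2)[OF q(2) inj(1)] nc(2)[OF sym inj(2)] p(3) n by force+
  moreover from this(1) have "noncollinear_family n s {q, p}" "card {q, p} = 2"
    using noncollinear_family_insert[OF 1(1) q(1) nc(1)[OF q(2) inj(1)]] 1(2) by simp_all
  ultimately have "noncollinear_family n s {flip q, q, p}" "card {flip q, q, p} = 3"
    using noncollinear_family_insert[OF _ crit nc(1)[OF sym inj(2)], of "{q, p}"] flip by auto
  then show thesis
    using that by blast
qed

lemma noncollinear_family_three:
  assumes s: "s > 1" and n: "6 \<le> n \<or> 4 \<le> n \<and> s \<ge> 12 / 5"
  obtains Q where "noncollinear_family n s Q" "card Q = 3"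
proof -
  consider "6 \<le> n" | "n = 4" "s \<ge> 12 / 5" | "n = 5" "s \<ge> 12 / 5"
    using n by linarith
  then show thesis
  proof cases
    case 1
    then show thesis
      using noncollinear_family_symmetric[OF s, of n 3] that by auto
  next
    case 2
    obtain q where q: "critical_config 4 s q" "q \<in> symmetric_configs 4 (swap_pairs 1)"
      "ver (q 3) < ver (q 2)" "ver (q 2) < ver (q 0)"
      using four_body_end_kite[OF 2(2)] .
    then have "\<not> similar 4 q (flip q)"
      using four_body_end_kite_not_similar_flip by (simp add: critical_config_def)
    then show thesis
      using noncollinear_family_kite[OF s _ q(1,2)] that 2(1) by auto
  next
    case 3
    obtain q where "critical_config 5 s q" "q \<in> symmetric_configs 5 (swap_pairs 1)" "\<not> similar 5 q (flip q)"
      using five_body_asymmetric_kite[OF 3(2)] .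
    then show thesis
      using noncollinear_family_kite[OF s, of 5 q] that 3(1) by auto
  qed
qed

section \<open>Collinear configurations and the spectral bound\<close>

lemma symmetric_form_min_eigenvector:
  fixes a :: "nat \<Rightarrow> nat \<Rightarrow> real"
  assumes n: "n > 0" and sym: "\<And>i j. i < n \<Longrightarrow> j < n \<Longrightarrow> a i j = a j i"
  obtains \<kappa> w where "\<exists>i<n. w i \<noteq> 0" "\<forall>i<n. (\<Sum>j<n. a i j * w j) = \<kappa> * w i"
    "\<forall>v. \<kappa> * (\<Sum>i<n. (v i)\<^sup>2) \<le> (\<Sum>i<n. v i * (\<Sum>j<n. a i j * v j))"
proof -
  define Q where "Q v = (\<Sum>i<n. v i * (\<Sum>j<n. a i j * v j))" for v :: "nat \<Rightarrow> real"
  define N where "N v = (\<Sum>i<n. (v i)\<^sup>2)" for v :: "nat \<Rightarrow> real"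
  \<comment> \<open>Coordinates from n on do not affect the forms; the box merely bounds them, so
    that \<open>K\<close> is compact in the product topology.\<close>
  define K where "K = {w :: nat \<Rightarrow> real. \<forall>i. norm (w i) \<le> 1} \<inter> {w. N w = 1}"
  have coord: "continuous_on A (\<lambda>w :: nat \<Rightarrow> real. w i)" for A i
    by (rule continuous_on_subset[OF continuous_on_product_coordinates]) simp
  have "compact K"
    unfolding K_def N_def
    by (intro compact_Int_closed compact_coordinate_box closed_Collect_eq continuous_intros coord)
  moreover have "K \<noteq> {}"
  proof -
    have "N (\<lambda>i. if i = 0 then 1 else 0) = 1"
      using n by (simp add: N_def if_distrib[of "\<lambda>x. x\<^sup>2"] sum.delta cong: if_cong)
    then have "(\<lambda>i. if i = 0 then 1 else 0) \<in> K"
      by (simp add: K_def)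
    then show ?thesis
      by blast
  qed
  moreover have "continuous_on K Q"
    unfolding Q_def by (intro continuous_intros coord)
  ultimately obtain w where w: "w \<in> K" "\<And>v. v \<in> K \<Longrightarrow> Q w \<le> Q v"
    using continuous_attains_inf[of K Q] by blast
  define \<kappa> where "\<kappa> = Q w"
  have Nw: "N w = 1"
    using w(1) by (simp add: K_def)
  have scale: "Q (\<lambda>i. c * v i) = c\<^sup>2 * Q v" "N (\<lambda>i. c * v i) = c\<^sup>2 * N v" for c v
    by (simp_all add: Q_def N_def sum_distrib_left power2_eq_square algebra_simps)
  have le: "\<kappa> * N v \<le> Q v" for v
  proof (cases "N v = 0")
    case True
    then have "v i = 0" if "i < n" for i
      using that by (simp add: N_def sum_nonneg_eq_0_iff)
    then show ?thesis
      using True by (simp add: Q_def)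
  next
    case False
    then have pos: "N v > 0"
      by (simp add: N_def sum_nonneg less_le)
    define c where "c = 1 / sqrt (N v)"
    have c: "c\<^sup>2 * N v = 1" "c\<^sup>2 > 0"
      using pos by (simp_all add: c_def power_divide)
    define u where "u i = (if i < n then c * v i else 0)" for i
    have "Q u = Q (\<lambda>i. c * v i)" "N u = N (\<lambda>i. c * v i)"
      by (simp_all add: Q_def N_def u_def)
    then have u: "Q u = c\<^sup>2 * Q v" "N u = 1"
      by (simp_all only: scale c(1))
    have "\<bar>u i\<bar> \<le> 1" for i
    proof (cases "i < n")
      case True
      then have "(u i)\<^sup>2 \<le> N u"
        unfolding N_def by (intro member_le_sum) auto
      then show ?thesis
        using u(2) by (simp add: abs_square_le_1)
    qed (simp add: u_def)
    then have "\<kappa> \<le> c\<^sup>2 * Q v"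
      using w(2)[of u] u by (simp add: K_def \<kappa>_def)
    then have "c\<^sup>2 * (\<kappa> * N v) \<le> c\<^sup>2 * Q v"
      using c(1) by (simp add: mult.left_commute)
    then show ?thesis
      using c(2) by simp
  qed
  \<comment> \<open>Half the gradient at \<open>w\<close> of the nonnegative form
    \<open>Q v - \<kappa> * N v\<close>, which vanishes at \<open>w\<close>.\<close>
  define f where "f i = (\<Sum>j<n. a i j * w j) - \<kappa> * w i" for i
  have expand: "Q (\<lambda>i. w i + t * v i) - \<kappa> * N (\<lambda>i. w i + t * v i)
      = 2 * t * (\<Sum>i<n. f i * v i) + t\<^sup>2 * (Q v - \<kappa> * N v)" for t v
  proof -
    have "(\<Sum>i<n. w i * (\<Sum>j<n. a i j * v j)) = (\<Sum>j<n. \<Sum>i<n. w i * (a i j * v j))"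
      unfolding sum_distrib_left by (rule sum.swap)
    also have "\<dots> = (\<Sum>i<n. v i * (\<Sum>j<n. a i j * w j))"
      unfolding sum_distrib_left by (intro sum.cong refl) (use sym in \<open>auto simp: algebra_simps\<close>)
    finally have cross: "(\<Sum>i<n. w i * (\<Sum>j<n. a i j * v j)) = (\<Sum>i<n. v i * (\<Sum>j<n. a i j * w j))" .
    have 1: "Q (\<lambda>i. w i + t * v i) = Q w + t * (\<Sum>i<n. w i * (\<Sum>j<n. a i j * v j))
        + t * (\<Sum>i<n. v i * (\<Sum>j<n. a i j * w j)) + t\<^sup>2 * Q v"
      unfolding Q_def by (simp add: algebra_simps sum.distrib sum_distrib_left power2_eq_square)
    have 2: "N (\<lambda>i. w i + t * v i) = N w + 2 * t * (\<Sum>i<n. w i * v i) + t\<^sup>2 * N v"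
      unfolding N_def by (simp add: algebra_simps sum.distrib sum_distrib_left power2_eq_square)
    have 3: "(\<Sum>i<n. f i * v i) = (\<Sum>i<n. v i * (\<Sum>j<n. a i j * w j)) - \<kappa> * (\<Sum>i<n. w i * v i)"
      unfolding f_def sum_distrib_left[of \<kappa>] sum_subtractf[symmetric]
      by (intro sum.cong refl) (simp add: algebra_simps)
    show ?thesis
      unfolding 1 2 3 cross Nw by (simp add: \<kappa>_def algebra_simps)
  qed
  have f: "f i = 0" if "i < n" for i
  proof (rule ccontr)
    assume "f i \<noteq> 0"
    define F where "F = N f"
    have "F > 0"
      unfolding F_def N_def using that \<open>f i \<noteq> 0\<close> by (intro sum_pos2[of _ i]) auto
    define G where "G = Q f - \<kappa> * F"
    have G: "G \<ge> 0"
      using le[of f] by (simp add: G_def F_def)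
    have nonneg: "0 \<le> 2 * t * F + t\<^sup>2 * G" for t
      using expand[of t f] le[of "\<lambda>i. w i + t * f i"] by (simp add: F_def G_def N_def power2_eq_square)
    \<comment> \<open>For small negative t the linear term would dominate; t = - T gives the
      explicit negative value -T^2 (G + 2).\<close>
    define T where "T = F / (G + 1)"
    have T: "T > 0" "F = T * (G + 1)"
      using \<open>F > 0\<close> G by (simp_all add: T_def)
    have "0 \<le> 2 * (- T) * F + (- T)\<^sup>2 * G"
      by (rule nonneg)
    also have "\<dots> = - (T\<^sup>2 * (G + 2))"
      by (subst T(2)) (simp add: power2_eq_square algebra_simps)
    also have "\<dots> < 0"
      using T(1) G by simp
    finally show False by simp
  qed
  have "\<exists>i<n. w i \<noteq> 0"
  proof (rule ccontr)
    assume "\<not> ?thesis"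
    then have "N w = 0"
      by (simp add: N_def)
    then show False
      using Nw by simp
  qed
  moreover have "\<forall>i<n. (\<Sum>j<n. a i j * w j) = \<kappa> * w i"
    using f by (simp add: f_def)
  ultimately show thesis
    using that[of w \<kappa>] le unfolding Q_def N_def by blast
qed

text \<open>The two auxiliary inequalities give the factors 5/4 and 2, and 12/5 * 5/4 = 3/2 * 2.
  Both are equalities for \<open>g = h\<close>, the equally spaced triple, so 12/5 cannot be
  improved here.\<close>

lemma three_gap_inequality:
  fixes g h \<mu> :: real
  assumes g: "g > 0" "h > 0" and le: "\<mu> * (g + h) \<le> 1 / g\<^sup>2 + 1 / h\<^sup>2 + 2 / (g + h)\<^sup>2"
  shows "12 / 5 * \<mu> \<le> 3 / 2 * (1 / g ^ 3 + 1 / h ^ 3)"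
proof -
  have "8 * (g\<^sup>2 * h\<^sup>2) \<le> (g\<^sup>2 + h\<^sup>2) * (g + h)\<^sup>2"
  proof -
    have "(g\<^sup>2 + h\<^sup>2) * (g + h)\<^sup>2 - 8 * (g\<^sup>2 * h\<^sup>2)
        = (g\<^sup>2 + h\<^sup>2) * (g - h)\<^sup>2 + 4 * (g * h) * (g - h)\<^sup>2"
      by (simp add: power2_eq_square algebra_simps)
    also have "\<dots> \<ge> 0"
      using g by simp
    finally show ?thesis by simp
  qed
  then have 1: "2 / (g + h)\<^sup>2 \<le> 1 / 4 * (1 / g\<^sup>2 + 1 / h\<^sup>2)"
    using g by (simp add: divide_simps) (simp add: algebra_simps)
  have 2: "2 * (1 / g\<^sup>2 + 1 / h\<^sup>2) \<le> (1 / g ^ 3 + 1 / h ^ 3) * (g + h)"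
  proof -
    have "(1 / g ^ 3 + 1 / h ^ 3) * (g + h) - 2 * (1 / g\<^sup>2 + 1 / h\<^sup>2)
        = (g - h)\<^sup>2 * (g\<^sup>2 + g * h + h\<^sup>2) / (g ^ 3 * h ^ 3)"
      using g by (simp add: divide_simps) (simp add: power2_eq_square power3_eq_cube algebra_simps)
    also have "\<dots> \<ge> 0"
      using g by simp
    finally show ?thesis by simp
  qed
  have "12 / 5 * \<mu> * (g + h) \<le> 12 / 5 * (5 / 4 * (1 / g\<^sup>2 + 1 / h\<^sup>2))"
    using le 1 by simp
  also have "\<dots> = 3 / 2 * (2 * (1 / g\<^sup>2 + 1 / h\<^sup>2))"
    by simp
  also have "\<dots> \<le> 3 / 2 * ((1 / g ^ 3 + 1 / h ^ 3) * (g + h))"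
    using 2 by (rule mult_left_mono) simp
  also have "\<dots> = 3 / 2 * (1 / g ^ 3 + 1 / h ^ 3) * (g + h)"
    by (simp only: mult.assoc)
  finally show ?thesis
    using g by (simp add: mult_le_cancel_right)
qed

section \<open>Collinear central configurations with equal masses\<close>

locale collinear_central_configuration =
  fixes n :: nat and m :: "nat \<Rightarrow> real" and m0 :: real and qhat :: "2 config"
  assumes n: "n \<ge> 3" and m0: "m0 > 0" and m: "\<And>i. i < n \<Longrightarrow> m i = m0"
    and CC: "collinear_CC n m qhat"
begin

abbreviation U :: real where
  "U \<equiv> potential n m qhat"

lemma qhat_inj: "inj_on qhat {..<n}"
  using CC by (auto simp: collinear_CC_def collisions_def inj_on_def)

lemma potential_pos: "U > 0"
proof -
  have "0 < (\<Sum>i<n. \<Sum>j<n. m i * m j / norm (qhat i - qhat j))"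
  proof (rule sum_pos2[of _ 0])
    have "qhat 0 \<noteq> qhat 1"
      using inj_onD[OF qhat_inj, of 0 1] n by auto
    then show "0 < (\<Sum>j<n. m 0 * m j / norm (qhat 0 - qhat j))"
      using n m m0 by (intro sum_pos2[of _ 1]) auto
  qed (use n m m0 in \<open>auto intro!: sum_nonneg\<close>)
  then show ?thesis
    by (simp add: potential_double_sum)
qed

text \<open>Pairing the balance equation with \<open>qhat\<close> identifies the multiplier: the
  potential is homogeneous of degree -1 and the inertia is normalized to 1.\<close>

lemma qhat_balance:
  assumes i: "i < n"
  shows "(U / m0) *\<^sub>R qhat i = repulsion n qhat i"
proof -
  obtain l where l: "balance_equations n m (Finite_Cartesian_Product.mat 1) l qhat"
    using CC by (auto simp: collinear_CC_def)
  have eq: "(l / m0) *\<^sub>R qhat i = repulsion n qhat i" if "i < n" for i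
  proof -
    have "(l * m0) *\<^sub>R qhat i = (\<Sum>j<n. (m i * m j / norm (qhat i - qhat j) ^ 3) *\<^sub>R (qhat i - qhat j))"
      using spec[OF l[unfolded balance_equations_iff[OF qhat_inj]], of i] that
      by (simp only: m[OF that, symmetric] matrix_vector_mul_lid simp_thms)
    also have "\<dots> = (\<Sum>j<n. (m0 * m0) *\<^sub>R ((1 / norm (qhat i - qhat j) ^ 3) *\<^sub>R (qhat i - qhat j)))"
      using m that by (intro sum.cong) auto
    also have "\<dots> = (m0 * m0) *\<^sub>R repulsion n qhat i"
      by (simp add: repulsion_def scaleR_right.sum)
    finally have "(1 / (m0 * m0)) *\<^sub>R (l * m0) *\<^sub>R qhat i = repulsion n qhat i"
      using m0 by simp
    then show ?thesis
      using m0 by simp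
  qed
  have norm1: "m0 * (\<Sum>i<n. (norm (qhat i))\<^sup>2) = 1"
    using CC m by (simp add: collinear_CC_def sum_distrib_left)
  have "l = l * (m0 * (\<Sum>i<n. (norm (qhat i))\<^sup>2))"
    using norm1 by simp
  also have "\<dots> = m0\<^sup>2 * (l / m0 * (\<Sum>i<n. (norm (qhat i))\<^sup>2))"
    using m0 by (simp add: power2_eq_square)
  also have "\<dots> = m0\<^sup>2 * (\<Sum>i<n. ((l / m0) *\<^sub>R qhat i) \<bullet> qhat i)"
    by (simp only: sum_distrib_left[of "l / m0"] inner_scaleR_left power2_norm_eq_inner)
  also have "\<dots> = m0\<^sup>2 * (\<Sum>i<n. repulsion n qhat i \<bullet> qhat i)"
    by (simp add: eq)
  also have "\<dots> = U"
  proof -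
    have "((qhat i - qhat j) \<bullet> (qhat i - qhat j)) / norm (qhat i - qhat j) ^ 3 = 1 / norm (qhat i - qhat j)" for i j
      by (cases "qhat i = qhat j") (simp_all add: dot_square_norm power2_eq_square power3_eq_cube)
    then have rep: "(\<Sum>i<n. repulsion n qhat i \<bullet> qhat i) = (\<Sum>i<n. \<Sum>j<n. 1 / norm (qhat i - qhat j)) / 2"
      unfolding sum_repulsion_inner by simp
    have pot: "U = m0\<^sup>2 * (\<Sum>i<n. \<Sum>j<n. 1 / norm (qhat i - qhat j)) / 2"
      unfolding potential_double_sum using m by (simp add: power2_eq_square sum_distrib_left)
    show ?thesis
      unfolding rep pot by simp
  qed
  finally show ?thesis
    using eq[OF i] by simp
qed

text \<open>Signed coordinates along a unit vector leave a scalar equation that can be transplanted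
  to either coordinate axis.\<close>

lemma qhat_line:
  "\<exists>c. inj_on c {..<n} \<and> (\<forall>i<n. \<forall>j<n. norm (qhat i - qhat j) = \<bar>c i - c j\<bar>) \<and>
    (\<forall>i<n. U / m0 * c i = (\<Sum>j<n. (c i - c j) / \<bar>c i - c j\<bar> ^ 3))"
proof -
  obtain L where L: "subspace L" "dim L = 1" "\<forall>i<n. qhat i \<in> L"
    using CC by (auto simp: collinear_CC_def collinear_config_def)
  obtain B where B: "independent B" "L \<subseteq> span B" "card B = dim L"
    using basis_exists by metis
  then obtain u where u: "B = {u}"
    using L(2) by (auto simp: card_1_singleton_iff)
  have "u \<noteq> 0"
    using B(1) u dependent_zero by auto
  have "\<exists>k. qhat i = k *\<^sub>R u" if "i < n" for i
    using L(3) B(2) u that by (auto simp: span_singleton)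
  then obtain k where k: "\<And>i. i < n \<Longrightarrow> qhat i = k i *\<^sub>R u"
    by metis
  define e where "e = (1 / norm u) *\<^sub>R u"
  define c where "c i = k i * norm u" for i
  have e: "norm e = 1" and q: "\<And>i. i < n \<Longrightarrow> qhat i = c i *\<^sub>R e"
    using \<open>u \<noteq> 0\<close> k by (simp_all add: e_def c_def)
  have diff: "qhat i - qhat j = (c i - c j) *\<^sub>R e" if "i < n" "j < n" for i j
    using q that by (simp add: scaleR_left_diff_distrib)
  show ?thesis
  proof (intro exI[of _ c] conjI allI impI)
    show "norm (qhat i - qhat j) = \<bar>c i - c j\<bar>" if "i < n" "j < n" for i j
      using diff[OF that] e by simp
    show "inj_on c {..<n}"
      using qhat_inj q by (auto simp: inj_on_def)
    show "U / m0 * c i = (\<Sum>j<n. (c i - c j) / \<bar>c i - c j\<bar> ^ 3)" if i: "i < n" for i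
    proof -
      have "(U / m0 * c i) *\<^sub>R e = repulsion n qhat i"
        unfolding qhat_balance[OF i, symmetric] q[OF i] by simp
      also have "\<dots> = (\<Sum>j<n. ((c i - c j) / \<bar>c i - c j\<bar> ^ 3) *\<^sub>R e)"
        unfolding repulsion_def using diff[OF i] e by (intro sum.cong) auto
      also have "\<dots> = (\<Sum>j<n. (c i - c j) / \<bar>c i - c j\<bar> ^ 3) *\<^sub>R e"
        by (simp add: scaleR_left.sum)
      finally show ?thesis
        unfolding scaleR_cancel_right using e by auto
    qed
  qed
qed

text \<open>The lower bound is attained for \<open>n = 3\<close>. It comes from the Rayleigh quotient of
  \<open>(1, -2, 1)\<close> on three consecutive bodies at the end of the line.\<close>

lemma small_eigenvalue:
  obtains \<kappa> where "Char_Poly.eigenvalue (mat_diag n (\<lambda>i. inverse (m i)) * B_matrix n m qhat) \<kappa>"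
    "\<kappa> \<le> - (12 / 5 * U)"
proof -
  obtain c where c: "inj_on c {..<n}"
    and "\<forall>i<n. \<forall>j<n. norm (qhat i - qhat j) = \<bar>c i - c j\<bar>"
    and "\<forall>i<n. U / m0 * c i = (\<Sum>j<n. (c i - c j) / \<bar>c i - c j\<bar> ^ 3)"
    using qhat_line by blast
  then have dist: "\<And>i j. i < n \<Longrightarrow> j < n \<Longrightarrow> norm (qhat i - qhat j) = \<bar>c i - c j\<bar>"
    and bal: "\<And>i. i < n \<Longrightarrow> U / m0 * c i = (\<Sum>j<n. (c i - c j) / \<bar>c i - c j\<bar> ^ 3)"
    by blast+
  define A where "A = mat_diag n (\<lambda>i. inverse (m i)) * B_matrix n m qhat"
  \<comment> \<open>One mass factor cancels against the inverse mass. Since \<open>b i i = 0\<close>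
    by division by zero, sums may include the diagonal.\<close>
  define b where "b i j = m0 / \<bar>c i - c j\<bar> ^ 3" for i j
  define a where "a i j = (if i = j then - (\<Sum>k<n. b i k) else b i j)" for i j
  have b: "b i j = b j i" "b i j \<ge> 0" "b i i = 0" for i j
    using m0 by (simp_all add: b_def abs_minus_commute)
  have A: "A = Matrix.mat n n (\<lambda>(i, j). a i j)"
  proof -
    have entry: "inverse (m i) * B_entry m qhat i j = b i j" if "i < n" "j < n" for i j
      using m m0 that dist by (simp add: B_entry_def b_def)
    have B: "B_matrix n m qhat \<in> carrier_mat n n"
      by (simp add: B_matrix_def)
    show ?thesis
    proof (rule eq_matI)
      fix i j assume "i < dim_row (Matrix.mat n n (\<lambda>(i, j). a i j))" "j < dim_col (Matrix.mat n n (\<lambda>(i, j). a i j))"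
      then have ij: "i < n" "j < n" by auto
      have "(\<Sum>k\<in>{..<n} - {i}. inverse (m i) * B_entry m qhat i k) = (\<Sum>k\<in>{..<n} - {i}. b i k)"
        using entry ij by (intro sum.cong) auto
      also have "\<dots> = (\<Sum>k<n. b i k)"
        using ij b(3) by (simp add: sum.remove[of "{..<n}" i])
      finally have "inverse (m i) * (\<Sum>k\<in>{..<n} - {i}. B_entry m qhat i k) = (\<Sum>k<n. b i k)"
        by (simp add: sum_distrib_left)
      then show "A $$ (i, j) = Matrix.mat n n (\<lambda>(i, j). a i j) $$ (i, j)"
        using ij entry[OF ij] unfolding A_def mat_diag_mult_left[OF B]
        by (auto simp: B_matrix_def a_def)
    qed (simp_all add: A_def mat_diag_mult_left[OF B])
  qed
  have form: "(\<Sum>j<n. a i j * v j) = (\<Sum>j<n. b i j * (v j - v i))" if "i < n" for i v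
  proof -
    have "(\<Sum>j<n. a i j * v j) = a i i * v i + (\<Sum>j\<in>{..<n} - {i}. b i j * v j)"
      using that by (simp add: sum.remove[of "{..<n}" i] a_def)
    also have "(\<Sum>j\<in>{..<n} - {i}. b i j * v j) = (\<Sum>j<n. b i j * v j)"
      using that b(3) by (simp add: sum.remove[of "{..<n}" i])
    finally show ?thesis
      by (simp add: a_def right_diff_distrib sum_subtractf sum_distrib_right)
  qed
  have quad: "(\<Sum>i<n. v i * (\<Sum>j<n. a i j * v j)) = - (\<Sum>i<n. \<Sum>j<n. b i j * (v i - v j)\<^sup>2) / 2" for v
  proof -
    have "(\<Sum>i<n. \<Sum>j<n. b i j * (v j * (v j - v i))) = (\<Sum>i<n. \<Sum>j<n. b i j * (v i * (v i - v j)))"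
      by (subst sum.swap) (simp add: b(1))
    moreover have "(v i - v j)\<^sup>2 = v i * (v i - v j) + v j * (v j - v i)" for i j
      by (simp add: power2_eq_square algebra_simps)
    ultimately have "(\<Sum>i<n. \<Sum>j<n. b i j * (v i - v j)\<^sup>2) = 2 * (\<Sum>i<n. \<Sum>j<n. b i j * (v i * (v i - v j)))"
      by (simp add: distrib_left sum.distrib)
    moreover have "(\<Sum>i<n. v i * (\<Sum>j<n. a i j * v j)) = (\<Sum>i<n. v i * (\<Sum>j<n. b i j * (v j - v i)))"
      by (simp add: form)
    moreover have "\<dots> = - (\<Sum>i<n. \<Sum>j<n. b i j * (v i * (v i - v j)))"
      by (simp add: sum_distrib_left sum_negf[symmetric] algebra_simps)
    ultimately show ?thesis
      by simp
  qed
  have sym: "a i j = a j i" for i j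
    by (simp add: a_def b(1)[of i j])
  have "n > 0"
    using n by simp
  then obtain \<kappa> w where w: "\<exists>i<n. w i \<noteq> 0" and ev: "\<forall>i<n. (\<Sum>j<n. a i j * w j) = \<kappa> * w i"
    and min: "\<forall>v. \<kappa> * (\<Sum>i<n. (v i)\<^sup>2) \<le> (\<Sum>i<n. v i * (\<Sum>j<n. a i j * v j))"
    by (rule symmetric_form_min_eigenvector[OF _ sym])
  have "Char_Poly.eigenvalue A \<kappa>"
  proof -
    define z where "z = Matrix.vec n w"
    have "A *\<^sub>v z = \<kappa> \<cdot>\<^sub>v z"
      by (rule eq_vecI) (use ev in \<open>auto simp: A z_def scalar_prod_def lessThan_atLeast0\<close>)
    moreover have "z \<noteq> 0\<^sub>v n"
    proof
      assume "z = 0\<^sub>v n"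
      moreover obtain i where "i < n" "w i \<noteq> 0"
        using w by blast
      ultimately show False
        by (metis index_vec index_zero_vec(1) z_def)
    qed
    ultimately show ?thesis
      unfolding eigenvalue_def eigenvector_def by (intro exI[of _ z]) (simp add: A z_def)
  qed
  moreover have "\<kappa> \<le> - (12 / 5 * U)"
  proof -
    have minex: "\<exists>i\<in>X. \<forall>p\<in>X. c i \<le> c p" if "X \<noteq> {}" "finite X" for X
      using that by (metis arg_min_if_finite(1) arg_min_least)
    have "{..<n} \<noteq> {}"
      using n by (simp add: lessThan_empty_iff)
    then obtain i where i: "i \<in> {..<n}" "\<And>p. p \<in> {..<n} \<Longrightarrow> c i \<le> c p"
      using minex[of "{..<n}"] by blast
    have "card ({..<n} - {i}) > 0"
      using i(1) n by simp
    then obtain j where j: "j \<in> {..<n} - {i}" "\<And>p. p \<in> {..<n} - {i} \<Longrightarrow> c j \<le> c p"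
      using minex[of "{..<n} - {i}"] by (auto simp: card_gt_0_iff)
    have "card ({..<n} - {i, j}) > 0"
      using i(1) j(1) n by (simp add: card_Diff_subset)
    then obtain k where k: "k \<in> {..<n} - {i, j}" "\<And>p. p \<in> {..<n} - {i, j} \<Longrightarrow> c k \<le> c p"
      using minex[of "{..<n} - {i, j}"] by (auto simp: card_gt_0_iff)
    have ijk: "i < n" "j < n" "k < n" "i \<noteq> j" "i \<noteq> k" "j \<noteq> k"
      using i(1) j(1) k(1) by auto
    have less: "c i < c j" "c j < c k"
      using i(2)[of j] j(2)[of k] ijk inj_onD[OF c, of i j] inj_onD[OF c, of j k]
      by (auto simp: less_le)
    define g h where "g = c j - c i" and "h = c k - c j"
    have gh: "g > 0" "h > 0" "c k - c i = g + h"
      using less by (auto simp: g_def h_def)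
    \<comment> \<open>Difference of the balance equations of the third and first body; all other
      bodies lie beyond \<open>k\<close> and only lower it.\<close>
    have "U / m0 * (g + h) = (\<Sum>p<n. (c k - c p) / \<bar>c k - c p\<bar> ^ 3) - (\<Sum>p<n. (c i - c p) / \<bar>c i - c p\<bar> ^ 3)"
      using bal[OF ijk(1)] bal[OF ijk(3)] by (simp add: gh(3)[symmetric] right_diff_distrib)
    also have "\<dots> \<le> (\<Sum>p\<in>{i, j, k}. (c k - c p) / \<bar>c k - c p\<bar> ^ 3 - (c i - c p) / \<bar>c i - c p\<bar> ^ 3)"
    proof (rule force_difference_le)
      fix p assume p: "p \<in> {..<n} - {i, j, k}"
      then have "c k \<noteq> c p"
        using inj_onD[OF c, of k p] ijk by auto
      then show "c p < c i \<or> c k < c p"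
        using k(2)[of p] p by auto
    qed (use ijk less in auto)
    also have "\<dots> = (g + h) / (g + h) ^ 3 + (h / h ^ 3 + g / g ^ 3) + (g + h) / (g + h) ^ 3"
    proof -
      have "(c i - c p) / \<bar>c i - c p\<bar> ^ 3 = - ((c p - c i) / \<bar>c p - c i\<bar> ^ 3)" for p
        by (simp add: abs_minus_commute[of "c i"] minus_divide_left)
      moreover have "c j - c i = g" "c k - c i = g + h" "c k - c j = h"
        by (simp_all add: g_def h_def)
      ultimately show ?thesis
        using ijk gh(1,2) by simp (simp add: g_def)
    qed
    also have "\<dots> = 1 / g\<^sup>2 + 1 / h\<^sup>2 + 2 / (g + h)\<^sup>2"
    proof -
      have "x / x ^ 3 = 1 / x\<^sup>2" for x :: real
        by (simp add: power2_eq_square power3_eq_cube)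
      then show ?thesis
        by simp
    qed
    finally have "12 / 5 * (U / m0) \<le> 3 / 2 * (1 / g ^ 3 + 1 / h ^ 3)"
      by (rule three_gap_inequality[OF gh(1,2)])
    then have gap: "12 / 5 * U \<le> 3 / 2 * (m0 / g ^ 3 + m0 / h ^ 3)"
      using m0 by (simp add: field_simps)
    \<comment> \<open>The squared norm is 6 and neighbours differ by 3, so the quotient is at most -
      9/6 times the sum of the two neighbour couplings.\<close>
    define v where "v p = (if p = i \<or> p = k then 1 else if p = j then - 2 else 0 :: real)" for p
    have "(\<Sum>p<n. (v p)\<^sup>2) = (\<Sum>p\<in>{i, j, k}. (v p)\<^sup>2)"
      using ijk by (intro sum.mono_neutral_right) (auto simp: v_def)
    then have N: "(\<Sum>p<n. (v p)\<^sup>2) = 6"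
      using ijk by (simp add: v_def)
    define H where "H = {(i, j), (j, i), (j, k), (k, j)}"
    have "(\<Sum>(p, r)\<in>H. b p r * (v p - v r)\<^sup>2) \<le> (\<Sum>(p, r)\<in>{..<n} \<times> {..<n}. b p r * (v p - v r)\<^sup>2)"
      using ijk b(2) by (intro sum_mono2) (auto simp: H_def)
    moreover have "(\<Sum>(p, r)\<in>H. b p r * (v p - v r)\<^sup>2) = 18 * (b i j + b j k)"
      using ijk by (simp add: H_def v_def b(1)[of j i] b(1)[of k j])
    moreover have "b i j = m0 / g ^ 3" "b j k = m0 / h ^ 3"
      using less by (simp_all add: b_def g_def h_def abs_if)
    ultimately have "18 * (m0 / g ^ 3 + m0 / h ^ 3) \<le> (\<Sum>p<n. \<Sum>r<n. b p r * (v p - v r)\<^sup>2)"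
      by (simp add: sum.cartesian_product)
    then have "\<kappa> * 6 \<le> - 9 * (m0 / g ^ 3 + m0 / h ^ 3)"
      using min[rule_format, of v] unfolding N quad by simp
    then show ?thesis
      using gap by simp
  qed
  ultimately show thesis
    using that by (simp add: A_def)
qed

text \<open>As 12/5 > 1, the eigenvalue from \<open>small_eigenvalue\<close> is neither 0 nor - U,
  so it occurs among the \<eta>, the smallest of which is \<open>\<eta> k\<close>.\<close>

lemma last_eigenvalue_le:
  assumes "remaining_eigenvalues n m qhat k \<eta>"
  shows "12 / 5 \<le> - (\<eta> k / U)"
proof -
  obtain \<kappa> where \<kappa>: "Char_Poly.eigenvalue (mat_diag n (\<lambda>i. inverse (m i)) * B_matrix n m qhat) \<kappa>"
    "\<kappa> \<le> - (12 / 5 * U)"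
    by (rule small_eigenvalue)
  have "\<kappa> \<noteq> 0" "\<kappa> \<noteq> - U"
    using \<kappa>(2) potential_pos by auto
  then obtain j where j: "j \<in> {1..k}" "\<kappa> = \<eta> j"
    using assms \<kappa>(1) unfolding remaining_eigenvalues_def by blast
  have "\<eta> k \<le> \<eta> j"
    using assms j(1) unfolding remaining_eigenvalues_def by (cases "j = k") (auto intro: less_imp_le)
  then have "\<eta> k \<le> - (12 / 5 * U)"
    using j(2) \<kappa>(2) by simp
  then show ?thesis
    using potential_pos by (simp add: field_simps)
qed

text \<open>\<open>S\<close> acts as 1 on the vertical and as \<open>s\<close> on the horizontal
  axis, so one profile serves both after dividing the multiplier by \<open>s\<close>. The axis
  counts show the two to be dissimilar.\<close>

lemma collinear_balanced:
  assumes s: "s > 0"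
  obtains v h where "balanced n (aniso s) v" "collinear_config n v" "axis_count n v = n"
    "balanced n (aniso s) h" "collinear_config n h" "axis_count n h \<le> 1"
proof -
  obtain c where c: "inj_on c {..<n}"
    and "\<forall>i<n. U / m0 * c i = (\<Sum>j<n. (c i - c j) / \<bar>c i - c j\<bar> ^ 3)"
    using qhat_line by blast
  then have bal: "\<And>i. i < n \<Longrightarrow> U / m0 * c i = (\<Sum>j<n. (c i - c j) / \<bar>c i - c j\<bar> ^ 3)"
    by blast
  define v h where "v i = (if i < n then point 0 (c i) else 0)"
    and "h i = (if i < n then point (c i) 0 else 0)" for i
  have \<mu>: "U / m0 > 0" "U / m0 / s > 0"
    using potential_pos m0 s by simp_all
  have rep: "repulsion n v i = point 0 (U / m0 * c i)" "repulsion n h i = point (U / m0 * c i) 0"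
    if "i < n" for i
    using that bal[OF that] by (simp_all add: repulsion_def plane_eq_iff norm_plane v_def h_def)
  have "inj_on v {..<n}" "inj_on h {..<n}"
    using c by (auto simp: inj_on_def v_def h_def plane_eq_iff)
  moreover have "(U / m0) *\<^sub>R (aniso s *v v i) = repulsion n v i"
    "(U / m0 / s) *\<^sub>R (aniso s *v h i) = repulsion n h i" if "i < n" for i
    using that s unfolding rep[OF that] by (simp_all add: v_def h_def aniso_mult plane_eq_iff)
  moreover have "v i = 0" "h i = 0" if "i \<ge> n" for i
    using that by (simp_all add: v_def h_def)
  ultimately have "balanced n (aniso s) v" "balanced n (aniso s) h"
    unfolding balanced_def using \<mu> by blast+
  moreover have "collinear_config n v" "collinear_config n h"
    by (rule collinear_configI[of "point 0 1" n v c], simp_all add: plane_eq_iff v_def)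
      (rule collinear_configI[of "point 1 0" n h c], simp_all add: plane_eq_iff h_def)
  moreover have "axis_count n v = n"
    by (simp add: axis_count_def v_def)
  moreover have "axis_count n h \<le> 1"
  proof -
    have "{i \<in> {..<n}. hor (h i) = 0} = {i \<in> {..<n}. c i = 0}"
      by (auto simp: h_def)
    moreover have "card {i \<in> {..<n}. c i = 0} \<le> 1"
      using card_le_Suc0_iff_eq[of "{i \<in> {..<n}. c i = 0}"] c by (auto simp: inj_on_def)
    ultimately show ?thesis
      by (simp add: axis_count_def)
  qed
  ultimately show thesis
    using that by blast
qed

lemma at_least_from_family:
  assumes s: "s > 1" and Q: "noncollinear_family n s Q" "card Q = N"
    and b: "b \<le> (real N + 2) * fact n" "b' \<le> real N * fact n"
  shows "at_least b {q. is_SBC n m (aniso s) q \<and> planar_config n q}"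
    "at_least b' {q. is_SBC n m (aniso s) q \<and> planar_config n q \<and> \<not> collinear_config n q}"
proof -
  have s0: "s > 0" and n2: "n \<ge> 2"
    using s n by auto
  have planar: "planar_config n q" for q :: "2 config"
    unfolding planar_config_def by (intro exI[of _ UNIV]) (simp add: subspace_UNIV)
  have Qbal: "balanced n (aniso s) q" if "q \<in> Q" for q
    using Q(1) that unfolding noncollinear_family_def critical_config_def balanced_def
    by (intro conjI exI[of _ 1]) auto
  have Qnc: "\<not> collinear_config n q" if "q \<in> Q" for q
    using Q(1) that by (simp add: noncollinear_family_def)
  have Qsim: "q = q'" if "q \<in> Q" "q' \<in> Q" "similar n q q'" for q q'
    using Q(1) that by (simp add: noncollinear_family_def)
  have fin: "finite Q"
    using Q(1) by (simp add: noncollinear_family_def)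
  show "at_least b' {q. is_SBC n m (aniso s) q \<and> planar_config n q \<and> \<not> collinear_config n q}"
    using at_least_SBC_orbits[where m = m and P = "\<lambda>q. planar_config n q \<and> \<not> collinear_config n q"
        and b = b', OF n2 m0 m s0 fin Qbal Qsim]
      planar Qnc similar_collinear[OF similar_sym] b(2) Q(2) by blast
  obtain v h where v: "balanced n (aniso s) v" "collinear_config n v" "axis_count n v = n"
    and h: "balanced n (aniso s) h" "collinear_config n h" "axis_count n h \<le> 1"
    using collinear_balanced[OF s0] .
  have vh: "\<not> similar n v h" "v \<noteq> h"
    using similar_axis_count[of n v h] v(3) h(3) n by auto
  have new: "\<not> similar n v q" "\<not> similar n h q" "v \<noteq> q" "h \<noteq> q" if "q \<in> Q" for q
    using Qnc[OF that] similar_collinear v(2) h(2) by auto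
  have vh': "\<not> similar n h v"
    using vh(1) similar_sym by blast
  have new': "\<not> similar n q v" "\<not> similar n q h" if "q \<in> Q" for q
    using new(1,2)[OF that] similar_sym by blast+
  have card: "card (insert v (insert h Q)) = N + 2"
    using vh(2) new(3,4) fin Q(2) by (subst card_insert_disjoint; force)+
  have fin': "finite (insert v (insert h Q))"
    using fin by simp
  have bal': "balanced n (aniso s) q" if "q \<in> insert v (insert h Q)" for q
    using that v(1) h(1) Qbal by auto
  have sim': "q = q'" if "q \<in> insert v (insert h Q)" "q' \<in> insert v (insert h Q)" "similar n q q'" for q q'
    using that vh vh' new(1,2) new' Qsim by (elim insertE) auto
  show "at_least b {q. is_SBC n m (aniso s) q \<and> planar_config n q}"
  proof (rule at_least_SBC_orbits[where m = m, OF n2 m0 m s0 fin' bal' sim'])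
    show "b \<le> real (card (insert v (insert h Q))) * fact n"
      unfolding card using b(1) by (simp add: add.commute)
  qed (use planar in simp_all)
qed

end

section \<open>The three ranges of the anisotropy\<close>

lemma at_least_superset: "at_least x A \<Longrightarrow> A \<subseteq> B \<Longrightarrow> at_least x B"
  unfolding at_least_def by blast

theorem theorem4p2:
  shows "\<exists>(\<epsilon> :: nat \<Rightarrow> real) (N :: nat). \<epsilon> \<longlonglongrightarrow> 0 \<and>
    (\<forall>(n :: nat) (m :: nat \<Rightarrow> real) (s1 :: real) (S :: real^2^2) (qhat :: 2 config)
        (k :: nat) (\<eta> :: nat \<Rightarrow> real).
      n \<ge> 3 \<and> (\<forall>i<n. m i > 0) \<and> (\<forall>i<n. \<forall>j<n. m i = m j) \<and>
      S = diag (vector [s1, 1]) \<and> s1 > 1 \<and>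
      (\<forall>q. is_SBC n m S q \<longrightarrow> nondegenerate_SBC n m S q) \<and>
      collinear_CC n m qhat \<and> remaining_eigenvalues n m qhat k \<eta>
      \<longrightarrow>
      (1 < s1 \<and> s1 < - (\<eta> 1 / potential n m qhat) \<longrightarrow>
         at_least (3 * fact n - 2 * fact (n - 1)) {q. is_SBC n m S q \<and> planar_config n q} \<and>
         at_least (fact n - 2 * fact (n - 1))
           {q. is_SBC n m S q \<and> planar_config n q \<and> \<not> collinear_config n q}) \<and>
      (- (\<eta> 1 / potential n m qhat) < s1 \<and> s1 < - (\<eta> k / potential n m qhat) \<longrightarrow>
         at_least (4 * fact n - 2 * fact (n - 1)) {q. is_SBC n m S q \<and> planar_config n q} \<and>
         at_least (2 * fact n - 2 * fact (n - 1))
           {q. is_SBC n m S q \<and> planar_config n q \<and> \<not> collinear_config n q} \<and>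
         (n \<ge> N \<longrightarrow>
           at_least ((3 * real n - 2 * (1 + real n powr \<epsilon> n)) * fact (n - 1))
             {q. is_SBC n m S q \<and> \<not> collinear_config n q})) \<and>
      (- (\<eta> k / potential n m qhat) < s1 \<longrightarrow>
         at_least (5 * fact n - 2 * fact (n - 1) - 2) {q. is_SBC n m S q \<and> planar_config n q} \<and>
         at_least (3 * fact n - 2 * fact (n - 1) - 2)
           {q. is_SBC n m S q \<and> planar_config n q \<and> \<not> collinear_config n q}))"
proof (rule exI[of _ "\<lambda>_. 0"], rule exI[of _ 6], intro conjI tendsto_const, intro allI, rule impI, elim conjE)
  fix n m s1 S and qhat :: "2 config" and k \<eta>
  assume n: "n \<ge> 3" and pos: "\<forall>i<n. m i > 0" and eq: "\<forall>i<n. \<forall>j<n. m i = m j"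
    and S: "S = aniso s1" and s: "s1 > 1" and CC: "collinear_CC n m qhat"
    and \<eta>: "remaining_eigenvalues n m qhat k \<eta>"
  let ?P = "{q. is_SBC n m S q \<and> planar_config n q}"
  let ?N = "{q. is_SBC n m S q \<and> planar_config n q \<and> \<not> collinear_config n q}"
  interpret collinear_central_configuration n m "m 0" qhat
  proof
    show "m 0 > 0"
      using pos n by simp
    show "m i = m 0" if "i < n" for i
      using eq[rule_format, of i 0] that n by simp
  qed (fact n CC)+
  have fact_n: "fact n = real n * fact (n - 1)" and fact_pos: "fact (n - 1) > (0 :: real)"
    using n by (simp_all add: fact_reduce)
  obtain Q2 where Q2: "noncollinear_family n s1 Q2" "card Q2 = 2"
    using noncollinear_family_two[OF s n] .
  have two: "at_least b ?P" "at_least b' ?N" if "b \<le> 4 * fact n" "b' \<le> 2 * fact n" for b b'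
    using at_least_from_family[OF s Q2, folded S, of b b'] that by simp_all
  have three: "at_least b ?P" "at_least b' ?N"
    if many: "6 \<le> n \<or> 4 \<le> n \<and> s1 \<ge> 12 / 5" and b: "b \<le> 5 * fact n" "b' \<le> 3 * fact n" for b b'
  proof -
    obtain Q3 where Q3: "noncollinear_family n s1 Q3" "card Q3 = 3"
      using noncollinear_family_three[OF s many] .
    show "at_least b ?P" "at_least b' ?N"
      using at_least_from_family[OF s Q3, folded S, of b b'] b by simp_all
  qed
  have F: "fact n \<ge> (0 :: real)"
    by simp
  have 1: "at_least (3 * fact n - 2 * fact (n - 1)) ?P \<and> at_least (fact n - 2 * fact (n - 1)) ?N"
    using two[of "3 * fact n - 2 * fact (n - 1)" "fact n - 2 * fact (n - 1)"] F fact_pos by linarith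
  have 2: "at_least (4 * fact n - 2 * fact (n - 1)) ?P \<and> at_least (2 * fact n - 2 * fact (n - 1)) ?N"
    using two[of "4 * fact n - 2 * fact (n - 1)" "2 * fact n - 2 * fact (n - 1)"] fact_pos by linarith
  \<comment> \<open>With exponent 0 the bound is (3 n - 4) (n - 1)!, below 3 n!. From n = 6 on three
    classes exist for every s1 > 1, which matters because s1 may be below 12/5 in this
    range.\<close>
  have large: "at_least ((3 * real n - 2 * (1 + real n powr 0)) * fact (n - 1))
      {q. is_SBC n m S q \<and> \<not> collinear_config n q}" if "n \<ge> 6"
  proof -
    have "(3 * real n - 2 * (1 + real n powr 0)) * fact (n - 1) \<le> 3 * fact n"
      using fact_pos n by (simp add: fact_n left_diff_distrib)
    then have "at_least ((3 * real n - 2 * (1 + real n powr 0)) * fact (n - 1)) ?N"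
      using three(2)[of "5 * fact n"] that by simp
    then show ?thesis
      by (rule at_least_superset) blast
  qed
  have 3: "at_least (5 * fact n - 2 * fact (n - 1) - 2) ?P \<and> at_least (3 * fact n - 2 * fact (n - 1) - 2) ?N"
    if "- (\<eta> k / potential n m qhat) < s1"
  proof (cases "n = 3")
    case True
    \<comment> \<open>For n = 3 the claimed numbers are 24 = 4 * 3! and 12 = 2 * 3!, exactly what
      two non-collinear classes provide.\<close>
    have "fact n = (6 :: real)" "fact (n - 1) = (2 :: real)"
      using True by (simp_all add: eval_nat_numeral)
    then show ?thesis
      using two[of "5 * fact n - 2 * fact (n - 1) - 2" "3 * fact n - 2 * fact (n - 1) - 2"] by simp
  next
    case False
    have "s1 \<ge> 12 / 5"
      by (rule order_trans[OF last_eigenvalue_le[OF \<eta>] less_imp_le[OF that]])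
    moreover have "4 \<le> n"
      using False n by simp
    moreover have "5 * fact n - 2 * fact (n - 1) - 2 \<le> (5 * fact n :: real)"
      "3 * fact n - 2 * fact (n - 1) - 2 \<le> (3 * fact n :: real)"
      using fact_pos by linarith+
    ultimately show ?thesis
      using three by blast
  qed
  show "(1 < s1 \<and> s1 < - (\<eta> 1 / potential n m qhat) \<longrightarrow>
         at_least (3 * fact n - 2 * fact (n - 1)) ?P \<and> at_least (fact n - 2 * fact (n - 1)) ?N) \<and>
      (- (\<eta> 1 / potential n m qhat) < s1 \<and> s1 < - (\<eta> k / potential n m qhat) \<longrightarrow>
         at_least (4 * fact n - 2 * fact (n - 1)) ?P \<and> at_least (2 * fact n - 2 * fact (n - 1)) ?N \<and>
         (n \<ge> 6 \<longrightarrow> at_least ((3 * real n - 2 * (1 + real n powr 0)) * fact (n - 1))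
             {q. is_SBC n m S q \<and> \<not> collinear_config n q})) \<and>
      (- (\<eta> k / potential n m qhat) < s1 \<longrightarrow>
         at_least (5 * fact n - 2 * fact (n - 1) - 2) ?P \<and>
         at_least (3 * fact n - 2 * fact (n - 1) - 2) ?N)"
    using 1 2 3 large by blast
qed

end
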